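(* Let $r$ be a graphon with $\log r,\ \log(1-r)\in L^1([0,1]^2)$, and let $(r_N)_{N\in\mathbb N}$ be graphons $r_N\colon[0,1]^2\to(0,1)$ such that $r_N$ is constant on the blocks $[\frac{i-1}{N},\frac iN)\times[\frac{j-1}{N},\frac jN)$, $1\le i,j\le N$, and, as $N\to\infty$, $r_N\to r$ a.e., $\|r_N-r\|_1\to0$, $\|\log r_N-\log r\|_1\to0$ and $\|\log(1-r_N)-\log(1-r)\|_1\to0$. Let $C_r=\|\mathcal L_r\|$, $C_r^0=\int_{[0,1]^2}\log\frac1{1-r}$, and for $\beta\in[0,C_r]$ let $$\psi_r(\beta)=\inf_{\widetilde h\in\widetilde{\mathcal W},\ \|\mathcal L_{\widetilde h}\|\le\beta}J_r(\widetilde h)=\inf_{h\in\mathcal W,\ \|\mathcal L_h\|\le\beta}I_r(h).$$ Then: (i) $\psi_r$ is continuous and strictly decreasing on $[0,C_r]$, with $\psi_r(0)=C_r^0>0$ and $\psi_r(C_r)=0$. (ii) For every $\beta\in[0,C_r]$, the set of minimisers $\widetilde h\in\widetilde{\mathcal W}$ of the variational formula for $\psi_r(\beta)$ is non-empty and compact in $(\widetilde{\mathcal W},\delta_\square)$.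
   Context: Graphons: $\mathcal W$ is the set of measurable $h\colon[0,1]^2\to[0,1]$ with $h(x,y)=h(y,x)$ for all $x,y$. $\mathcal M$ is the set of Lebesgue-measure-preserving bijections $\phi\colon[0,1]\to[0,1]$, and $h^\phi(x,y)=h(\phi(x),\phi(y))$. Cut-distance: $d_\square(h_1,h_2)=\sup_{S,T\subset[0,1]}\big|\int_{S\times T}[h_1-h_2]\,dx\,dy\big|$ (measurable $S,T$); cut-metric: $\delta_\square(h_1,h_2)=\inf_{\phi\in\mathcal M}d_\square(h_1,h_2^\phi)$. $\widetilde{\mathcal W}=\mathcal W/\!\sim$, where $h_1\sim h_2$ iff $\delta_\square(h_1,h_2)=0$; $\widetilde h$ is the class of $h$. $(\widetilde{\mathcal W},\delta_\square)$ is a compact metric space. Laplacian operator: for $h\in\mathcal W$, $\mathcal L_h$ acts on $L^2([0,1])$ by $(\mathcal L_hu)(x)=\int_{[0,1]}h(x,y)[u(x)-u(y)]\,dy$; $\|\mathcal L_h\|$ is its operator norm, and $\|\mathcal L_{\widetilde h}\|:=\|\mathcal L_h\|$ for any representative $h$. Rate functions: $\mathcal R(a\mid b)=a\log\frac ab+(1-a)\log\frac{1-a}{1-b}$ for $a\in[0,1]$, $b\in(0,1)$, with $0\log0=0$; $I_r(h)=\int_{[0,1]^2}\mathcal R(h(x,y)\mid r(x,y))\,dx\,dy$ for $h\in\mathcal W$; $J_r(\widetilde h)=\inf_{\phi\in\mathcal M}I_r(h^\phi)$ for any representative $h$ of $\widetilde h$. *)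

theory Defs
  imports "HOL-Analysis.Analysis"
begin

(* Graphons are curried functions on real. Their values off the unit square are unconstrained
   but never used; the quotient below identifies functions that differ only there. *)

abbreviation leb01 :: "real measure" where
  "leb01 \<equiv> lebesgue_on {0..1}"

abbreviation leb_sq :: "(real \<times> real) measure" where
  "leb_sq \<equiv> lebesgue_on ({0..1} \<times> {0..1})"

definition graphons :: "(real \<Rightarrow> real \<Rightarrow> real) set" where
  "graphons = {h. (\<lambda>(x, y). h x y) \<in> borel_measurable leb_sq \<and>
     (\<forall>x\<in>{0..1}. \<forall>y\<in>{0..1}. 0 \<le> h x y \<and> h x y \<le> 1 \<and> h x y = h y x)}"

definition mp_bijections :: "(real \<Rightarrow> real) set" where
  "mp_bijections = {\<phi>. bij_betw \<phi> {0..1} {0..1} \<and> \<phi> \<in> measurable leb01 leb01 \<and>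
     distr leb01 leb01 \<phi> = leb01}"

definition relabel :: "(real \<Rightarrow> real \<Rightarrow> real) \<Rightarrow> (real \<Rightarrow> real) \<Rightarrow> real \<Rightarrow> real \<Rightarrow> real" where
  "relabel h \<phi> = (\<lambda>x y. h (\<phi> x) (\<phi> y))"

definition cut_dist :: "(real \<Rightarrow> real \<Rightarrow> real) \<Rightarrow> (real \<Rightarrow> real \<Rightarrow> real) \<Rightarrow> real" where
  "cut_dist h1 h2 =
     (SUP (S, T) \<in> sets leb01 \<times> sets leb01.
        \<bar>set_lebesgue_integral lebesgue (S \<times> T) (\<lambda>(x, y). h1 x y - h2 x y)\<bar>)"

definition cut_metric :: "(real \<Rightarrow> real \<Rightarrow> real) \<Rightarrow> (real \<Rightarrow> real \<Rightarrow> real) \<Rightarrow> real" where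
  "cut_metric h1 h2 = (INF \<phi>\<in>mp_bijections. cut_dist h1 (relabel h2 \<phi>))"

definition cut_rel :: "((real \<Rightarrow> real \<Rightarrow> real) \<times> (real \<Rightarrow> real \<Rightarrow> real)) set" where
  "cut_rel = {(h1, h2). h1 \<in> graphons \<and> h2 \<in> graphons \<and> cut_metric h1 h2 = 0}"

definition graphon_classes :: "(real \<Rightarrow> real \<Rightarrow> real) set set" where
  "graphon_classes = graphons // cut_rel"

definition rep :: "(real \<Rightarrow> real \<Rightarrow> real) set \<Rightarrow> real \<Rightarrow> real \<Rightarrow> real" where
  "rep c = (SOME h. h \<in> c)"

(* The value 0 on arguments that are not classes is there because the locale Metric_space
   requires nonnegativity and symmetry on the whole type. *)
definition class_metric ::
    "(real \<Rightarrow> real \<Rightarrow> real) set \<Rightarrow> (real \<Rightarrow> real \<Rightarrow> real) set \<Rightarrow> real" where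
  "class_metric c1 c2 =
     (if c1 \<in> graphon_classes \<and> c2 \<in> graphon_classes then cut_metric (rep c1) (rep c2) else 0)"

definition graphon_topology :: "(real \<Rightarrow> real \<Rightarrow> real) set topology" where
  "graphon_topology = Metric_space.mtopology graphon_classes class_metric"

definition L2_funs :: "(real \<Rightarrow> real) set" where
  "L2_funs = {u \<in> borel_measurable leb01. integrable leb01 (\<lambda>x. (u x)\<^sup>2)}"

definition L2_norm01 :: "(real \<Rightarrow> real) \<Rightarrow> real" where
  "L2_norm01 u = sqrt (LINT x|leb01. (u x)\<^sup>2)"

definition laplacian :: "(real \<Rightarrow> real \<Rightarrow> real) \<Rightarrow> (real \<Rightarrow> real) \<Rightarrow> real \<Rightarrow> real" where
  "laplacian h u = (\<lambda>x. LINT y|leb01. h x y * (u x - u y))"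

definition lap_norm :: "(real \<Rightarrow> real \<Rightarrow> real) \<Rightarrow> real" where
  "lap_norm h = (SUP u \<in> {u \<in> L2_funs. L2_norm01 u \<le> 1}. L2_norm01 (laplacian h u))"

definition lap_norm_class :: "(real \<Rightarrow> real \<Rightarrow> real) set \<Rightarrow> real" where
  "lap_norm_class c = lap_norm (rep c)"

(* The convention 0 log 0 = 0 holds because the factor a (resp. 1 - a) vanishes. *)
definition rel_ent :: "real \<Rightarrow> real \<Rightarrow> real" where
  "rel_ent a b = a * ln (a / b) + (1 - a) * ln ((1 - a) / (1 - b))"

(* Used only when log r and log (1 - r) are integrable; the integrand is then integrable too,
   since its absolute value is at most ln 2 + |ln r| + |ln (1 - r)| almost everywhere. *)
definition rate_I :: "(real \<Rightarrow> real \<Rightarrow> real) \<Rightarrow> (real \<Rightarrow> real \<Rightarrow> real) \<Rightarrow> real" where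
  "rate_I r h = (LINT (x, y)|leb_sq. rel_ent (h x y) (r x y))"

definition rate_J :: "(real \<Rightarrow> real \<Rightarrow> real) \<Rightarrow> (real \<Rightarrow> real \<Rightarrow> real) set \<Rightarrow> real" where
  "rate_J r c = (INF \<phi>\<in>mp_bijections. rate_I r (relabel (rep c) \<phi>))"

definition psi :: "(real \<Rightarrow> real \<Rightarrow> real) \<Rightarrow> real \<Rightarrow> real" where
  "psi r \<beta> = (INF c \<in> {c \<in> graphon_classes. lap_norm_class c \<le> \<beta>}. rate_J r c)"

definition minimisers :: "(real \<Rightarrow> real \<Rightarrow> real) \<Rightarrow> real \<Rightarrow> (real \<Rightarrow> real \<Rightarrow> real) set set" where
  "minimisers r \<beta> = {c \<in> graphon_classes. lap_norm_class c \<le> \<beta> \<and> rate_J r c = psi r \<beta>}"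

definition C0 :: "(real \<Rightarrow> real \<Rightarrow> real) \<Rightarrow> real" where
  "C0 r = (LINT (x, y)|leb_sq. ln (1 / (1 - r x y)))"

(* Positivity is explicit because ln is a total function, finite also at arguments where the
   logarithm is infinite or undefined. *)
definition log_in_L1 :: "(real \<Rightarrow> real \<Rightarrow> real) \<Rightarrow> bool" where
  "log_in_L1 f \<longleftrightarrow> (AE (x, y) in leb_sq. 0 < f x y) \<and> integrable leb_sq (\<lambda>(x, y). ln (f x y))"

definition L1_norm_sq :: "(real \<Rightarrow> real \<Rightarrow> real) \<Rightarrow> ennreal" where
  "L1_norm_sq f = (\<integral>\<^sup>+ (x, y). ennreal \<bar>f x y\<bar> \<partial>leb_sq)"

definition block_constant :: "nat \<Rightarrow> (real \<Rightarrow> real \<Rightarrow> real) \<Rightarrow> bool" where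
  "block_constant N f \<longleftrightarrow> (\<forall>i\<in>{1..N}. \<forall>j\<in>{1..N}. \<exists>c.
     \<forall>x\<in>{(real i - 1) / real N..<real i / real N}.
     \<forall>y\<in>{(real j - 1) / real N..<real j / real N}. f x y = c)"

end

theory Submission
  imports Defs
begin

text \<open>Everything reduces to convexity in \<open>L\<^sup>2\<close>; compactness of the space of graphons is not needed.
  The relative entropy is uniformly convex: the convexity defect at a midpoint bounds the squared
  \<open>L\<^sup>2\<close> distance. The sets \<open>{h. lap_norm h \<le> \<beta>}\<close> are convex and \<open>L\<^sup>2\<close>-closed, so a minimising sequence
  is Cauchy and the minimiser of \<open>rate_I r\<close> exists and is unique almost everywhere. Moreover, two
  graphons at cut metric zero are \<open>L\<^sup>2\<close> limits of relabellings of each other, because relabelling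
  preserves the \<open>L\<^sup>2\<close> norm and cut convergence implies weak convergence. Hence the infimum over classes
  agrees with the infimum over graphons, and the set of minimising classes is a single point. The
  infimum is convex in \<open>\<beta>\<close>, which yields strict monotonicity and continuity away from \<open>0\<close>; at \<open>0\<close> one
  uses that \<open>\<integral> h(x, y) (x - y)\<^sup>2\<close> is at most twice the norm of the Laplacian.\<close>

section \<open>The unit square as a completed product space\<close>

text \<open>Two features of the definitions shape the argument. Graphons are Lebesgue measurable on
  the square, and that sigma-algebra is larger than the product of those of the factors; results on
  product measures are therefore applied to Borel versions and carried through completions. A
  relabelling is a bijection at every point for which only preimages are known to be measurable,
  whereas symmetry of the cut metric needs its inverse as well; this is where Lusin's theorem
  enters. Equivalent graphons need not be relabellings of each other, and the infimum in
  \<open>rate_J\<close> need not be attained. Statements about classes therefore pass through almost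
  everywhere limits, under which \<open>rate_I r\<close> is continuous because the two logarithms
  supply one majorant for all graphons. A convex function on a closed interval may jump at an
  endpoint, hence the separate treatment of \<beta> = 0. The weight \<open>(x - y)\<^sup>2\<close>
  comes from testing the Laplacian on u(x) = x: this function is injective, so the weight vanishes
  on the diagonal only, which is a null set.\<close>

lemma completion_restrict_space:
  assumes S: "S \<in> sets M"
  shows "completion (restrict_space M S) = restrict_space (completion M) S"
proof (rule measure_eqI)
  have S': "S \<in> sets (completion M)" using S by auto
  show sets: "sets (completion (restrict_space M S)) = sets (restrict_space (completion M) S)"
  proof (intro set_eqI iffI)
    fix A assume "A \<in> sets (completion (restrict_space M S))"
    then obtain B N N' where *: "A = B \<union> N" "N \<subseteq> N'" "N' \<in> null_sets (restrict_space M S)"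
      "B \<in> sets (restrict_space M S)" by (rule sets_completionE)
    then have "N' \<in> null_sets M" "N' \<subseteq> S" "B \<in> sets M" "B \<subseteq> S"
      using S by (auto simp: null_sets_restrict_space sets_restrict_space_iff)
    then have "A \<in> sets (completion M)" "A \<subseteq> S"
      using * by (auto intro: sets_completionI)
    then show "A \<in> sets (restrict_space (completion M) S)"
      using S' by (subst sets_restrict_space_iff) (auto simp: sets.Int_space_eq2 simp del: space_completion)
  next
    fix A assume "A \<in> sets (restrict_space (completion M) S)"
    then have A: "A \<in> sets (completion M)" "A \<subseteq> S" using S' by (simp_all add: sets_restrict_space_iff sets.Int_space_eq2 del: space_completion)
    from A(1) obtain B N N' where *: "A = B \<union> N" "N \<subseteq> N'" "N' \<in> null_sets M" "B \<in> sets M"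
      by (rule sets_completionE)
    show "A \<in> sets (completion (restrict_space M S))"
    proof (rule sets_completionI)
      show "A = B \<union> N" "N \<subseteq> N' \<inter> S" using * A by auto
      show "N' \<inter> S \<in> null_sets (restrict_space M S)" using * S
        by (simp add: null_sets_restrict_space null_set_Int2)
      show "B \<in> sets (restrict_space M S)" using * A S by (auto simp: sets_restrict_space_iff)
    qed
  qed
  fix A assume A0: "A \<in> sets (completion (restrict_space M S))"
  then have A: "A \<in> sets (completion M)" "A \<subseteq> S" using S' sets by (simp_all add: sets_restrict_space_iff sets.Int_space_eq2 del: space_completion)
  from A0 obtain B N N' where *: "A = B \<union> N" "N \<subseteq> N'" "N' \<in> null_sets (restrict_space M S)"
      "B \<in> sets (restrict_space M S)" by (rule sets_completionE)
  then have **: "N' \<in> null_sets M" "N' \<subseteq> S" "B \<in> sets M" "B \<subseteq> S"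
      using S by (auto simp: null_sets_restrict_space sets_restrict_space_iff)
  have "N \<in> null_sets (completion (restrict_space M S))"
    using * null_sets_completion_subset null_sets_completionI by blast
  then have "emeasure (completion (restrict_space M S)) A = emeasure (completion (restrict_space M S)) B"
    using * by (simp add: emeasure_Un_null_set del: emeasure_completion)
  also have "\<dots> = emeasure M B" using * ** S by (simp add: emeasure_restrict_space)
  also have "\<dots> = emeasure (completion M) B" using ** by simp
  also have "\<dots> = emeasure (completion M) A"
  proof -
    have "N \<in> null_sets (completion M)"
      using * ** null_sets_completion_subset null_sets_completionI by blast
    then show ?thesis using * ** by (simp add: emeasure_Un_null_set del: emeasure_completion)
  qed
  finally show "emeasure (completion (restrict_space M S)) A = emeasure (restrict_space (completion M) S) A"
    using A S' by (subst emeasure_restrict_space) (simp_all add: sets.Int_space_eq2 del: space_completion emeasure_completion)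
qed

lemma (in complete_measure) borel_measurable_AE_cong:
  assumes f: "f \<in> measurable M N" and ae: "AE x in M. f x = g x" and sp: "\<And>x. x \<in> space M \<Longrightarrow> g x \<in> space N"
  shows "g \<in> measurable M N"
proof (rule measurableI)
  fix A assume "A \<in> sets N"
  then have f': "f -` A \<inter> space M \<in> sets M" using f by (rule measurable_sets[rotated])
  have ae': "AE x in M. (x \<in> f -` A \<inter> space M) \<longleftrightarrow> (x \<in> g -` A \<inter> space M)"
    using ae by eventually_elim auto
  then show "g -` A \<inter> space M \<in> sets M"
    using in_sets_AE[OF ae'] f' by simp
qed (rule sp)

text \<open>A measure-preserving map pulls null sets back to null sets, which is exactly what
  measurability into the completed target asks for beyond measurability into
  \<open>N\<close>.\<close>

lemma distr_completion_eq_completion: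
  assumes T: "T \<in> measurable (completion M) N" and N: "distr (completion M) N T = N"
  shows "T \<in> measurable (completion M) (completion N)"
    and "distr (completion M) (completion N) T = completion N"
proof -
  show "T \<in> measurable (completion M) (completion N)"
    using T N by (intro completion.measurable_completion2) auto
  show "distr (completion M) (completion N) T = completion N"
    using completion.completion_distr_eq[OF T] N by simp
qed

abbreviation unit1 :: "real measure" where
  "unit1 \<equiv> restrict_space lborel {0..1}"

lemma pair_measure_restrict_space:
  assumes "sigma_finite_measure M" "sigma_finite_measure N" and S: "S \<in> sets M" and T: "T \<in> sets N"
  shows "restrict_space M S \<Otimes>\<^sub>M restrict_space N T = restrict_space (M \<Otimes>\<^sub>M N) (S \<times> T)"
proof (rule pair_measure_eqI)
  show "sigma_finite_measure (restrict_space M S)" "sigma_finite_measure (restrict_space N T)"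
    using assms by (auto intro: sigma_finite_measure_restrict_space)
  interpret N: sigma_finite_measure N by fact
  show "emeasure (restrict_space M S) A * emeasure (restrict_space N T) B
    = emeasure (restrict_space (M \<Otimes>\<^sub>M N) (S \<times> T)) (A \<times> B)"
    if "A \<in> sets (restrict_space M S)" "B \<in> sets (restrict_space N T)" for A B
    using that S T
    by (subst (1 2 3) emeasure_restrict_space)
       (auto simp: sets_restrict_space_iff N.emeasure_pair_measure_Times)
  show "sets (restrict_space M S \<Otimes>\<^sub>M restrict_space N T) = sets (restrict_space (M \<Otimes>\<^sub>M N) (S \<times> T))"
  proof (intro antisym)
    show "sets (restrict_space M S \<Otimes>\<^sub>M restrict_space N T) \<subseteq> sets (restrict_space (M \<Otimes>\<^sub>M N) (S \<times> T))"
      using S T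
      by (intro sets_pair_in_sets) (auto simp: sets_restrict_space_iff pair_measureI)
    show "sets (restrict_space (M \<Otimes>\<^sub>M N) (S \<times> T)) \<subseteq> sets (restrict_space M S \<Otimes>\<^sub>M restrict_space N T)"
    proof
      fix A assume "A \<in> sets (restrict_space (M \<Otimes>\<^sub>M N) (S \<times> T))"
      then have A: "A \<in> sets (M \<Otimes>\<^sub>M N)" "A \<subseteq> S \<times> T" using S T by (auto simp: sets_restrict_space_iff)
      have "(\<lambda>x. x) \<in> measurable (restrict_space M S \<Otimes>\<^sub>M restrict_space N T) (M \<Otimes>\<^sub>M N)"
        by (intro measurable_pair)
           (auto simp: comp_def intro!: measurable_compose[OF measurable_fst] measurable_compose[OF measurable_snd] measurable_restrict_space1)
      then have "(\<lambda>x. x) -` A \<inter> space (restrict_space M S \<Otimes>\<^sub>M restrict_space N T) \<in>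
        sets (restrict_space M S \<Otimes>\<^sub>M restrict_space N T)" using A(1) by (rule measurable_sets)
      moreover have "(\<lambda>x. x) -` A \<inter> space (restrict_space M S \<Otimes>\<^sub>M restrict_space N T) = A"
        using A S T by (auto simp: space_pair_measure)
      ultimately show "A \<in> sets (restrict_space M S \<Otimes>\<^sub>M restrict_space N T)" by simp
    qed
  qed
qed

lemma leb01_eq: "leb01 = completion unit1"
  by (rule completion_restrict_space[symmetric]) auto

text \<open>The product of \<open>leb01\<close> with itself is not complete, so it cannot be
  \<open>leb_sq\<close>; the Borel product has to be completed as a whole. Product arguments are run
  on \<open>unit1\<close> and moved along this equation.\<close>

lemma leb_sq_eq: "leb_sq = completion (unit1 \<Otimes>\<^sub>M unit1)"
proof -
  have "unit1 \<Otimes>\<^sub>M unit1 = restrict_space (lborel \<Otimes>\<^sub>M lborel) ({0..1} \<times> {0..1})"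
    by (intro pair_measure_restrict_space) (auto intro: lborel.sigma_finite_measure_axioms)
  then show ?thesis
    by (subst completion_restrict_space[symmetric]) (auto simp: lborel_prod intro: borel_Times)
qed

interpretation unit1: sigma_finite_measure unit1
  by (rule sigma_finite_measure_restrict_space) (auto intro: lborel.sigma_finite_measure_axioms)

interpretation unit2: pair_sigma_finite unit1 unit1 ..

lemma space_unit1 [simp]: "space unit1 = {0..1}" by (simp add: space_restrict_space)

lemma emeasure_leb01_space [simp]: "emeasure leb01 {0..1} = 1"
  by (simp add: emeasure_restrict_space)

lemma emeasure_leb_sq_space [simp]: "emeasure leb_sq ({0..1} \<times> {0..1}) = 1"
proof -
  have "emeasure leb_sq ({0..1} \<times> {0..1}) = emeasure (unit1 \<Otimes>\<^sub>M unit1) ({0..1} \<times> {0..1})"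
    unfolding leb_sq_eq by (auto simp: sets_restrict_space_iff)
  also have "\<dots> = emeasure unit1 {0..1} * emeasure unit1 {0..1}"
    by (rule unit1.emeasure_pair_measure_Times) (auto simp: sets_restrict_space_iff)
  also have "\<dots> = 1" by (simp add: emeasure_restrict_space)
  finally show ?thesis .
qed

interpretation leb01: finite_measure leb01 by standard auto
interpretation leb_sq: finite_measure leb_sq by standard auto

lemma measure_leb01 [simp]: "measure leb01 {0..1} = 1"
  by (simp add: measure_def)

lemma measure_leb_sq [simp]: "measure leb_sq ({0..1} \<times> {0..1}) = 1"
  by (simp add: measure_def)

lemma complete_leb01: "complete_measure leb01"
  unfolding leb01_eq by (rule completion.complete_measure_axioms)

lemma AE_leb_sq_pair:
  assumes "AE p in leb_sq. P p"
  shows "AE x in leb01. AE y in leb01. P (x, y)"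
proof -
  have "AE p in unit1 \<Otimes>\<^sub>M unit1. P p" using assms unfolding leb_sq_eq AE_completion_iff .
  then have "AE x in unit1. AE y in unit1. P (x, y)" by (rule unit2.AE_pair)
  then show ?thesis unfolding leb01_eq AE_completion_iff .
qed

lemma leb_sq_borel_version:
  assumes "f \<in> borel_measurable leb_sq"
  obtains g :: "real \<times> real \<Rightarrow> real" where "g \<in> borel_measurable (unit1 \<Otimes>\<^sub>M unit1)" "AE p in leb_sq. f p = g p"
proof -
  obtain g where "g \<in> borel_measurable (unit1 \<Otimes>\<^sub>M unit1)" "AE p in unit1 \<Otimes>\<^sub>M unit1. f p = g p"
    using completion_ex_borel_measurable_real[OF assms[unfolded leb_sq_eq]] by blast
  then have "AE p in leb_sq. f p = g p"
    unfolding leb_sq_eq AE_completion_iff by blast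
  show thesis by (rule that) fact+
qed

text \<open>Fubini's theorem is available for a Borel version g of f. For almost every x the
  sections of f and g agree almost everywhere, and completeness of \<open>leb01\<close> makes the
  sections of f measurable there.\<close>

lemma leb_sq_Fubini:
  fixes f :: "real \<times> real \<Rightarrow> real"
  assumes f: "integrable leb_sq f"
  shows "AE x in leb01. integrable leb01 (\<lambda>y. f (x, y))"
    and "integrable leb01 (\<lambda>x. LINT y|leb01. f (x, y))"
    and "(LINT x|leb01. LINT y|leb01. f (x, y)) = integral\<^sup>L leb_sq f"
proof -
  obtain g where g [measurable]: "g \<in> borel_measurable (unit1 \<Otimes>\<^sub>M unit1)" and ae: "AE p in leb_sq. f p = g p"
    using leb_sq_borel_version f by blast
  have g': "g \<in> borel_measurable leb_sq"
    unfolding leb_sq_eq using g by (rule measurable_completion)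
  have ig: "integrable leb_sq g"
    using integrable_cong_AE_imp[OF f g'] ae by auto
  then have ig': "integrable (unit1 \<Otimes>\<^sub>M unit1) g"
    unfolding leb_sq_eq by (simp add: integrable_completion)
  interpret c: complete_measure leb01 by (rule complete_leb01)
  have gm: "(\<lambda>y. g (x, y)) \<in> borel_measurable unit1" if "x \<in> {0..1}" for x
    using that by (intro measurable_compose[OF measurable_Pair1' g]) auto
  have A: "AE x in leb01. integrable leb01 (\<lambda>y. f (x, y)) \<and> (LINT y|leb01. f (x, y)) = (LINT y|unit1. g (x, y))"
  proof -
    have "AE x in unit1. integrable unit1 (\<lambda>y. g (x, y))"
      using unit2.AE_integrable_fst'[OF ig'] .
    then have 1: "AE x in leb01. integrable unit1 (\<lambda>y. g (x, y))"
      unfolding leb01_eq AE_completion_iff .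
    have 2: "AE x in leb01. x \<in> {0..1}" by (rule AE_I2) simp
    show ?thesis using 1 2 AE_leb_sq_pair[OF ae]
    proof eventually_elim
      fix x assume i: "integrable unit1 (\<lambda>y. g (x, y))" and x: "x \<in> {0..1::real}"
        and e: "AE y in leb01. f (x, y) = g (x, y)"
      have gl: "integrable leb01 (\<lambda>y. g (x, y))"
        unfolding leb01_eq using i gm[OF x] by (simp add: integrable_completion)
      have fm: "(\<lambda>y. f (x, y)) \<in> borel_measurable leb01"
        by (rule c.borel_measurable_AE_cong[OF borel_measurable_integrable[OF gl]]) (use e in \<open>auto elim: eventually_mono\<close>)
      have "integrable leb01 (\<lambda>y. f (x, y))"
        by (rule integrable_cong_AE_imp[OF gl fm]) (use e in \<open>auto elim: eventually_mono\<close>)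
      moreover have "(LINT y|leb01. f (x, y)) = (LINT y|leb01. g (x, y))"
        using fm gl e by (intro integral_cong_AE) auto
      moreover have "\<dots> = (LINT y|unit1. g (x, y))"
        unfolding leb01_eq using gm[OF x] by (rule integral_completion)
      ultimately show "integrable leb01 (\<lambda>y. f (x, y)) \<and> (LINT y|leb01. f (x, y)) = (LINT y|unit1. g (x, y))"
        by simp
    qed
  qed
  then show "AE x in leb01. integrable leb01 (\<lambda>y. f (x, y))" by auto
  have G: "integrable unit1 (\<lambda>x. LINT y|unit1. g (x, y))"
    using unit2.integrable_fst'[OF ig'] .
  then have G': "integrable leb01 (\<lambda>x. LINT y|unit1. g (x, y))"
    unfolding leb01_eq by (simp add: integrable_completion)
  have A': "AE x in leb01. (LINT y|leb01. f (x, y)) = (LINT y|unit1. g (x, y))"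
    using A by eventually_elim simp
  then have A'': "AE x in leb01. (LINT y|unit1. g (x, y)) = (LINT y|leb01. f (x, y))"
    by eventually_elim (rule sym)
  have F: "(\<lambda>x. LINT y|leb01. f (x, y)) \<in> borel_measurable leb01"
    by (rule c.borel_measurable_AE_cong[OF borel_measurable_integrable[OF G'] A'']) simp
  show "integrable leb01 (\<lambda>x. LINT y|leb01. f (x, y))"
    by (rule integrable_cong_AE_imp[OF G' F A''])
  have "(LINT x|leb01. LINT y|leb01. f (x, y)) = (LINT x|leb01. LINT y|unit1. g (x, y))"
    by (rule integral_cong_AE[OF F borel_measurable_integrable[OF G'] A'])
  also have "\<dots> = (LINT x|unit1. LINT y|unit1. g (x, y))"
    unfolding leb01_eq using G by (intro integral_completion) auto
  also have "\<dots> = integral\<^sup>L (unit1 \<Otimes>\<^sub>M unit1) g"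
    using unit2.integral_fst'[OF ig'] .
  also have "\<dots> = integral\<^sup>L leb_sq g"
    unfolding leb_sq_eq using g by (rule integral_completion[symmetric])
  also have "\<dots> = integral\<^sup>L leb_sq f"
    using g' f ae by (intro integral_cong_AE) (auto elim!: eventually_mono)
  finally show "(LINT x|leb01. LINT y|leb01. f (x, y)) = integral\<^sup>L leb_sq f" .
qed

lemma measurable_fst_leb_sq [measurable]: "fst \<in> measurable leb_sq leb01"
  and distr_fst_leb_sq: "distr leb_sq leb01 fst = leb01"
proof -
  have "distr (unit1 \<Otimes>\<^sub>M unit1) unit1 fst = unit1"
  proof (intro measure_eqI)
    fix A assume "A \<in> sets (distr (unit1 \<Otimes>\<^sub>M unit1) unit1 fst)"
    then have A: "A \<in> sets unit1" by simp
    then have "fst -` A \<inter> space (unit1 \<Otimes>\<^sub>M unit1) = A \<times> {0..1}"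
      using sets.sets_into_space[OF A] by (auto simp: space_pair_measure)
    then show "emeasure (distr (unit1 \<Otimes>\<^sub>M unit1) unit1 fst) A = emeasure unit1 A"
      using A by (simp add: emeasure_distr unit1.emeasure_pair_measure_Times emeasure_restrict_space sets_restrict_space_iff)
  qed simp
  then show "fst \<in> measurable leb_sq leb01" "distr leb_sq leb01 fst = leb01"
    unfolding leb_sq_eq leb01_eq
    by (auto intro!: distr_completion_eq_completion intro: measurable_completion simp: distr_completion)
qed

lemma measurable_leb_sq_swap: "prod.swap \<in> measurable leb_sq leb_sq"
  and distr_leb_sq_swap: "distr leb_sq leb_sq prod.swap = leb_sq"
proof -
  have [simp]: "prod.swap = (\<lambda>(x, y). (y, x))" by auto
  have "distr (unit1 \<Otimes>\<^sub>M unit1) (unit1 \<Otimes>\<^sub>M unit1) prod.swap = unit1 \<Otimes>\<^sub>M unit1"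
    by (simp add: unit2.distr_pair_swap[symmetric])
  then show "prod.swap \<in> measurable leb_sq leb_sq" "distr leb_sq leb_sq prod.swap = leb_sq"
    unfolding leb_sq_eq
    using measurable_pair_swap'[of unit1 unit1]
    by (auto intro!: distr_completion_eq_completion(1) distr_completion_eq_completion(2)
       intro: measurable_completion simp: distr_completion)
qed

lemma measurable_snd_leb_sq [measurable]: "snd \<in> measurable leb_sq leb01"
  and distr_snd_leb_sq: "distr leb_sq leb01 snd = leb01"
proof -
  have eq: "snd = fst \<circ> (prod.swap :: real \<times> real \<Rightarrow> _)" by (auto simp: comp_def)
  show "snd \<in> measurable leb_sq leb01"
    unfolding eq by (rule measurable_comp[OF measurable_leb_sq_swap measurable_fst_leb_sq])
  have "distr leb_sq leb01 snd = distr (distr leb_sq leb_sq prod.swap) leb01 fst"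
    unfolding eq by (rule distr_distr[OF measurable_fst_leb_sq measurable_leb_sq_swap, symmetric])
  then show "distr leb_sq leb01 snd = leb01"
    unfolding distr_leb_sq_swap distr_fst_leb_sq .
qed

text \<open>The sigma-algebra of \<open>leb_sq\<close> is the larger one, so the identity transports
  the measure to the product of the completed factors. This gives access to product arguments for
  maps that are Lebesgue but not Borel measurable.\<close>

lemma measurable_leb_sq_pair: "(\<lambda>p. p) \<in> measurable leb_sq (leb01 \<Otimes>\<^sub>M leb01)"
  and distr_leb_sq_pair: "distr leb_sq (leb01 \<Otimes>\<^sub>M leb01) (\<lambda>p. p) = leb01 \<Otimes>\<^sub>M leb01"
proof -
  show m: "(\<lambda>p. p) \<in> measurable leb_sq (leb01 \<Otimes>\<^sub>M leb01)"
    by (intro measurable_pair) (auto simp: comp_def)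
  show "distr leb_sq (leb01 \<Otimes>\<^sub>M leb01) (\<lambda>p. p) = leb01 \<Otimes>\<^sub>M leb01"
  proof (rule pair_measure_eqI[symmetric])
    fix A B assume AB: "A \<in> sets leb01" "B \<in> sets leb01"
    from AB obtain A1 A2 A3 where A: "A = A1 \<union> A2" "A2 \<subseteq> A3" "A3 \<in> null_sets unit1" "A1 \<in> sets unit1"
      unfolding leb01_eq by (auto elim: sets_completionE)
    from AB obtain B1 B2 B3 where B: "B = B1 \<union> B2" "B2 \<subseteq> B3" "B3 \<in> null_sets unit1" "B1 \<in> sets unit1"
      unfolding leb01_eq by (auto elim: sets_completionE)
    have AB': "A \<times> B \<in> sets leb_sq"
      using measurable_sets[OF m pair_measureI[OF AB]] AB[THEN sets.sets_into_space]
      by (simp add: Int_absorb2 Sigma_mono)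
    have ss: "A1 \<subseteq> {0..1}" "A3 \<subseteq> {0..1}" "B1 \<subseteq> {0..1}" "B3 \<subseteq> {0..1}"
      using A B by (auto dest!: sets.sets_into_space null_setsD2)
    have s1: "{0..1} \<in> sets unit1" using sets.top[of unit1] by simp
    \<comment> \<open>The rectangles \<open>A \<times> B\<close> and \<open>A1 \<times> B1\<close>
      can differ only inside two strips over null sets.\<close>
    have "A3 \<times> {0..1} \<union> {0..1} \<times> B3 \<in> null_sets (unit1 \<Otimes>\<^sub>M unit1)"
      using A(3) B(3) s1 by (intro null_sets.Un) (auto intro: unit1.times_in_null_sets1 unit1.times_in_null_sets2)
    then have N: "A3 \<times> {0..1} \<union> {0..1} \<times> B3 \<in> null_sets leb_sq"
      unfolding leb_sq_eq by (rule null_sets_completionI)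
    have ae: "AE p in leb_sq. p \<in> A \<times> B \<longleftrightarrow> p \<in> A1 \<times> B1"
      using AE_not_in[OF N] by eventually_elim (use A B ss in auto)
    have "emeasure leb_sq (A \<times> B) = emeasure leb_sq (A1 \<times> B1)"
      using ae AB' A B by (intro emeasure_eq_AE) (auto simp: leb_sq_eq)
    also have "\<dots> = emeasure unit1 A1 * emeasure unit1 B1"
      unfolding leb_sq_eq using A B by (simp add: unit1.emeasure_pair_measure_Times)
    also have "emeasure unit1 A1 = emeasure leb01 A1" unfolding leb01_eq using A by simp
    also have "emeasure unit1 B1 = emeasure leb01 B1" unfolding leb01_eq using B by simp
    also have "emeasure leb01 A1 = emeasure leb01 A"
    proof (rule emeasure_eq_AE)
      show "AE x in leb01. (x \<in> A1) = (x \<in> A)" unfolding leb01_eq AE_completion_iff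
        using AE_not_in[OF A(3)] by eventually_elim (use A in auto)
    qed (use A AB in \<open>auto simp: leb01_eq\<close>)
    also have "emeasure leb01 B1 = emeasure leb01 B"
    proof (rule emeasure_eq_AE)
      show "AE x in leb01. (x \<in> B1) = (x \<in> B)" unfolding leb01_eq AE_completion_iff
        using AE_not_in[OF B(3)] by eventually_elim (use B in auto)
    qed (use B AB in \<open>auto simp: leb01_eq\<close>)
    finally have *: "emeasure leb_sq (A \<times> B) = emeasure leb01 A * emeasure leb01 B" .
    have "emeasure (distr leb_sq (leb01 \<Otimes>\<^sub>M leb01) (\<lambda>p. p)) (A \<times> B) = emeasure leb_sq (A \<times> B)"
      using AB[THEN sets.sets_into_space]
      by (subst emeasure_distr[OF m pair_measureI[OF AB]]) (simp add: Int_absorb2 Sigma_mono)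
    then show "emeasure leb01 A * emeasure leb01 B = emeasure (distr leb_sq (leb01 \<Otimes>\<^sub>M leb01) (\<lambda>p. p)) (A \<times> B)"
      using * by simp
  qed (rule leb01.sigma_finite_measure_axioms sets_distr[symmetric])+
qed

lemma sets_leb_sq_Times:
  assumes "S \<in> sets leb01" "T \<in> sets leb01"
  shows "S \<times> T \<in> sets leb_sq"
  using measurable_sets[OF measurable_leb_sq_pair pair_measureI[OF assms]] assms[THEN sets.sets_into_space]
  by (simp add: Int_absorb2 Sigma_mono)

section \<open>Measure-preserving bijections\<close>

lemma leb01_inner_compact:
  assumes A: "A \<in> sets leb01" and e: "e > 0"
  obtains K where "compact K" "K \<subseteq> A" "measure leb01 (A - K) < e"
proof -
  have A': "A \<in> sets lebesgue" "A \<subseteq> {0..1}"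
    using A by (auto simp: sets_restrict_space_iff)
  obtain K where K: "closed K" "K \<subseteq> A" "A - K \<in> lmeasurable" "emeasure lebesgue (A - K) < ennreal e"
    using sets_lebesgue_inner_closed[OF A'(1) e] by blast
  have "bounded K" using K(2) A'(2) bounded_closed_interval bounded_subset by (metis subset_trans)
  then have "compact K" using K by (simp add: compact_eq_bounded_closed)
  moreover have "measure lebesgue (A - K) < e"
    using K(3,4) e by (metis emeasure_eq_measure2 ennreal_less_iff fmeasurable_def measure_nonneg mem_Collect_eq)
  moreover have "measure leb01 (A - K) = measure lebesgue (A - K)"
    using A' K by (intro measure_restrict_space) auto
  ultimately show thesis using that K by simp
qed

text \<open>For each basic open set, both its preimage and the complement of the preimage are
  approximated from inside by compact sets \<open>C k\<close> and \<open>D k\<close>. On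
  \<open>K\<close> a point outside \<open>D k\<close> must lie in \<open>C k\<close>, so the open
  set \<open>- D k\<close> witnesses continuity.\<close>

lemma leb01_Lusin:
  fixes f :: "real \<Rightarrow> 'a::second_countable_topology"
  assumes f: "f \<in> borel_measurable leb01" and e: "e > 0"
  obtains K where "compact K" "K \<subseteq> {0..1}" "continuous_on K f" "measure leb01 ({0..1} - K) < e"
proof -
  obtain B :: "'a set set" where B: "countable B" "topological_basis B"
    using ex_countable_basis by blast
  have Bne: "B \<noteq> {}" using B(2) unfolding topological_basis_def
    by (metis Union_empty empty_not_UNIV equals0D open_UNIV subset_empty)
  define U where "U = from_nat_into B"
  have U: "range U = B" unfolding U_def using Bne B(1) by (rule range_from_nat_into)
  define P where "P k = f -` U k \<inter> {0..1}" for k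
  have Uo: "open (U k)" for k using U B(2) topological_basis_open by blast
  have P: "P k \<in> sets leb01" "{0..1} - P k \<in> sets leb01" for k
  proof -
    show "P k \<in> sets leb01"
      unfolding P_def using measurable_sets[OF f borel_open[OF Uo]] by simp
    then show "{0..1} - P k \<in> sets leb01" using sets.compl_sets[of "P k" leb01] by simp
  qed
  \<comment> \<open>Each k loses at most \<open>2 * d k\<close> in measure, and these losses add up
    to \<open>e/2\<close>.\<close>
  define d where "d k = (e/4) * (1/2) ^ Suc k" for k :: nat
  have d: "d k > 0" for k using e by (simp add: d_def)
  have "\<exists>C. compact C \<and> C \<subseteq> P k \<and> measure leb01 (P k - C) < d k" for k
    by (rule leb01_inner_compact[OF P(1)[of k] d[of k]]) blast
  then obtain C where C: "\<And>k. compact (C k)" "\<And>k. C k \<subseteq> P k" "\<And>k. measure leb01 (P k - C k) < d k" by metis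
  have "\<exists>D. compact D \<and> D \<subseteq> {0..1} - P k \<and> measure leb01 ({0..1} - P k - D) < d k" for k
    by (rule leb01_inner_compact[OF P(2)[of k] d[of k]]) blast
  then obtain D where D: "\<And>k. compact (D k)" "\<And>k. D k \<subseteq> {0..1} - P k"
    "\<And>k. measure leb01 ({0..1} - P k - D k) < d k" by metis
  define K where "K = (\<Inter>k. C k \<union> D k)"
  have msr: "S \<in> sets leb01" if "compact S" "S \<subseteq> {0..1}" for S
    using that by (auto simp: sets_restrict_space_iff borel_compact)
  have CD01: "C k \<subseteq> {0..1}" "D k \<subseteq> {0..1}" for k
    using C(2)[of k] D(2)[of k] by (auto simp: P_def)
  have CD: "C k \<in> sets leb01" "D k \<in> sets leb01" for k
    using msr C(1) D(1) CD01 by auto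
  have "compact K" unfolding K_def by (intro compact_Inter) (auto simp: compact_Un C D)
  moreover have K: "K \<subseteq> {0..1}" using CD01[of 0] by (auto simp: K_def)
  moreover have "continuous_on K f"
    unfolding continuous_on_topological
  proof safe
    fix x V assume x: "x \<in> K" and V: "open V" "f x \<in> V"
    obtain k where k: "f x \<in> U k" "U k \<subseteq> V"
      using topological_basisE[OF B(2) V] U by (metis rangeE)
    have "f y \<in> V" if "y \<in> K" "y \<notin> D k" for y
      using that C(2)[of k] k by (auto simp: K_def P_def)
    moreover have "x \<notin> D k" using D(2)[of k] k x K by (auto simp: P_def)
    moreover have "open (- D k)" using D(1) compact_imp_closed by blast
    ultimately show "\<exists>A. open A \<and> x \<in> A \<and> (\<forall>y\<in>K. y \<in> A \<longrightarrow> f y \<in> V)"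
      by (intro exI[of _ "- D k"]) auto
  qed
  moreover have "measure leb01 ({0..1} - K) < e"
  proof -
    have m: "measure leb01 ({0..1} - (C k \<union> D k)) \<le> 2 * d k" for k
    proof -
      have "measure leb01 ({0..1} - (C k \<union> D k)) \<le> measure leb01 ((P k - C k) \<union> ({0..1} - P k - D k))"
        using CD P by (intro leb01.finite_measure_mono) auto
      also have "\<dots> \<le> measure leb01 (P k - C k) + measure leb01 ({0..1} - P k - D k)"
        using CD P by (intro measure_Un_le) auto
      finally show ?thesis using C(3)[of k] D(3)[of k] by simp
    qed
    have "(\<lambda>k. (e/2) * (1/2) ^ Suc k) sums ((e/2) * 1)"
      using power_half_series by (rule sums_mult)
    then have s: "(\<lambda>k. 2 * d k) sums (e/2)" by (simp add: d_def)
    have sm: "summable (\<lambda>k. measure leb01 ({0..1} - (C k \<union> D k)))"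
      by (rule summable_comparison_test_ev[OF _ sums_summable[OF s]]) (use m in auto)
    have "{0..1} - K = (\<Union>k. {0..1} - (C k \<union> D k))" by (auto simp: K_def)
    also have "measure leb01 \<dots> \<le> (\<Sum>k. measure leb01 ({0..1} - (C k \<union> D k)))"
      using CD sm by (intro leb01.finite_measure_subadditive_countably) auto
    also have "\<dots> \<le> (\<Sum>k. 2 * d k)" using m sm s by (intro suminf_le) (auto simp: sums_iff)
    also have "\<dots> = e/2" using s by (simp add: sums_iff)
    finally show ?thesis using e by simp
  qed
  ultimately show thesis using that by blast
qed

lemma mp_bijectionsD:
  assumes "\<phi> \<in> mp_bijections"
  shows "bij_betw \<phi> {0..1} {0..1}" "\<phi> \<in> measurable leb01 leb01" "distr leb01 leb01 \<phi> = leb01"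
    "\<And>x. x \<in> {0..1} \<Longrightarrow> \<phi> x \<in> {0..1}"
  using assms by (auto simp: mp_bijections_def bij_betw_def simp del: atLeastAtMost_iff)

lemma id_mp_bijections: "(\<lambda>x. x) \<in> mp_bijections"
  by (auto simp: mp_bijections_def intro: bij_betw_byWitness)

lemma comp_mp_bijections:
  assumes "\<phi> \<in> mp_bijections" "\<psi> \<in> mp_bijections"
  shows "\<phi> \<circ> \<psi> \<in> mp_bijections"
proof -
  have "distr leb01 leb01 (\<phi> \<circ> \<psi>) = distr (distr leb01 leb01 \<psi>) leb01 \<phi>"
    using assms by (intro distr_distr[symmetric] mp_bijectionsD)
  then show ?thesis using assms
    by (auto simp: mp_bijections_def intro: bij_betw_trans)
qed

text \<open>Lusin's theorem makes the image of a measurable set squeezable between a compact set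
  and the complement of a compact set.\<close>

lemma mp_bijections_image:
  assumes \<phi>: "\<phi> \<in> mp_bijections" and A: "A \<in> sets leb01"
  shows "\<phi> ` A \<in> sets leb01" and "emeasure leb01 (\<phi> ` A) = emeasure leb01 A"
proof -
  note p = mp_bijectionsD[OF \<phi>]
  have inj: "inj_on \<phi> {0..1}" and surj: "\<phi> ` {0..1} = {0..1}" using p(1) by (auto simp: bij_betw_def)
  interpret c: complete_measure leb01 by (rule complete_leb01)
  have "(\<lambda>x. x) \<in> borel_measurable leb01"
    by (intro measurable_restrict_space1 measurable_completion) simp
  then have bm: "\<phi> \<in> borel_measurable leb01"
    using measurable_compose[OF p(2)] by blast
  have fm: "A \<in> sets leb01 \<Longrightarrow> A \<in> fmeasurable leb01" for A
    by (auto simp: fmeasurable_def leb01.emeasure_finite less_top[symmetric])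
  \<comment> \<open>On a compact set where \<open>\<phi>\<close> is continuous, compact sets have
    compact images. Measure preservation speaks of preimages only; by injectivity the preimage of
    such an image is the set itself.\<close>
  have inner: "\<exists>K. K \<subseteq> B \<and> K \<in> sets leb01 \<and> \<phi> ` K \<in> sets leb01 \<and> measure leb01 (\<phi> ` K) > measure leb01 B - e"
    if B: "B \<in> sets leb01" and e: "e > 0" for B e
  proof -
    obtain L where L: "compact L" "L \<subseteq> {0..1}" "continuous_on L \<phi>" "measure leb01 ({0..1} - L) < e/2"
      using leb01_Lusin[OF bm, of "e/2"] e by auto
    obtain C where C: "compact C" "C \<subseteq> B" "measure leb01 (B - C) < e/2"
      using leb01_inner_compact[OF B, of "e/2"] e by auto
    have B01: "B \<subseteq> {0..1}" using sets.sets_into_space[OF B] by simp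
    have cs: "S \<in> sets leb01" if "compact S" "S \<subseteq> {0..1}" for S
      using that by (auto simp: sets_restrict_space_iff borel_compact)
    have Ls: "L \<in> sets leb01" "C \<in> sets leb01" using L C B01 by (auto intro: cs)
    have LC: "compact (L \<inter> C)" using L C by (auto intro: compact_Int)
    have im: "\<phi> ` (L \<inter> C) \<in> sets leb01"
      using L LC surj by (intro cs compact_continuous_image) (auto intro: continuous_on_subset)
    have "measure leb01 (\<phi> ` (L \<inter> C)) = measure (distr leb01 leb01 \<phi>) (\<phi> ` (L \<inter> C))" using p by simp
    also have "\<dots> = measure leb01 (\<phi> -` \<phi> ` (L \<inter> C) \<inter> {0..1})"
      using p im by (subst measure_distr) auto
    also have "\<phi> -` \<phi> ` (L \<inter> C) \<inter> {0..1} = L \<inter> C"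
      using L(2) inj by (auto simp: inj_on_def)
    finally have eq: "measure leb01 (\<phi> ` (L \<inter> C)) = measure leb01 (L \<inter> C)" .
    have "measure leb01 B \<le> measure leb01 ((L \<inter> C) \<union> (({0..1} - L) \<union> (B - C)))"
      using Ls B B01 by (intro leb01.finite_measure_mono) auto
    also have "\<dots> \<le> measure leb01 (L \<inter> C) + measure leb01 (({0..1} - L) \<union> (B - C))"
      using Ls B by (intro measure_Un_le) auto
    also have "measure leb01 (({0..1} - L) \<union> (B - C)) \<le> measure leb01 ({0..1} - L) + measure leb01 (B - C)"
      using Ls B by (intro measure_Un_le) auto
    finally have "measure leb01 (\<phi> ` (L \<inter> C)) > measure leb01 B - e" using eq L C by simp
    moreover have "L \<inter> C \<subseteq> B" "L \<inter> C \<in> sets leb01" using C(2) Ls by auto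
    ultimately show ?thesis using im by blast
  qed
  have A01: "A \<subseteq> {0..1}" using sets.sets_into_space[OF A] by simp
  have "\<phi> ` A \<in> fmeasurable leb01 \<and> measure leb01 A = measure leb01 (\<phi> ` A)"
  proof (rule c.fmeasurable_measure_inner_outer[THEN iffD2], intro conjI allI impI)
    fix e :: real assume "e > 0"
    from inner[OF A this] obtain K where "K \<subseteq> A" "\<phi> ` K \<in> sets leb01" "measure leb01 A - e < measure leb01 (\<phi> ` K)"
      by auto
    then show "\<exists>T\<in>fmeasurable leb01. T \<subseteq> \<phi> ` A \<and> measure leb01 A - e < measure leb01 T"
      by (intro bexI[of _ "\<phi> ` K"] conjI image_mono fm)
  next
    fix e :: real assume e: "e > 0"
    \<comment> \<open>An outer approximation of the image of \<open>A\<close> is the complement of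
      an inner approximation of the image of the complement; injectivity keeps the two images
      apart.\<close>
    have A': "{0..1} - A \<in> sets leb01" using A sets.compl_sets[of A leb01] by simp
    obtain K where K: "K \<subseteq> {0..1} - A" "\<phi> ` K \<in> sets leb01" "measure leb01 (\<phi> ` K) > measure leb01 ({0..1} - A) - e"
      using inner[OF A' e] by blast
    have "measure leb01 ({0..1} - \<phi> ` K) = 1 - measure leb01 (\<phi> ` K)"
      using leb01.finite_measure_compl[OF K(2)] by simp
    moreover have "measure leb01 ({0..1} - A) = 1 - measure leb01 A"
      using leb01.finite_measure_compl[OF A] by simp
    moreover have "\<phi> ` A \<subseteq> {0..1} - \<phi> ` K"
      using K(1) A01 inj p(4) by (auto simp: inj_on_def subset_eq simp del: atLeastAtMost_iff)
    moreover have "{0..1} - \<phi> ` K \<in> fmeasurable leb01"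
      using K(2) sets.compl_sets[of "\<phi> ` K" leb01] by (intro fm) simp
    ultimately show "\<exists>U\<in>fmeasurable leb01. \<phi> ` A \<subseteq> U \<and> measure leb01 U < measure leb01 A + e"
      using K(3) by (intro bexI[of _ "{0..1} - \<phi> ` K"]) auto
  qed
  then show "\<phi> ` A \<in> sets leb01" "emeasure leb01 (\<phi> ` A) = emeasure leb01 A"
    by (auto simp: leb01.emeasure_eq_measure)
qed

text \<open>Preimages under the inverse are images under \<open>\<phi>\<close>, so measurability and
  measure preservation of the inverse are the two facts in
  \<open>mp_bijections_image\<close>.\<close>

lemma inverse_mp_bijections:
  assumes \<phi>: "\<phi> \<in> mp_bijections"
  obtains \<psi> where "\<psi> \<in> mp_bijections" "\<And>x. x \<in> {0..1} \<Longrightarrow> \<phi> (\<psi> x) = x" "\<And>x. x \<in> {0..1} \<Longrightarrow> \<psi> (\<phi> x) = x"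
proof -
  note p = mp_bijectionsD[OF \<phi>]
  define \<psi> where "\<psi> = the_inv_into {0..1} \<phi>"
  have inj: "inj_on \<phi> {0..1}" and surj: "\<phi> ` {0..1} = {0..1}" using p(1) by (auto simp: bij_betw_def)
  have bij: "bij_betw \<psi> {0..1} {0..1}" unfolding \<psi>_def using p(1) by (rule bij_betw_the_inv_into)
  have 1: "\<phi> (\<psi> x) = x" if "x \<in> {0..1}" for x
    unfolding \<psi>_def using inj surj that by (intro f_the_inv_into_f) auto
  have 2: "\<psi> (\<phi> x) = x" if "x \<in> {0..1}" for x
    unfolding \<psi>_def using inj that by (rule the_inv_into_f_f)
  have \<psi>01: "\<psi> x \<in> {0..1}" if "x \<in> {0..1}" for x using bij that by (rule bij_betwE[rule_format])
  have vim: "\<psi> -` A \<inter> {0..1} = \<phi> ` A" if "A \<subseteq> {0..1}" for A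
  proof (intro set_eqI iffI)
    fix x assume "x \<in> \<psi> -` A \<inter> {0..1}"
    then show "x \<in> \<phi> ` A" using 1[of x] by (metis IntD1 IntD2 image_eqI vimageD)
  next
    fix x assume "x \<in> \<phi> ` A"
    then obtain a where "a \<in> A" "x = \<phi> a" by auto
    then show "x \<in> \<psi> -` A \<inter> {0..1}" using that 2 p(4) by auto
  qed
  have m: "\<psi> \<in> measurable leb01 leb01"
  proof (rule measurableI)
    fix A assume A: "A \<in> sets leb01"
    then have "A \<subseteq> {0..1}" using sets.sets_into_space[of A leb01] by simp
    then show "\<psi> -` A \<inter> space leb01 \<in> sets leb01"
      using vim mp_bijections_image(1)[OF \<phi> A] by simp
  qed (use \<psi>01 in auto)
  have "distr leb01 leb01 \<psi> = leb01"
  proof (rule measure_eqI)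
    fix A assume "A \<in> sets (distr leb01 leb01 \<psi>)"
    then have A: "A \<in> sets leb01" by simp
    then have "A \<subseteq> {0..1}" using sets.sets_into_space[of A leb01] by simp
    then show "emeasure (distr leb01 leb01 \<psi>) A = emeasure leb01 A"
      using vim mp_bijections_image(2)[OF \<phi> A] A m by (simp add: emeasure_distr)
  qed simp
  then have "\<psi> \<in> mp_bijections" using bij m by (simp add: mp_bijections_def)
  then show thesis using that 1 2 by blast
qed

text \<open>As \<open>\<phi>\<close> is only Lebesgue measurable, the product map starts on the
  product of the completed factors and lands in the Borel product. Completing the target comes last
  and uses that the measure is preserved.\<close>

lemma measurable_map_prod_leb_sq:
  assumes "\<phi> \<in> mp_bijections"
  shows "map_prod \<phi> \<phi> \<in> measurable leb_sq leb_sq"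
    and "distr leb_sq leb_sq (map_prod \<phi> \<phi>) = leb_sq"
proof -
  note p = mp_bijectionsD[OF assms]
  have id: "(\<lambda>x. x) \<in> measurable leb01 unit1"
    unfolding leb01_eq by (intro measurable_completion) simp
  have did: "distr leb01 unit1 (\<lambda>x. x) = unit1"
    unfolding leb01_eq by (simp add: distr_completion distr_id)
  have \<phi>1: "\<phi> \<in> measurable leb01 unit1"
    using measurable_compose[OF p(2) id] by simp
  have "distr leb01 unit1 \<phi> = distr (distr leb01 leb01 \<phi>) unit1 (\<lambda>x. x)"
    using p(2) id by (subst distr_distr) (auto simp: comp_def)
  then have d\<phi>: "distr leb01 unit1 \<phi> = unit1" using p did by simp
  have mp: "map_prod \<phi> \<phi> = (\<lambda>(x, y). (\<phi> x, \<phi> y))" by auto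
  have mp1: "map_prod \<phi> \<phi> \<in> measurable (leb01 \<Otimes>\<^sub>M leb01) (unit1 \<Otimes>\<^sub>M unit1)"
    unfolding mp using \<phi>1 by measurable
  have "unit1 \<Otimes>\<^sub>M unit1 = distr leb01 unit1 \<phi> \<Otimes>\<^sub>M distr leb01 unit1 \<phi>"
    unfolding d\<phi> ..
  also have "\<dots> = distr (leb01 \<Otimes>\<^sub>M leb01) (unit1 \<Otimes>\<^sub>M unit1) (map_prod \<phi> \<phi>)"
    unfolding mp using \<phi>1 by (intro pair_measure_distr) (auto simp: d\<phi> intro: unit1.sigma_finite_measure_axioms)
  also have "\<dots> = distr (distr leb_sq (leb01 \<Otimes>\<^sub>M leb01) (\<lambda>p. p)) (unit1 \<Otimes>\<^sub>M unit1) (map_prod \<phi> \<phi>)"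
    unfolding distr_leb_sq_pair ..
  also have "\<dots> = distr leb_sq (unit1 \<Otimes>\<^sub>M unit1) (map_prod \<phi> \<phi>)"
    using mp1 measurable_leb_sq_pair by (subst distr_distr) (auto simp: comp_def)
  finally have "distr leb_sq (unit1 \<Otimes>\<^sub>M unit1) (map_prod \<phi> \<phi>) = unit1 \<Otimes>\<^sub>M unit1" ..
  moreover have "map_prod \<phi> \<phi> \<in> measurable leb_sq (unit1 \<Otimes>\<^sub>M unit1)"
    using measurable_compose[OF measurable_leb_sq_pair mp1] by simp
  ultimately show "map_prod \<phi> \<phi> \<in> measurable leb_sq leb_sq"
    "distr leb_sq leb_sq (map_prod \<phi> \<phi>) = leb_sq"
    using distr_completion_eq_completion[of "map_prod \<phi> \<phi>" "unit1 \<Otimes>\<^sub>M unit1" "unit1 \<Otimes>\<^sub>M unit1"]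
    unfolding leb_sq_eq by auto
qed

section \<open>Cut distance and cut metric\<close>

lemma graphonD:
  assumes "h \<in> graphons"
  shows "case_prod h \<in> borel_measurable leb_sq"
    "\<And>p. p \<in> {0..1} \<times> {0..1} \<Longrightarrow> 0 \<le> case_prod h p"
    "\<And>p. p \<in> {0..1} \<times> {0..1} \<Longrightarrow> case_prod h p \<le> 1"
    "\<And>x y. x \<in> {0..1} \<Longrightarrow> y \<in> {0..1} \<Longrightarrow> h x y = h y x"
    "\<And>x y. x \<in> {0..1} \<Longrightarrow> y \<in> {0..1} \<Longrightarrow> 0 \<le> h x y"
    "\<And>x y. x \<in> {0..1} \<Longrightarrow> y \<in> {0..1} \<Longrightarrow> h x y \<le> 1"
  using assms by (auto simp: graphons_def)

lemma graphonI:
  assumes "case_prod h \<in> borel_measurable leb_sq"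
    "\<And>x y. x \<in> {0..1} \<Longrightarrow> y \<in> {0..1} \<Longrightarrow> 0 \<le> h x y"
    "\<And>x y. x \<in> {0..1} \<Longrightarrow> y \<in> {0..1} \<Longrightarrow> h x y \<le> 1"
    "\<And>x y. x \<in> {0..1} \<Longrightarrow> y \<in> {0..1} \<Longrightarrow> h x y = h y x"
  shows "h \<in> graphons"
  using assms unfolding graphons_def by blast

lemma integrable_leb_sq_bounded:
  fixes f :: "real \<times> real \<Rightarrow> real"
  assumes "f \<in> borel_measurable leb_sq" "\<And>p. p \<in> {0..1} \<times> {0..1} \<Longrightarrow> \<bar>f p\<bar> \<le> B"
  shows "integrable leb_sq f"
  using assms by (intro leb_sq.integrable_const_bound[of _ B] AE_I2) auto

lemma graphon_integrable: "h \<in> graphons \<Longrightarrow> integrable leb_sq (case_prod h)"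
  by (rule integrable_leb_sq_bounded[of _ 1]) (use graphonD in \<open>auto simp del: split_beta split_conv\<close>)

lemma graphon_diff_bound:
  assumes "h \<in> graphons" "k \<in> graphons" "p \<in> {0..1} \<times> {0..1}"
  shows "\<bar>case_prod h p - case_prod k p\<bar> \<le> 1"
  using graphonD(2,3)[OF assms(1,3)] graphonD(2,3)[OF assms(2,3)] by linarith

lemma relabel_apply: "case_prod (relabel h \<phi>) p = case_prod h (map_prod \<phi> \<phi> p)"
  by (cases p) (simp add: relabel_def)

lemma relabel_graphons:
  assumes h: "h \<in> graphons" and \<phi>: "\<phi> \<in> mp_bijections"
  shows "relabel h \<phi> \<in> graphons"
proof (rule graphonI)
  show "case_prod (relabel h \<phi>) \<in> borel_measurable leb_sq"
    unfolding relabel_apply[abs_def]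
    using measurable_map_prod_leb_sq(1)[OF \<phi>] graphonD(1)[OF h] by (rule measurable_compose)
qed (use graphonD[OF h] mp_bijectionsD(4)[OF \<phi>] in \<open>auto simp: relabel_def simp del: atLeastAtMost_iff\<close>)

lemma integral_map_prod_leb_sq:
  fixes f :: "real \<times> real \<Rightarrow> real"
  assumes \<phi>: "\<phi> \<in> mp_bijections" and f: "f \<in> borel_measurable leb_sq"
  shows "(LINT p|leb_sq. f (map_prod \<phi> \<phi> p)) = integral\<^sup>L leb_sq f"
  using integral_distr[OF measurable_map_prod_leb_sq(1)[OF \<phi>] f] measurable_map_prod_leb_sq(2)[OF \<phi>] by simp

definition dist_L1 :: "(real \<Rightarrow> real \<Rightarrow> real) \<Rightarrow> (real \<Rightarrow> real \<Rightarrow> real) \<Rightarrow> real" where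
  "dist_L1 h k = (LINT p|leb_sq. \<bar>case_prod h p - case_prod k p\<bar>)"

definition sqdist_L2 :: "(real \<Rightarrow> real \<Rightarrow> real) \<Rightarrow> (real \<Rightarrow> real \<Rightarrow> real) \<Rightarrow> real" where
  "sqdist_L2 h k = (LINT p|leb_sq. (case_prod h p - case_prod k p)\<^sup>2)"

definition rect_diff :: "(real \<Rightarrow> real \<Rightarrow> real) \<Rightarrow> (real \<Rightarrow> real \<Rightarrow> real) \<Rightarrow> real set \<Rightarrow> real set \<Rightarrow> real" where
  "rect_diff h k S T = (LINT p|leb_sq. indicator (S \<times> T) p * (case_prod h p - case_prod k p))"

lemma graphon_diff_integrable:
  assumes "h \<in> graphons" "k \<in> graphons"
  shows "integrable leb_sq (\<lambda>p. \<bar>case_prod h p - case_prod k p\<bar>)"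
    "integrable leb_sq (\<lambda>p. (case_prod h p - case_prod k p)\<^sup>2)"
    "A \<in> sets leb_sq \<Longrightarrow> integrable leb_sq (\<lambda>p. indicator A p * (case_prod h p - case_prod k p))"
proof -
  note [measurable] = graphonD(1)[OF assms(1)] graphonD(1)[OF assms(2)]
  note bd = graphon_diff_bound[OF assms]
  show "integrable leb_sq (\<lambda>p. \<bar>case_prod h p - case_prod k p\<bar>)"
    by (rule integrable_leb_sq_bounded[of _ 1], measurable) (simp only: abs_idempotent bd)
  show "integrable leb_sq (\<lambda>p. (case_prod h p - case_prod k p)\<^sup>2)"
    by (rule integrable_leb_sq_bounded[of _ 1], measurable) (simp only: abs_power2 abs_square_le_1 bd)
  assume [measurable]: "A \<in> sets leb_sq"
  show "integrable leb_sq (\<lambda>p. indicator A p * (case_prod h p - case_prod k p))"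
  proof (rule integrable_leb_sq_bounded[of _ 1])
    fix p :: "real \<times> real" assume "p \<in> {0..1} \<times> {0..1}"
    from bd[OF this] show "\<bar>indicator A p * (case_prod h p - case_prod k p)\<bar> \<le> 1"
      by (cases "p \<in> A") auto
  qed measurable
qed

lemma cut_dist_eq: "cut_dist h k = (SUP (S, T) \<in> sets leb01 \<times> sets leb01. \<bar>rect_diff h k S T\<bar>)"
proof -
  have "set_lebesgue_integral lebesgue (S \<times> T) (\<lambda>(x, y). h x y - k x y) = rect_diff h k S T"
    if "S \<in> sets leb01" "T \<in> sets leb01" for S T
  proof -
    have st: "S \<subseteq> {0..1}" "T \<subseteq> {0..1}" using that[THEN sets.sets_into_space] by simp_all
    have "indicator (S \<times> T) p * (case p of (x, y) \<Rightarrow> h x y - k x y) =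
      indicator ({0..1} \<times> {0..1}) p * (indicator (S \<times> T) p * (case_prod h p - case_prod k p))" for p :: "real \<times> real"
      using st by (cases p) (auto split: split_indicator)
    moreover have "{0..1::real} \<times> {0..1::real} \<in> sets lebesgue" by (auto intro!: sets_completionI_sets borel_Times)
    ultimately show ?thesis
      unfolding set_lebesgue_integral_def rect_diff_def
      by (subst integral_restrict_space) (simp_all only: real_scaleR_def space_completion space_lborel space_borel Int_UNIV_right)
  qed
  then show ?thesis unfolding cut_dist_def by (intro SUP_cong) auto
qed

lemma abs_rect_diff_le_dist_L1:
  assumes "h \<in> graphons" "k \<in> graphons" "S \<in> sets leb01" "T \<in> sets leb01"
  shows "\<bar>rect_diff h k S T\<bar> \<le> dist_L1 h k"
proof -
  have "\<bar>rect_diff h k S T\<bar> \<le> (LINT p|leb_sq. \<bar>indicator (S \<times> T) p * (case_prod h p - case_prod k p)\<bar>)"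
    unfolding rect_diff_def by (rule integral_abs_bound)
  also have "\<dots> \<le> dist_L1 h k"
    unfolding dist_L1_def
  proof (rule integral_mono[OF integrable_abs])
    show "\<bar>indicator (S \<times> T) p * (case_prod h p - case_prod k p)\<bar> \<le> \<bar>case_prod h p - case_prod k p\<bar>" for p
      by (cases "p \<in> S \<times> T") auto
  qed (rule graphon_diff_integrable[OF assms(1,2)] sets_leb_sq_Times[OF assms(3,4)])+
  finally show ?thesis .
qed

lemma abs_rect_diff_le_cut_dist:
  assumes "h \<in> graphons" "k \<in> graphons" "S \<in> sets leb01" "T \<in> sets leb01"
  shows "\<bar>rect_diff h k S T\<bar> \<le> cut_dist h k"
proof -
  have "bdd_above ((\<lambda>(S, T). \<bar>rect_diff h k S T\<bar>) ` (sets leb01 \<times> sets leb01))"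
    using abs_rect_diff_le_dist_L1[OF assms(1,2)] by (intro bdd_aboveI2[of _ _ "dist_L1 h k"]) auto
  then have "(case (S, T) of (S, T) \<Rightarrow> \<bar>rect_diff h k S T\<bar>) \<le> cut_dist h k"
    unfolding cut_dist_eq using assms by (intro cSUP_upper) auto
  then show ?thesis by simp
qed

lemma cut_dist_least:
  assumes "\<And>S T. S \<in> sets leb01 \<Longrightarrow> T \<in> sets leb01 \<Longrightarrow> \<bar>rect_diff h k S T\<bar> \<le> c"
  shows "cut_dist h k \<le> c"
proof -
  have "sets leb01 \<times> sets leb01 \<noteq> {}" by auto
  then show ?thesis unfolding cut_dist_eq using assms by (intro cSUP_least) auto
qed

lemma cut_dist_nonneg:
  assumes "h \<in> graphons" "k \<in> graphons" shows "0 \<le> cut_dist h k"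
  using abs_rect_diff_le_cut_dist[OF assms, of "{}" "{}"] by simp

lemma cut_dist_le_dist_L1:
  assumes "h \<in> graphons" "k \<in> graphons" shows "cut_dist h k \<le> dist_L1 h k"
  using abs_rect_diff_le_dist_L1[OF assms] by (rule cut_dist_least)

lemma cut_dist_commute: "cut_dist h k = cut_dist k h"
proof -
  have "rect_diff h k S T = - rect_diff k h S T" for S T
    unfolding rect_diff_def integral_minus[symmetric]
    by (intro Bochner_Integration.integral_cong) (auto simp: right_diff_distrib)
  then show ?thesis unfolding cut_dist_eq by simp
qed

lemma cut_dist_triangle:
  assumes "h \<in> graphons" "k \<in> graphons" "l \<in> graphons"
  shows "cut_dist h l \<le> cut_dist h k + cut_dist k l"
proof (rule cut_dist_least)
  fix S T assume ST: "S \<in> sets leb01" "T \<in> sets leb01"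
  have "rect_diff h l S T = rect_diff h k S T + rect_diff k l S T"
    unfolding rect_diff_def
      Bochner_Integration.integral_add[OF graphon_diff_integrable(3)[OF assms(1,2) sets_leb_sq_Times[OF ST]]
        graphon_diff_integrable(3)[OF assms(2,3) sets_leb_sq_Times[OF ST]], symmetric]
    by (intro Bochner_Integration.integral_cong) (auto simp: right_diff_distrib)
  then show "\<bar>rect_diff h l S T\<bar> \<le> cut_dist h k + cut_dist k l"
    using abs_rect_diff_le_cut_dist[OF assms(1,2) ST] abs_rect_diff_le_cut_dist[OF assms(2,3) ST] by linarith
qed

lemma cut_dist_cong:
  assumes "\<And>x y. x \<in> {0..1} \<Longrightarrow> y \<in> {0..1} \<Longrightarrow> h x y = h' x y"
    "\<And>x y. x \<in> {0..1} \<Longrightarrow> y \<in> {0..1} \<Longrightarrow> k x y = k' x y"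
  shows "cut_dist h k = cut_dist h' k'"
proof -
  have "rect_diff h k S T = rect_diff h' k' S T" for S T
    unfolding rect_diff_def using assms by (intro Bochner_Integration.integral_cong) auto
  then show ?thesis unfolding cut_dist_eq by simp
qed

text \<open>Relabelling permutes the rectangles over which the supremum is taken. One inequality
  sends S and T to their images, which have to be measurable; the other uses preimages.\<close>

lemma cut_dist_relabel:
  assumes h: "h \<in> graphons" and k: "k \<in> graphons" and \<phi>: "\<phi> \<in> mp_bijections"
  shows "cut_dist (relabel h \<phi>) (relabel k \<phi>) = cut_dist h k"
proof (rule antisym)
  note [measurable] = graphonD(1)[OF h] graphonD(1)[OF k]
  have inj: "inj_on \<phi> {0..1}" using mp_bijectionsD(1)[OF \<phi>] by (simp add: bij_betw_def)
  have eq: "rect_diff (relabel h \<phi>) (relabel k \<phi>) S T = rect_diff h k S' T'"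
    if ST: "S' \<in> sets leb01" "T' \<in> sets leb01"
      and *: "\<And>x. x \<in> {0..1} \<Longrightarrow> x \<in> S \<longleftrightarrow> \<phi> x \<in> S'" "\<And>x. x \<in> {0..1} \<Longrightarrow> x \<in> T \<longleftrightarrow> \<phi> x \<in> T'" for S T S' T'
  proof -
    have [measurable]: "S' \<times> T' \<in> sets leb_sq" using ST by (rule sets_leb_sq_Times)
    have "rect_diff (relabel h \<phi>) (relabel k \<phi>) S T =
      (LINT p|leb_sq. indicator (S' \<times> T') (map_prod \<phi> \<phi> p) * (case_prod h (map_prod \<phi> \<phi> p) - case_prod k (map_prod \<phi> \<phi> p)))"
      unfolding rect_diff_def relabel_apply
      using * by (intro Bochner_Integration.integral_cong) (auto simp: indicator_def)
    also have "\<dots> = rect_diff h k S' T'"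
      unfolding rect_diff_def by (rule integral_map_prod_leb_sq[OF \<phi>]) measurable
    finally show ?thesis .
  qed
  show "cut_dist (relabel h \<phi>) (relabel k \<phi>) \<le> cut_dist h k"
  proof (rule cut_dist_least)
    fix S T assume ST: "S \<in> sets leb01" "T \<in> sets leb01"
    have "S \<subseteq> {0..1}" "T \<subseteq> {0..1}" using ST[THEN sets.sets_into_space] by simp_all
    then have "rect_diff (relabel h \<phi>) (relabel k \<phi>) S T = rect_diff h k (\<phi> ` S) (\<phi> ` T)"
      using inj by (intro eq mp_bijections_image \<phi> ST) (auto simp: inj_on_image_mem_iff)
    then show "\<bar>rect_diff (relabel h \<phi>) (relabel k \<phi>) S T\<bar> \<le> cut_dist h k"
      using abs_rect_diff_le_cut_dist[OF h k] mp_bijections_image(1)[OF \<phi>] ST by simp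
  qed
  show "cut_dist h k \<le> cut_dist (relabel h \<phi>) (relabel k \<phi>)"
  proof (rule cut_dist_least)
    fix S T assume ST: "S \<in> sets leb01" "T \<in> sets leb01"
    have m: "\<phi> -` A \<inter> {0..1} \<in> sets leb01" if "A \<in> sets leb01" for A
      using measurable_sets[OF mp_bijectionsD(2)[OF \<phi>] that] by simp
    have "rect_diff (relabel h \<phi>) (relabel k \<phi>) (\<phi> -` S \<inter> {0..1}) (\<phi> -` T \<inter> {0..1}) = rect_diff h k S T"
      using ST by (intro eq) auto
    then show "\<bar>rect_diff h k S T\<bar> \<le> cut_dist (relabel h \<phi>) (relabel k \<phi>)"
      using abs_rect_diff_le_cut_dist[OF relabel_graphons[OF h \<phi>] relabel_graphons[OF k \<phi>] m[OF ST(1)] m[OF ST(2)]] by simp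
  qed
qed

section \<open>The cut metric as a pseudometric on graphons\<close>

lemma mp_bijections_nonempty: "mp_bijections \<noteq> {}" using id_mp_bijections by blast

lemma cut_metric_bdd:
  assumes "h \<in> graphons" "k \<in> graphons"
  shows "bdd_below ((\<lambda>\<phi>. cut_dist h (relabel k \<phi>)) ` mp_bijections)"
  using cut_dist_nonneg[OF assms(1) relabel_graphons[OF assms(2)]] by (intro bdd_belowI2[of _ 0]) auto

lemma cut_metric_le:
  assumes "h \<in> graphons" "k \<in> graphons" "\<phi> \<in> mp_bijections"
  shows "cut_metric h k \<le> cut_dist h (relabel k \<phi>)"
  unfolding cut_metric_def using cut_metric_bdd[OF assms(1,2)] assms(3) by (rule cINF_lower)

lemma cut_metric_nonneg:
  assumes "h \<in> graphons" "k \<in> graphons" shows "0 \<le> cut_metric h k"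
  unfolding cut_metric_def
  using cut_dist_nonneg[OF assms(1) relabel_graphons[OF assms(2)]] mp_bijections_nonempty by (intro cINF_greatest) auto

lemma cut_metric_approx:
  assumes "h \<in> graphons" "k \<in> graphons" "e > 0"
  obtains \<phi> where "\<phi> \<in> mp_bijections" "cut_dist h (relabel k \<phi>) < cut_metric h k + e"
  using cINF_less_iff[OF mp_bijections_nonempty cut_metric_bdd[OF assms(1,2)], of "cut_metric h k + e"] assms(3)
  unfolding cut_metric_def by auto

text \<open>Relabelling both arguments by the inverse of a nearly optimal bijection moves the
  relabelling to the other argument. The infimum need not be attained, hence the slack
  \<open>e\<close>.\<close>

lemma cut_metric_commute:
  assumes "h \<in> graphons" "k \<in> graphons" shows "cut_metric h k = cut_metric k h"
proof -
  have "cut_metric k h \<le> cut_metric h k" if h: "h \<in> graphons" and k: "k \<in> graphons" for h k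
  proof (rule field_le_epsilon)
    fix e :: real assume e: "e > 0"
    obtain \<phi> where \<phi>: "\<phi> \<in> mp_bijections" "cut_dist h (relabel k \<phi>) < cut_metric h k + e"
      using cut_metric_approx[OF h k e] .
    obtain \<psi> where \<psi>: "\<psi> \<in> mp_bijections" "\<And>x. x \<in> {0..1} \<Longrightarrow> \<phi> (\<psi> x) = x"
      using inverse_mp_bijections[OF \<phi>(1)] by metis
    have "cut_metric k h \<le> cut_dist k (relabel h \<psi>)" using k h \<psi>(1) by (rule cut_metric_le)
    also have "\<dots> = cut_dist (relabel h \<psi>) (relabel (relabel k \<phi>) \<psi>)"
      by (subst cut_dist_commute, rule cut_dist_cong) (auto simp: relabel_def \<psi>(2) simp del: atLeastAtMost_iff)
    also have "\<dots> = cut_dist h (relabel k \<phi>)"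
      by (rule cut_dist_relabel[OF h relabel_graphons[OF k \<phi>(1)] \<psi>(1)])
    finally show "cut_metric k h \<le> cut_metric h k + e" using \<phi>(2) by simp
  qed
  then show ?thesis using assms by (intro antisym) auto
qed

lemma cut_metric_triangle:
  assumes h: "h \<in> graphons" and k: "k \<in> graphons" and l: "l \<in> graphons"
  shows "cut_metric h l \<le> cut_metric h k + cut_metric k l"
proof (rule field_le_epsilon)
  fix e :: real assume e: "e > 0"
  obtain \<phi> where \<phi>: "\<phi> \<in> mp_bijections" "cut_dist h (relabel k \<phi>) < cut_metric h k + e/2"
    using cut_metric_approx[OF h k, of "e/2"] e by auto
  obtain \<psi> where \<psi>: "\<psi> \<in> mp_bijections" "cut_dist k (relabel l \<psi>) < cut_metric k l + e/2"
    using cut_metric_approx[OF k l, of "e/2"] e by auto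
  have "cut_metric h l \<le> cut_dist h (relabel l (\<psi> \<circ> \<phi>))"
    using h l comp_mp_bijections[OF \<psi>(1) \<phi>(1)] by (rule cut_metric_le)
  also have "relabel l (\<psi> \<circ> \<phi>) = relabel (relabel l \<psi>) \<phi>" by (simp add: relabel_def)
  also have "cut_dist h \<dots> \<le> cut_dist h (relabel k \<phi>) + cut_dist (relabel k \<phi>) (relabel (relabel l \<psi>) \<phi>)"
    using h k l \<phi>(1) \<psi>(1) by (intro cut_dist_triangle relabel_graphons)
  also have "cut_dist (relabel k \<phi>) (relabel (relabel l \<psi>) \<phi>) = cut_dist k (relabel l \<psi>)"
    using h k l \<phi>(1) \<psi>(1) by (intro cut_dist_relabel relabel_graphons)
  finally show "cut_metric h l \<le> cut_metric h k + cut_metric k l + e" using \<phi> \<psi> by linarith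
qed

lemma cut_metric_self:
  assumes "h \<in> graphons" shows "cut_metric h h = 0"
proof -
  have "cut_metric h h \<le> cut_dist h (relabel h (\<lambda>x. x))"
    using assms assms id_mp_bijections by (rule cut_metric_le)
  also have "\<dots> \<le> dist_L1 h h" using cut_dist_le_dist_L1[OF assms assms] by (simp add: relabel_def)
  also have "\<dots> = 0" by (simp add: dist_L1_def)
  finally show ?thesis using cut_metric_nonneg[OF assms assms] by simp
qed

section \<open>The metric space of graphon classes\<close>

lemma equiv_cut_rel: "equiv graphons cut_rel"
proof (rule equivI)
  show "cut_rel \<subseteq> graphons \<times> graphons" by (auto simp: cut_rel_def)
  show "refl_on graphons cut_rel" by (auto simp: refl_on_def cut_rel_def cut_metric_self)
  show "sym cut_rel" by (auto simp: sym_def cut_rel_def cut_metric_commute)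
  show "trans cut_rel"
  proof (rule transI)
    fix h k l assume "(h, k) \<in> cut_rel" "(k, l) \<in> cut_rel"
    then show "(h, l) \<in> cut_rel"
      using cut_metric_triangle[of h k l] cut_metric_nonneg[of h l] by (auto simp: cut_rel_def)
  qed
qed

lemma rep_in:
  assumes "c \<in> graphon_classes"
  shows "rep c \<in> c" "rep c \<in> graphons"
proof -
  obtain h where h: "h \<in> graphons" "c = cut_rel `` {h}" using assms by (auto simp: graphon_classes_def elim: quotientE)
  then have "h \<in> c" using equiv_class_self[OF equiv_cut_rel] by blast
  then show "rep c \<in> c" unfolding rep_def by (rule someI[of "\<lambda>h. h \<in> c"])
  then show "rep c \<in> graphons" using h by (auto simp: cut_rel_def)
qed

lemma class_in: "h \<in> graphons \<Longrightarrow> cut_rel `` {h} \<in> graphon_classes"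
  unfolding graphon_classes_def by (rule quotientI)

lemma rep_class: "h \<in> graphons \<Longrightarrow> (h, rep (cut_rel `` {h})) \<in> cut_rel"
  using rep_in(1)[OF class_in] by blast

lemma eq_classI:
  assumes "c \<in> graphon_classes" "(h, rep c) \<in> cut_rel"
  shows "c = cut_rel `` {h}"
  using assms rep_in(1)[OF assms(1)] equiv_class_eq[OF equiv_cut_rel assms(2)]
  by (auto simp: graphon_classes_def elim!: quotientE dest: equiv_class_eq[OF equiv_cut_rel])

text \<open>Serves to identify the points of \<open>graphon_topology\<close>, the topology in which
  compactness is claimed.\<close>

lemma Metric_space_class_metric: "Metric_space graphon_classes class_metric"
proof
  fix c d e
  show "0 \<le> class_metric c d" using rep_in cut_metric_nonneg by (auto simp: class_metric_def)
  show "class_metric c d = class_metric d c" using rep_in cut_metric_commute by (auto simp: class_metric_def)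
  assume cd: "c \<in> graphon_classes" "d \<in> graphon_classes"
  show "class_metric c d = 0 \<longleftrightarrow> c = d"
  proof
    assume "class_metric c d = 0"
    then have "(rep c, rep d) \<in> cut_rel" using cd rep_in by (auto simp: class_metric_def cut_rel_def)
    moreover have "(rep c, rep c) \<in> cut_rel" using rep_in(2)[OF cd(1)] by (auto simp: cut_rel_def cut_metric_self)
    ultimately show "c = d" using eq_classI[OF cd(1), of "rep c"] eq_classI[OF cd(2), of "rep c"] by simp
  next
    assume "c = d" then show "class_metric c d = 0" using cd rep_in cut_metric_self by (auto simp: class_metric_def)
  qed
  assume "e \<in> graphon_classes"
  then show "class_metric c e \<le> class_metric c d + class_metric d e"
    using cd rep_in cut_metric_triangle by (auto simp: class_metric_def)
qed

lemma topspace_graphon_topology: "topspace graphon_topology = graphon_classes"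
  unfolding graphon_topology_def
  by (rule Metric_space.topspace_mtopology[OF Metric_space_class_metric])

section \<open>The cut metric and the square norm\<close>

text \<open>The variance of the absolute difference of h and k, on a space of total mass one, is
  nonnegative.\<close>

lemma dist_L1_sq_le:
  assumes "h \<in> graphons" "k \<in> graphons"
  shows "(dist_L1 h k)\<^sup>2 \<le> sqdist_L2 h k"
proof -
  define c where "c = dist_L1 h k"
  define f where "f p = \<bar>case_prod h p - case_prod k p\<bar>" for p
  have f: "integrable leb_sq f" "integrable leb_sq (\<lambda>p. (f p)\<^sup>2)"
    unfolding f_def using graphon_diff_integrable(1,2)[OF assms] by (simp_all only: power2_abs)
  have [simp]: "integral\<^sup>L leb_sq f = c" "(LINT p|leb_sq. (f p)\<^sup>2) = sqdist_L2 h k"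
    unfolding c_def f_def dist_L1_def sqdist_L2_def by (simp_all only: power2_abs)
  have "0 \<le> (LINT p|leb_sq. (f p - c)\<^sup>2)" by (rule integral_nonneg_AE) auto
  also have "\<dots> = (LINT p|leb_sq. (f p)\<^sup>2 + (c\<^sup>2 - (2 * c) * f p))"
    by (intro Bochner_Integration.integral_cong) (auto simp: power2_diff)
  also have "\<dots> = sqdist_L2 h k + (c\<^sup>2 - (2 * c) * c)"
    using f by (subst Bochner_Integration.integral_add) (auto simp: Bochner_Integration.integral_diff)
  finally show ?thesis by (simp add: c_def power2_eq_square)
qed

lemma dist_L1_nonneg: "0 \<le> dist_L1 h k"
  unfolding dist_L1_def by (rule integral_nonneg_AE) auto

lemma sqdist_L2_nonneg: "0 \<le> sqdist_L2 h k"
  unfolding sqdist_L2_def by (rule integral_nonneg_AE) auto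

lemma dist_L1_tendsto_0:
  assumes "h \<in> graphons" "\<And>n. k n \<in> graphons" "(\<lambda>n. sqdist_L2 h (k n)) \<longlonglongrightarrow> 0"
  shows "(\<lambda>n. dist_L1 h (k n)) \<longlonglongrightarrow> 0"
proof (rule tendsto_sandwich[of "\<lambda>_. 0" _ _ "\<lambda>n. sqrt (sqdist_L2 h (k n))"])
  show "\<forall>\<^sub>F n in sequentially. dist_L1 h (k n) \<le> sqrt (sqdist_L2 h (k n))"
    by (intro always_eventually allI real_le_rsqrt dist_L1_sq_le assms(1,2))
  show "(\<lambda>n. sqrt (sqdist_L2 h (k n))) \<longlonglongrightarrow> 0"
    using tendsto_real_sqrt[OF assms(3)] by simp
qed (auto simp: dist_L1_nonneg)

text \<open>Dominated convergence for the rate and for the Laplacian takes pointwise limits as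
  input; this converts square-mean convergence into that form, at the price of a
  subsequence.\<close>

lemma sqdist_L2_AE_subseq:
  assumes "h \<in> graphons" "\<And>n. k n \<in> graphons" "(\<lambda>n. sqdist_L2 h (k n)) \<longlonglongrightarrow> 0"
  obtains s where "strict_mono s" "AE p in leb_sq. (\<lambda>n. case_prod (k (s n)) p) \<longlonglongrightarrow> case_prod h p"
proof -
  have "\<exists>s::nat\<Rightarrow>nat. strict_mono s \<and> (AE p in leb_sq. (\<lambda>n. case_prod h p - case_prod (k (s n)) p) \<longlonglongrightarrow> 0)"
  proof (rule tendsto_L1_AE_subseq)
    show "integrable leb_sq (\<lambda>p. case_prod h p - case_prod (k n) p)" for n
      using graphon_integrable assms by (intro Bochner_Integration.integrable_diff) auto
    show "(\<lambda>n. LINT p|leb_sq. norm (case_prod h p - case_prod (k n) p)) \<longlonglongrightarrow> 0"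
      using dist_L1_tendsto_0[OF assms] by (simp add: dist_L1_def)
  qed
  then obtain s :: "nat \<Rightarrow> nat" where s: "strict_mono s"
    "AE p in leb_sq. (\<lambda>n. case_prod h p - case_prod (k (s n)) p) \<longlonglongrightarrow> 0" by blast
  from s(2) have "AE p in leb_sq. (\<lambda>n. case_prod (k (s n)) p) \<longlonglongrightarrow> case_prod h p"
  proof eventually_elim
    case (elim p)
    from tendsto_diff[OF tendsto_const[of "case_prod h p"] elim] show ?case
      by (simp only: diff_diff_eq2 diff_zero add_diff_cancel_left')
  qed
  with s(1) show thesis by (rule that)
qed

text \<open>Cut-norm convergence gives convergence of integrals against indicators of rectangles; a
  Dynkin-class argument extends it to measurable sets, and density to all integrable functions.\<close>

lemma tendsto_integral_mult_of_rectangles: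
  fixes w :: "nat \<Rightarrow> real \<times> real \<Rightarrow> real"
  assumes w: "\<And>n. w n \<in> borel_measurable leb_sq" "\<And>n p. p \<in> {0..1} \<times> {0..1} \<Longrightarrow> \<bar>w n p\<bar> \<le> 1"
    and rect: "\<And>S T. S \<in> sets leb01 \<Longrightarrow> T \<in> sets leb01 \<Longrightarrow> (\<lambda>n. LINT p|leb_sq. indicator (S \<times> T) p * w n p) \<longlonglongrightarrow> 0"
    and g: "integrable leb_sq g"
  shows "(\<lambda>n. LINT p|leb_sq. g p * w n p) \<longlonglongrightarrow> 0"
proof -
  define P where "P f \<longleftrightarrow> (\<lambda>n. LINT p|leb_sq. f p * w n p) \<longlonglongrightarrow> 0" for f
  note [measurable] = w(1)
  have int: "integrable leb_sq (\<lambda>p. f p * w n p)" if "integrable leb_sq f" for f n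
  proof (rule Bochner_Integration.integrable_bound[OF that])
    show "AE p in leb_sq. norm (f p * w n p) \<le> norm (f p)"
      using w(2) by (intro AE_I2) (auto simp: abs_mult intro!: mult_left_le simp del: mem_Times_iff)
  qed (use that in measurable)
  \<comment> \<open>Since \<open>w n\<close> is bounded by 1, an \<open>L\<^sup>1\<close> error in
    the test function changes all the integrals by at most that error, uniformly in n.\<close>
  have P_lim: "P f" if f: "integrable leb_sq f" "\<And>k. integrable leb_sq (s k)" "\<And>k. P (s k)"
      and L: "(\<lambda>k. LINT p|leb_sq. \<bar>s k p - f p\<bar>) \<longlonglongrightarrow> 0" for f and s :: "nat \<Rightarrow> _"
    unfolding P_def
  proof (rule LIMSEQ_I)
    fix e :: real assume e: "0 < e"
    obtain k where k: "\<bar>LINT p|leb_sq. \<bar>s k p - f p\<bar>\<bar> < e/2"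
      using LIMSEQ_D[OF L, of "e/2"] e by auto
    obtain N where N: "\<And>n. n \<ge> N \<Longrightarrow> \<bar>LINT p|leb_sq. s k p * w n p\<bar> < e/2"
      using LIMSEQ_D[OF f(3)[of k, unfolded P_def], of "e/2"] e by auto
    show "\<exists>N. \<forall>n\<ge>N. norm ((LINT p|leb_sq. f p * w n p) - 0) < e"
    proof (intro exI allI impI)
      fix n assume n: "n \<ge> N"
      have d: "integrable leb_sq (\<lambda>p. s k p - f p)" using f by auto
      have "(LINT p|leb_sq. f p * w n p) = (LINT p|leb_sq. s k p * w n p) - (LINT p|leb_sq. (s k p - f p) * w n p)"
        using int[OF f(2)[of k]] int[OF d]
        by (subst Bochner_Integration.integral_diff[symmetric]) (auto simp: algebra_simps)
      moreover have "\<bar>LINT p|leb_sq. (s k p - f p) * w n p\<bar> \<le> (LINT p|leb_sq. \<bar>s k p - f p\<bar>)"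
      proof -
        have "\<bar>LINT p|leb_sq. (s k p - f p) * w n p\<bar> \<le> (LINT p|leb_sq. \<bar>(s k p - f p) * w n p\<bar>)"
          by (rule integral_abs_bound)
        also have "\<dots> \<le> (LINT p|leb_sq. \<bar>s k p - f p\<bar>)"
        proof (rule integral_mono_AE)
          show "AE p in leb_sq. \<bar>(s k p - f p) * w n p\<bar> \<le> \<bar>s k p - f p\<bar>"
            using w(2) by (intro AE_I2) (auto simp: abs_mult intro!: mult_left_le simp del: mem_Times_iff)
        qed (use int[OF d] d in auto)
        finally show ?thesis .
      qed
      ultimately show "norm ((LINT p|leb_sq. f p * w n p) - 0) < e"
        using N[OF n] k by simp
    qed
  qed
  have P_add: "P (\<lambda>p. f p + g p)" if "integrable leb_sq f" "P f" "integrable leb_sq g" "P g" for f g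
  proof -
    have "(LINT p|leb_sq. (f p + g p) * w n p) = (LINT p|leb_sq. f p * w n p) + (LINT p|leb_sq. g p * w n p)" for n
      using int[OF that(1)] int[OF that(3)] by (simp add: distrib_right)
    then show ?thesis using tendsto_add[OF that(2,4)[unfolded P_def]] by (simp add: P_def)
  qed
  have scale: "P (\<lambda>p. c * f p)" if "P f" for c f
    using tendsto_mult_left[OF that[unfolded P_def], of c] by (simp add: P_def mult.assoc)
  have ind: "integrable leb_sq (\<lambda>p. indicator A p :: real)" if "A \<in> sets leb_sq" for A
    using that by (intro integrable_leb_sq_bounded[of _ 1]) auto
  have ae: "P f" if "P g" "AE p in leb_sq. f p = g p" "f \<in> borel_measurable leb_sq" "g \<in> borel_measurable leb_sq" for f g
  proof -
    have "(LINT p|leb_sq. f p * w n p) = (LINT p|leb_sq. g p * w n p)" for n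
      using that by (intro integral_cong_AE) auto
    then show ?thesis using that by (simp add: P_def)
  qed
  have Q: "sets (unit1 \<Otimes>\<^sub>M unit1) \<subseteq> sets leb_sq" unfolding leb_sq_eq by auto
  have P_borel: "P (indicator A)" if "A \<in> sets (unit1 \<Otimes>\<^sub>M unit1)" for A
  proof -
    let ?G = "{a \<times> b | a b. a \<in> sets unit1 \<and> b \<in> sets unit1}"
    note Int_stable_pair_measure_generator[of unit1 unit1]
    moreover have "?G \<subseteq> Pow ({0..1} \<times> {0..1})" using pair_measure_closed[of unit1 unit1] by simp
    moreover have "A \<in> sigma_sets ({0..1} \<times> {0..1}) ?G"
      using that by (simp add: sets_pair_measure)
    ultimately show ?thesis
    proof (induction rule: sigma_sets_induct_disjoint)
      case (basic A)
      then show ?case using rect unfolding P_def leb01_eq by auto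
    next
      case empty show ?case by (simp add: P_def)
    next
      case (compl A)
      have A: "A \<in> sets leb_sq" using compl(1) Q by (auto simp: sets_pair_measure)
      have "{0..1} \<in> sets leb01" by blast
      from rect[OF this this] have "P (indicator ({0..1} \<times> {0..1}))" by (simp add: P_def)
      moreover have "P (\<lambda>p. - 1 * indicator A p)" using compl(2) by (rule scale)
      moreover have "{0..1} \<times> {0..1} \<in> sets leb_sq" by blast
      ultimately have "P (\<lambda>p. indicator ({0..1} \<times> {0..1}) p + - 1 * indicator A p)"
        using ind A by (intro P_add) auto
      moreover have "(\<lambda>p. indicator ({0..1} \<times> {0..1}) p + - 1 * indicator A p) = (indicator ({0..1} \<times> {0..1} - A) :: _ \<Rightarrow> real)"
        using sets.sets_into_space[OF A] by (auto simp: indicator_def fun_eq_iff)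
      ultimately show ?case by simp
    next
      case (union A)
      have A: "A i \<in> sets leb_sq" for i using union(2) Q by (auto simp: sets_pair_measure)
      have A': "(\<Union>i. A i) \<in> sets leb_sq" "(\<Union>i<k. A i) \<in> sets leb_sq" for k using A by auto
      show ?case
      \<comment> \<open>Finite disjoint unions are sums of indicators, and the countable union is
        their \<open>L\<^sup>1\<close> limit.\<close>
      proof (rule P_lim[where s = "\<lambda>k. indicator (\<Union>i<k. A i)"])
        show "P (indicator (\<Union>i<k. A i))" for k
        proof (induction k)
          case (Suc k)
          have "indicator (\<Union>i<Suc k. A i) = (\<lambda>p. indicator (\<Union>i<k. A i) p + indicator (A k) p :: real)"
          proof
            fix p
            have "A i \<inter> A k = {}" if "i < k" for i using union(1) that by (simp add: disjoint_family_on_def)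
            then have "(\<Union>i<k. A i) \<inter> A k = {}" by blast
            then show "indicator (\<Union>i<Suc k. A i) p = (indicator (\<Union>i<k. A i) p + indicator (A k) p :: real)"
              by (auto simp: indicator_def less_Suc_eq)
          qed
          then show ?case using P_add[OF ind[OF A'(2)] Suc ind[OF A] union(3)] by simp
        qed (simp add: P_def)
        have "(\<lambda>k. LINT p|leb_sq. \<bar>indicator (\<Union>i<k. A i) p - indicator (\<Union>i. A i) p :: real\<bar>) \<longlonglongrightarrow> (LINT p|leb_sq. 0)"
        proof (rule integral_dominated_convergence[where w = "\<lambda>_. 1"])
          show "AE p in leb_sq. (\<lambda>k. \<bar>indicator (\<Union>i<k. A i) p - indicator (\<Union>i. A i) p :: real\<bar>) \<longlonglongrightarrow> 0"
            using tendsto_rabs_zero[OF LIM_zero[OF LIMSEQ_indicator_UN]] by (intro AE_I2) auto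
        qed (use A A' in \<open>auto split: split_indicator\<close>)
        then show "(\<lambda>k. LINT p|leb_sq. \<bar>indicator (\<Union>i<k. A i) p - indicator (\<Union>i. A i) p :: real\<bar>) \<longlonglongrightarrow> 0" by simp
      qed (use ind A' in auto)
    qed
  qed
  have P_ind: "P (indicator A)" if "A \<in> sets leb_sq" for A
  proof -
    obtain B N N' where *: "A = B \<union> N" "N \<subseteq> N'" "N' \<in> null_sets (unit1 \<Otimes>\<^sub>M unit1)" "B \<in> sets (unit1 \<Otimes>\<^sub>M unit1)"
      using \<open>A \<in> sets leb_sq\<close> unfolding leb_sq_eq by (rule sets_completionE)
    have B: "B \<in> sets leb_sq" using *(4) Q by (rule rev_subsetD)
    have ae_eq: "AE p in leb_sq. indicator A p = (indicator B p :: real)"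
      unfolding leb_sq_eq AE_completion_iff using AE_not_in[OF *(3)]
      by eventually_elim (use * in \<open>auto simp: indicator_def\<close>)
    show ?thesis
      by (rule ae[OF P_borel[OF *(4)] ae_eq borel_measurable_indicator[OF that] borel_measurable_indicator[OF B]])
  qed
  from g have "P g"
  proof (induction rule: integrable_induct)
    case (base A c)
    then show ?case using scale[OF P_ind, of A c]
      by (simp add: mult.commute)
  next
    case (add f g) then show ?case by (intro P_add)
  next
    case (lim f s)
    \<comment> \<open>The approximating simple functions satisfy
      \<open>\<bar>s k p\<bar> \<le> 2 * \<bar>f p\<bar>\<close>, so their distance to f is
      dominated by \<open>3 * \<bar>f p\<bar>\<close>.\<close>
    have "(\<lambda>k. LINT p|leb_sq. \<bar>s k p - f p\<bar>) \<longlonglongrightarrow> (LINT p|leb_sq. 0)"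
    proof (rule integral_dominated_convergence[where w = "\<lambda>p. 3 * \<bar>f p\<bar>"])
      show "AE p in leb_sq. (\<lambda>k. \<bar>s k p - f p\<bar>) \<longlonglongrightarrow> 0"
        using tendsto_rabs_zero[OF LIM_zero[OF lim.hyps(2)]] by (intro AE_I2) auto
      show "AE p in leb_sq. norm \<bar>s k p - f p\<bar> \<le> 3 * \<bar>f p\<bar>" for k
        using lim.hyps(3)[of _ k] by (intro AE_I2) fastforce
    qed (use lim.hyps(1,4) in auto)
    then show ?case by (intro P_lim[OF lim.hyps(4,1) lim.IH]) simp
  qed
  then show ?thesis by (simp add: P_def)
qed

text \<open>Writing k' for a relabelling of k, one has
  \<open>(h - k')\<^sup>2 = k'\<^sup>2 - h\<^sup>2 - 2 * h * (k' - h)\<close>. The integral of the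
  first term does not depend on the relabelling, and that of the last tends to 0 by weak convergence
  with h itself as test function.\<close>

lemma cut_metric_zero_imp_weak:
  assumes h: "h \<in> graphons" and k: "k \<in> graphons" and 0: "cut_metric h k = 0"
  obtains \<phi> where "\<And>n. \<phi> n \<in> mp_bijections"
    "(\<lambda>n. sqdist_L2 h (relabel k (\<phi> n))) \<longlonglongrightarrow> (LINT p|leb_sq. (case_prod k p)\<^sup>2) - (LINT p|leb_sq. (case_prod h p)\<^sup>2)"
proof -
  have "\<exists>\<phi>. \<phi> \<in> mp_bijections \<and> cut_dist h (relabel k \<phi>) < 1 / real (Suc n)" for n
    by (rule cut_metric_approx[OF h k, of "1 / real (Suc n)"]) (use 0 in auto)
  then obtain \<phi> where \<phi>: "\<And>n. \<phi> n \<in> mp_bijections" "\<And>n. cut_dist h (relabel k (\<phi> n)) < 1 / real (Suc n)" by metis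
  note kg = relabel_graphons[OF k \<phi>(1)]
  define w where "w n p = case_prod (relabel k (\<phi> n)) p - case_prod h p" for n p
  have int: "integrable leb_sq (\<lambda>p. (case_prod g p)\<^sup>2)" if "g \<in> graphons" for g
  proof (rule integrable_leb_sq_bounded[of _ 1])
    fix p :: "real \<times> real" assume "p \<in> {0..1} \<times> {0..1}"
    from graphonD(2,3)[OF that this] show "\<bar>(case_prod g p)\<^sup>2\<bar> \<le> 1" by (simp only: abs_power2 abs_square_le_1)
  qed (use graphonD(1)[OF that] in measurable)
  have lim: "(\<lambda>n. LINT p|leb_sq. case_prod h p * w n p) \<longlonglongrightarrow> 0"
  proof (rule tendsto_integral_mult_of_rectangles)
    show "w n \<in> borel_measurable leb_sq" for n
      unfolding w_def using graphonD(1)[OF h] graphonD(1)[OF kg] by (intro borel_measurable_diff)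
    show "\<bar>w n p\<bar> \<le> 1" if "p \<in> {0..1} \<times> {0..1}" for n p
      unfolding w_def using kg h that by (rule graphon_diff_bound)
    show "(\<lambda>n. LINT p|leb_sq. indicator (S \<times> T) p * w n p) \<longlonglongrightarrow> 0"
      if "S \<in> sets leb01" "T \<in> sets leb01" for S T
    proof (rule LIMSEQ_norm_0)
      fix n
      have "(LINT p|leb_sq. indicator (S \<times> T) p * w n p) = rect_diff (relabel k (\<phi> n)) h S T"
        by (simp add: rect_diff_def w_def)
      then show "norm (LINT p|leb_sq. indicator (S \<times> T) p * w n p) < 1 / real (Suc n)"
        using abs_rect_diff_le_cut_dist[OF kg h that, of n] \<phi>(2)[of n] cut_dist_commute[of h] by simp
    qed
  qed (rule graphon_integrable[OF h])
  have eq: "sqdist_L2 h (relabel k (\<phi> n)) = (LINT p|leb_sq. (case_prod k p)\<^sup>2) - (LINT p|leb_sq. (case_prod h p)\<^sup>2)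
      - 2 * (LINT p|leb_sq. case_prod h p * w n p)" for n
  proof -
    let ?k = "relabel k (\<phi> n)"
    have "(LINT p|leb_sq. (case_prod ?k p)\<^sup>2) = (LINT p|leb_sq. (case_prod k p)\<^sup>2)"
      unfolding relabel_apply
      by (rule integral_map_prod_leb_sq[OF \<phi>(1), where f = "\<lambda>p. (case_prod k p)\<^sup>2"])
         (use graphonD(1)[OF k] in measurable)
    moreover have "integrable leb_sq (\<lambda>p. case_prod h p * w n p)"
    proof (rule integrable_leb_sq_bounded[of _ 1])
      fix p :: "real \<times> real" assume p: "p \<in> {0..1} \<times> {0..1}"
      show "\<bar>case_prod h p * w n p\<bar> \<le> 1"
        unfolding abs_mult w_def using graphonD(2,3)[OF h p] graphon_diff_bound[OF kg h p]
        by (intro mult_le_one) auto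
    qed (use graphonD(1)[OF h] graphonD(1)[OF kg] in \<open>simp only: w_def, measurable\<close>)
    moreover have "sqdist_L2 h ?k = (LINT p|leb_sq. (case_prod ?k p)\<^sup>2 - (case_prod h p)\<^sup>2 - 2 * (case_prod h p * w n p))"
      unfolding sqdist_L2_def w_def
      by (intro Bochner_Integration.integral_cong) (auto simp: power2_eq_square algebra_simps)
    ultimately show ?thesis using int[OF kg] int[OF h] by simp
  qed
  have "(\<lambda>n. sqdist_L2 h (relabel k (\<phi> n))) \<longlonglongrightarrow> (LINT p|leb_sq. (case_prod k p)\<^sup>2) - (LINT p|leb_sq. (case_prod h p)\<^sup>2) - 2 * 0"
    unfolding eq by (intro tendsto_intros lim)
  then show thesis by (intro that[OF \<phi>(1)]) (simp only: mult_zero_right diff_zero)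
qed

text \<open>Relabelling preserves the \<open>L\<^sup>2\<close> norm, so by symmetry both graphons have the same norm, and
  weak convergence together with convergence of norms is strong convergence.\<close>

lemma cut_metric_zero_imp_L2:
  assumes h: "h \<in> graphons" and k: "k \<in> graphons" and 0: "cut_metric h k = 0"
  obtains \<phi> where "\<And>n. \<phi> n \<in> mp_bijections" "(\<lambda>n. sqdist_L2 h (relabel k (\<phi> n))) \<longlonglongrightarrow> 0"
proof -
  have le: "(LINT p|leb_sq. (case_prod h p)\<^sup>2) \<le> (LINT p|leb_sq. (case_prod k p)\<^sup>2)"
    if hk: "h \<in> graphons" "k \<in> graphons" "cut_metric h k = 0" for h k
  proof -
    obtain \<phi> where "(\<lambda>n. sqdist_L2 h (relabel k (\<phi> n))) \<longlonglongrightarrow> (LINT p|leb_sq. (case_prod k p)\<^sup>2) - (LINT p|leb_sq. (case_prod h p)\<^sup>2)"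
      using cut_metric_zero_imp_weak[OF hk] by blast
    then have "0 \<le> (LINT p|leb_sq. (case_prod k p)\<^sup>2) - (LINT p|leb_sq. (case_prod h p)\<^sup>2)"
      by (rule LIMSEQ_le_const) (auto simp: sqdist_L2_nonneg)
    then show ?thesis by simp
  qed
  have "(LINT p|leb_sq. (case_prod k p)\<^sup>2) - (LINT p|leb_sq. (case_prod h p)\<^sup>2) = 0"
    using le[OF h k 0] le[OF k h] 0 cut_metric_commute[OF h k] by simp
  then show thesis using cut_metric_zero_imp_weak[OF h k 0] that by metis
qed

lemma cut_metric_zero_of_L2:
  assumes h: "h \<in> graphons" and k: "k \<in> graphons" and \<phi>: "\<And>n. \<phi> n \<in> mp_bijections"
    and lim: "(\<lambda>n. sqdist_L2 h (relabel k (\<phi> n))) \<longlonglongrightarrow> 0"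
  shows "cut_metric h k = 0"
proof -
  note kg = relabel_graphons[OF k \<phi>]
  have "cut_metric h k \<le> 0"
  proof (rule LIMSEQ_le_const[OF dist_L1_tendsto_0[OF h kg lim]], intro exI allI impI)
    show "cut_metric h k \<le> dist_L1 h (relabel k (\<phi> n))" for n
      using cut_metric_le[OF h k \<phi>] cut_dist_le_dist_L1[OF h kg] by (rule order_trans)
  qed
  then show ?thesis using cut_metric_nonneg[OF h k] by simp
qed

section \<open>The norm of the Laplacian\<close>

lemma L2_funsD:
  assumes "u \<in> L2_funs"
  shows "u \<in> borel_measurable leb01" "integrable leb01 (\<lambda>x. (u x)\<^sup>2)" "integrable leb01 u"
proof -
  show *: "u \<in> borel_measurable leb01" "integrable leb01 (\<lambda>x. (u x)\<^sup>2)"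
    using assms by (auto simp: L2_funs_def)
  show "integrable leb01 u"
  proof (rule Bochner_Integration.integrable_bound)
    show "integrable leb01 (\<lambda>x. 1 + (u x)\<^sup>2)" using * by auto
    have "\<bar>a\<bar> \<le> 1 + a\<^sup>2" for a :: real
      using zero_le_power2[of "\<bar>a\<bar> - 1"] zero_le_power2[of a] by (simp add: power2_diff)
    then show "AE x in leb01. norm (u x) \<le> norm (1 + (u x)\<^sup>2)" by (auto intro: order_trans)
  qed (rule *)
qed

lemma L2_norm01_nonneg: "0 \<le> L2_norm01 u"
  unfolding L2_norm01_def by (simp add: integral_nonneg_AE)

lemma L2_norm01_power2: "(L2_norm01 u)\<^sup>2 = (LINT x|leb01. (u x)\<^sup>2)"
  unfolding L2_norm01_def by (simp add: integral_nonneg_AE)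

lemma L2_funs_mult_integrable:
  assumes "u \<in> L2_funs" "v \<in> L2_funs"
  shows "integrable leb01 (\<lambda>x. u x * v x)"
proof (rule Bochner_Integration.integrable_bound)
  note [measurable] = L2_funsD(1)[OF assms(1)] L2_funsD(1)[OF assms(2)]
  show "integrable leb01 (\<lambda>x. (u x)\<^sup>2 + (v x)\<^sup>2)" using assms[THEN L2_funsD(2)] by auto
  show "(\<lambda>x. u x * v x) \<in> borel_measurable leb01" by measurable
  have "\<bar>a * b\<bar> \<le> a\<^sup>2 + b\<^sup>2" for a b :: real
    using sum_squares_bound[of a b] sum_squares_bound[of "-a" b] zero_le_power2[of a] zero_le_power2[of b]
    unfolding abs_le_iff by auto
  then show "AE x in leb01. norm (u x * v x) \<le> norm ((u x)\<^sup>2 + (v x)\<^sup>2)" by (auto intro: order_trans)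
qed

text \<open>The integral of \<open>(s * u x + v x)\<^sup>2\<close> is a nonnegative quadratic in s.
  It is evaluated at its minimum \<open>- C / A\<close>; if \<open>A = 0\<close> and
  \<open>C \<noteq> 0\<close>, the chosen s would give it the value -1.\<close>

lemma L2_Cauchy_Schwarz:
  assumes u: "u \<in> L2_funs" and v: "v \<in> L2_funs"
  shows "(LINT x|leb01. u x * v x) \<le> L2_norm01 u * L2_norm01 v"
proof -
  define A B C where "A = (LINT x|leb01. (u x)\<^sup>2)" and "B = (LINT x|leb01. (v x)\<^sup>2)"
    and "C = (LINT x|leb01. u x * v x)"
  have nn: "0 \<le> A" "0 \<le> B" unfolding A_def B_def by (auto intro: integral_nonneg_AE)
  have q: "0 \<le> A * s\<^sup>2 + 2 * C * s + B" for s
  proof -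
    have "0 \<le> (LINT x|leb01. (s * u x + v x)\<^sup>2)" by (auto intro: integral_nonneg_AE)
    also have "\<dots> = (LINT x|leb01. s\<^sup>2 * (u x)\<^sup>2 + (2 * s) * (u x * v x) + (v x)\<^sup>2)"
      by (intro Bochner_Integration.integral_cong) (auto simp: power2_sum power_mult_distrib mult_ac)
    also have "\<dots> = s\<^sup>2 * A + (2 * s) * C + B"
      using L2_funs_mult_integrable[OF u v] L2_funsD(2)[OF u] L2_funsD(2)[OF v]
      by (simp add: A_def B_def C_def)
    finally show ?thesis by (simp add: mult_ac)
  qed
  have "C\<^sup>2 \<le> A * B"
  proof (cases "A = 0")
    case True
    have "C = 0"
    proof (rule ccontr)
      assume "C \<noteq> 0"
      then have "2 * C * (- (B + 1) / (2 * C)) = - (B + 1)" by simp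
      then show False using q[of "- (B + 1) / (2 * C)"] True by simp
    qed
    then show ?thesis using True by simp
  next
    case False
    then have A: "A > 0" using nn by simp
    have "A * (- C / A)\<^sup>2 + 2 * C * (- C / A) + B = B - C\<^sup>2 / A"
      using A by (simp add: power2_eq_square field_simps)
    then have "C\<^sup>2 / A \<le> B" using q[of "- C / A"] by simp
    then show ?thesis using A by (simp add: field_simps)
  qed
  then have "C \<le> sqrt (A * B)" by (rule real_le_rsqrt)
  then show ?thesis by (simp add: A_def B_def C_def L2_norm01_def real_sqrt_mult)
qed

lemma L2_norm01_lincomb_le:
  assumes u: "u \<in> L2_funs" and v: "v \<in> L2_funs" and ab: "0 \<le> a" "0 \<le> b"
  shows "L2_norm01 (\<lambda>x. a * u x + b * v x) \<le> a * L2_norm01 u + b * L2_norm01 v"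
proof (rule power2_le_imp_le)
  have "(L2_norm01 (\<lambda>x. a * u x + b * v x))\<^sup>2 =
    (LINT x|leb01. a\<^sup>2 * (u x)\<^sup>2 + b\<^sup>2 * (v x)\<^sup>2 + (2 * a * b) * (u x * v x))"
    unfolding L2_norm01_power2
    by (intro Bochner_Integration.integral_cong) (auto simp: power2_sum power_mult_distrib mult_ac)
  also have "\<dots> = a\<^sup>2 * (L2_norm01 u)\<^sup>2 + b\<^sup>2 * (L2_norm01 v)\<^sup>2 + (2 * a * b) * (LINT x|leb01. u x * v x)"
    using L2_funs_mult_integrable[OF u v] L2_funsD(2)[OF u] L2_funsD(2)[OF v]
    by (simp add: L2_norm01_power2)
  also have "\<dots> \<le> a\<^sup>2 * (L2_norm01 u)\<^sup>2 + b\<^sup>2 * (L2_norm01 v)\<^sup>2 + (2 * a * b) * (L2_norm01 u * L2_norm01 v)"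
    using L2_Cauchy_Schwarz[OF u v] ab by (intro add_left_mono mult_left_mono) auto
  also have "\<dots> = (a * L2_norm01 u + b * L2_norm01 v)\<^sup>2"
    by (simp add: power2_sum power_mult_distrib mult_ac)
  finally show "(L2_norm01 (\<lambda>x. a * u x + b * v x))\<^sup>2 \<le> (a * L2_norm01 u + b * L2_norm01 v)\<^sup>2" .
qed (use ab in \<open>auto simp: L2_norm01_nonneg\<close>)

definition L2_ball :: "(real \<Rightarrow> real) set" where
  "L2_ball = {u \<in> L2_funs. L2_norm01 u \<le> 1}"

lemma lap_norm_eq: "lap_norm h = (SUP u\<in>L2_ball. L2_norm01 (laplacian h u))"
  unfolding lap_norm_def L2_ball_def ..

lemma zero_in_L2_ball: "(\<lambda>x. 0) \<in> L2_ball"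
  by (simp add: L2_ball_def L2_funs_def L2_norm01_def)

lemma L2_ball_abs_integral:
  assumes "u \<in> L2_ball" shows "(LINT x|leb01. \<bar>u x\<bar>) \<le> 1"
proof -
  have u: "u \<in> L2_funs" "L2_norm01 u \<le> 1" using assms by (auto simp: L2_ball_def)
  have "(\<lambda>x. \<bar>u x\<bar>) \<in> L2_funs" "(\<lambda>x. 1) \<in> L2_funs"
    using L2_funsD[OF u(1)] by (auto simp: L2_funs_def)
  from L2_Cauchy_Schwarz[OF this] have "(LINT x|leb01. \<bar>u x\<bar>) \<le> L2_norm01 u * 1"
    by (simp add: L2_norm01_def)
  then show ?thesis using u by simp
qed

lemma laplacian_integrand_integrable:
  assumes h: "h \<in> graphons" and u: "u \<in> L2_funs"
  shows "integrable leb_sq (\<lambda>p. case_prod h p * (u (fst p) - u (snd p)))"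
proof (rule Bochner_Integration.integrable_bound)
  note [measurable] = graphonD(1)[OF h] L2_funsD(1)[OF u]
  have "integrable leb_sq (\<lambda>p. u (fst p))" "integrable leb_sq (\<lambda>p. u (snd p))"
    using integrable_distr[OF measurable_fst_leb_sq, of u] integrable_distr[OF measurable_snd_leb_sq, of u]
      L2_funsD(3)[OF u] by (simp_all add: distr_fst_leb_sq distr_snd_leb_sq)
  then show "integrable leb_sq (\<lambda>p. u (fst p) - u (snd p))" by auto
  show "(\<lambda>p. case_prod h p * (u (fst p) - u (snd p))) \<in> borel_measurable leb_sq" by measurable
  show "AE p in leb_sq. norm (case_prod h p * (u (fst p) - u (snd p))) \<le> norm (u (fst p) - u (snd p))"
  proof (rule AE_I2)
    fix p assume "p \<in> space leb_sq"
    then have "0 \<le> case_prod h p" "case_prod h p \<le> 1" using graphonD(2,3)[OF h, of p] by simp_all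
    then show "norm (case_prod h p * (u (fst p) - u (snd p))) \<le> norm (u (fst p) - u (snd p))"
      unfolding real_norm_def abs_mult by (intro mult_left_le_one_le) auto
  qed
qed

lemma laplacian_section_integrable:
  assumes "h \<in> graphons" "u \<in> L2_funs"
  shows "AE x in leb01. integrable leb01 (\<lambda>y. h x y * (u x - u y))"
  using leb_sq_Fubini(1)[OF laplacian_integrand_integrable[OF assms]] by simp

lemma laplacian_measurable:
  assumes "h \<in> graphons" "u \<in> L2_funs"
  shows "laplacian h u \<in> borel_measurable leb01"
  using leb_sq_Fubini(2)[OF laplacian_integrand_integrable[OF assms]]
  by (auto simp: laplacian_def[abs_def])

lemma laplacian_integrand_bound:
  assumes "h \<in> graphons" "x \<in> {0..1}" "y \<in> {0..1}"
  shows "\<bar>h x y * (u x - u y)\<bar> \<le> \<bar>u x\<bar> + \<bar>u y\<bar>"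
proof -
  have "\<bar>h x y * (u x - u y)\<bar> \<le> 1 * \<bar>u x - u y\<bar>"
    unfolding abs_mult using graphonD(5,6)[OF assms] by (intro mult_right_mono) auto
  also have "1 * \<bar>u x - u y\<bar> \<le> \<bar>u x\<bar> + \<bar>u y\<bar>" by (simp add: abs_triangle_ineq4)
  finally show ?thesis .
qed

text \<open>A section over x may fail to be integrable, but then the integral is 0 by convention.
  The bound therefore holds at every x, without an exceptional null set. The summand 1 bounds the
  mean of |u| on the unit ball.\<close>

lemma laplacian_bound:
  assumes h: "h \<in> graphons" and u: "u \<in> L2_ball" and x: "x \<in> {0..1}"
  shows "\<bar>laplacian h u x\<bar> \<le> \<bar>u x\<bar> + 1"
proof (cases "integrable leb01 (\<lambda>y. h x y * (u x - u y))")
  case True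
  have u': "u \<in> L2_funs" using u by (simp add: L2_ball_def)
  have "\<bar>laplacian h u x\<bar> \<le> (LINT y|leb01. \<bar>h x y * (u x - u y)\<bar>)"
    unfolding laplacian_def by (rule integral_abs_bound)
  also have "\<dots> \<le> (LINT y|leb01. \<bar>u x\<bar> + \<bar>u y\<bar>)"
    using True L2_funsD(3)[OF u'] laplacian_integrand_bound[OF h x] by (intro integral_mono) auto
  also have "\<dots> = \<bar>u x\<bar> + (LINT y|leb01. \<bar>u y\<bar>)"
    using L2_funsD(3)[OF u'] by (subst Bochner_Integration.integral_add) auto
  finally show ?thesis using L2_ball_abs_integral[OF u] by linarith
qed (simp add: laplacian_def not_integrable_integral_eq)

lemma laplacian_power2_bound:
  assumes "h \<in> graphons" "u \<in> L2_ball" "x \<in> {0..1}"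
  shows "(laplacian h u x)\<^sup>2 \<le> 2 * (u x)\<^sup>2 + 2"
proof -
  have "(laplacian h u x)\<^sup>2 \<le> (\<bar>u x\<bar> + 1)\<^sup>2"
    using laplacian_bound[OF assms] by (metis abs_ge_zero abs_le_square_iff abs_of_nonneg order_trans)
  also have "\<dots> \<le> 2 * (u x)\<^sup>2 + 2"
    using sum_squares_bound[of "\<bar>u x\<bar>" 1] by (simp add: power2_sum)
  finally show ?thesis .
qed

lemma laplacian_power2_dominated:
  assumes "u \<in> L2_ball"
  shows "integrable leb01 (\<lambda>x. 2 * (u x)\<^sup>2 + 2)" "(LINT x|leb01. 2 * (u x)\<^sup>2 + 2) \<le> 4"
proof -
  have u: "u \<in> L2_funs" "L2_norm01 u \<le> 1" using assms by (auto simp: L2_ball_def)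
  show "integrable leb01 (\<lambda>x. 2 * (u x)\<^sup>2 + 2)" using L2_funsD(2)[OF u(1)] by auto
  have "(L2_norm01 u)\<^sup>2 \<le> 1" using u(2) L2_norm01_nonneg by (simp add: power_le_one)
  then show "(LINT x|leb01. 2 * (u x)\<^sup>2 + 2) \<le> 4"
    using L2_funsD(2)[OF u(1)] by (simp add: L2_norm01_power2)
qed

text \<open>This bounds the set whose supremum defines \<open>lap_norm\<close>; for an unbounded set
  the real-valued SUP would say nothing.\<close>

lemma laplacian_L2:
  assumes h: "h \<in> graphons" and u: "u \<in> L2_ball"
  shows "laplacian h u \<in> L2_funs" "L2_norm01 (laplacian h u) \<le> 2"
proof -
  have u': "u \<in> L2_funs" using u by (simp add: L2_ball_def)
  note [measurable] = laplacian_measurable[OF h u']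
  have i: "integrable leb01 (\<lambda>x. (laplacian h u x)\<^sup>2)"
    by (rule Bochner_Integration.integrable_bound[OF laplacian_power2_dominated(1)[OF u]])
      (use laplacian_power2_bound[OF h u] in \<open>auto intro!: AE_I2\<close>)
  then show "laplacian h u \<in> L2_funs" by (simp add: L2_funs_def)
  have "(LINT x|leb01. (laplacian h u x)\<^sup>2) \<le> (LINT x|leb01. 2 * (u x)\<^sup>2 + 2)"
    using i laplacian_power2_dominated(1)[OF u] laplacian_power2_bound[OF h u] by (intro integral_mono) auto
  also have "\<dots> \<le> 2\<^sup>2" using laplacian_power2_dominated(2)[OF u] by simp
  finally show "L2_norm01 (laplacian h u) \<le> 2"
    unfolding L2_norm01_def by (metis real_sqrt_le_mono real_sqrt_abs abs_numeral)
qed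

lemma lap_norm_upper:
  assumes "h \<in> graphons" "u \<in> L2_ball"
  shows "L2_norm01 (laplacian h u) \<le> lap_norm h"
  unfolding lap_norm_eq using laplacian_L2(2)[OF assms(1)] assms(2)
  by (intro cSUP_upper bdd_aboveI2[of _ _ 2]) auto

lemma lap_norm_least:
  assumes "\<And>u. u \<in> L2_ball \<Longrightarrow> L2_norm01 (laplacian h u) \<le> c"
  shows "lap_norm h \<le> c"
  unfolding lap_norm_eq using zero_in_L2_ball assms by (intro cSUP_least) auto

lemma lap_norm_nonneg: "h \<in> graphons \<Longrightarrow> 0 \<le> lap_norm h"
  using lap_norm_upper[OF _ zero_in_L2_ball] L2_norm01_nonneg order_trans by blast

lemma L2_norm01_cong_AE:
  assumes "AE x in leb01. u x = v x" "u \<in> borel_measurable leb01" "v \<in> borel_measurable leb01"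
  shows "L2_norm01 u = L2_norm01 v"
proof -
  have "(LINT x|leb01. (u x)\<^sup>2) = (LINT x|leb01. (v x)\<^sup>2)"
    using assms by (intro integral_cong_AE) auto
  then show ?thesis by (simp add: L2_norm01_def)
qed

lemma lap_norm_cong:
  assumes "\<And>x y. x \<in> {0..1} \<Longrightarrow> y \<in> {0..1} \<Longrightarrow> h x y = k x y"
  shows "lap_norm h = lap_norm k"
proof -
  have "laplacian h u x = laplacian k u x" if "x \<in> {0..1}" for u x
    unfolding laplacian_def using assms that by (intro Bochner_Integration.integral_cong) auto
  then have "L2_norm01 (laplacian h u) = L2_norm01 (laplacian k u)" for u
    unfolding L2_norm01_def by (intro arg_cong[where f = sqrt] Bochner_Integration.integral_cong) auto
  then show ?thesis by (simp add: lap_norm_eq)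
qed

definition mix :: "real \<Rightarrow> (real \<Rightarrow> real \<Rightarrow> real) \<Rightarrow> (real \<Rightarrow> real \<Rightarrow> real) \<Rightarrow> real \<Rightarrow> real \<Rightarrow> real" where
  "mix t h k = (\<lambda>x y. t * h x y + (1 - t) * k x y)"

lemma case_prod_mix: "case_prod (mix t h k) p = t * case_prod h p + (1 - t) * case_prod k p"
  by (cases p) (simp add: mix_def)

lemma mix_graphons:
  assumes h: "h \<in> graphons" and k: "k \<in> graphons" and t: "0 \<le> t" "t \<le> 1"
  shows "mix t h k \<in> graphons"
proof (rule graphonI)
  show "case_prod (mix t h k) \<in> borel_measurable leb_sq"
    unfolding case_prod_mix[abs_def] using graphonD(1)[OF h] graphonD(1)[OF k] by measurable
  fix x y :: real assume xy: "x \<in> {0..1}" "y \<in> {0..1}"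
  note hk = graphonD(5,6)[OF h xy] graphonD(5,6)[OF k xy]
  show "0 \<le> mix t h k x y" unfolding mix_def using hk t by simp
  show "mix t h k x y \<le> 1" unfolding mix_def using convex_bound_le[of "h x y" 1 "k x y" t "1 - t"] hk t by simp
  show "mix t h k x y = mix t h k y x" using graphonD(4)[OF h xy] graphonD(4)[OF k xy] by (simp add: mix_def)
qed

text \<open>The Laplacian is linear in the graphon wherever both sections are integrable, that is
  almost everywhere; the rest is the triangle inequality. Convexity of the constraint set rests on
  this.\<close>

lemma lap_norm_mix_le:
  assumes h: "h \<in> graphons" and k: "k \<in> graphons" and t: "0 \<le> t" "t \<le> 1"
  shows "lap_norm (mix t h k) \<le> t * lap_norm h + (1 - t) * lap_norm k"
proof (rule lap_norm_least)
  fix u assume u: "u \<in> L2_ball"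
  then have u': "u \<in> L2_funs" by (simp add: L2_ball_def)
  have "AE x in leb01. laplacian (mix t h k) u x = t * laplacian h u x + (1 - t) * laplacian k u x"
    using laplacian_section_integrable[OF h u'] laplacian_section_integrable[OF k u']
  proof eventually_elim
    case (elim x)
    have "laplacian (mix t h k) u x =
      (LINT y|leb01. t * (h x y * (u x - u y)) + (1 - t) * (k x y * (u x - u y)))"
      unfolding laplacian_def mix_def by (intro Bochner_Integration.integral_cong) (auto simp: algebra_simps)
    also have "\<dots> = t * laplacian h u x + (1 - t) * laplacian k u x"
      unfolding laplacian_def using elim by simp
    finally show ?case .
  qed
  then have "L2_norm01 (laplacian (mix t h k) u) = L2_norm01 (\<lambda>x. t * laplacian h u x + (1 - t) * laplacian k u x)"
    using laplacian_measurable[OF mix_graphons[OF h k t] u'] laplacian_measurable[OF h u'] laplacian_measurable[OF k u']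
    by (intro L2_norm01_cong_AE) auto
  also have "\<dots> \<le> t * L2_norm01 (laplacian h u) + (1 - t) * L2_norm01 (laplacian k u)"
    using laplacian_L2(1)[OF h u] laplacian_L2(1)[OF k u] t by (intro L2_norm01_lincomb_le) auto
  also have "\<dots> \<le> t * lap_norm h + (1 - t) * lap_norm k"
    using lap_norm_upper[OF h u] lap_norm_upper[OF k u] t by (intro add_mono mult_left_mono) auto
  finally show "L2_norm01 (laplacian (mix t h k) u) \<le> t * lap_norm h + (1 - t) * lap_norm k" .
qed

text \<open>Relabelling conjugates the Laplacian by composition with \<open>\<phi>\<close>, an
  isometry of the space of square-integrable functions. A test function u for the relabelled graphon
  thus corresponds to u composed with the inverse bijection.\<close>

lemma lap_norm_relabel_le:
  assumes h: "h \<in> graphons" and \<phi>: "\<phi> \<in> mp_bijections"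
  shows "lap_norm (relabel h \<phi>) \<le> lap_norm h"
proof (rule lap_norm_least)
  fix u assume u: "u \<in> L2_ball"
  then have u': "u \<in> L2_funs" "L2_norm01 u \<le> 1" by (auto simp: L2_ball_def)
  obtain \<psi> where \<psi>: "\<psi> \<in> mp_bijections" "\<And>x. x \<in> {0..1} \<Longrightarrow> \<phi> (\<psi> x) = x" "\<And>x. x \<in> {0..1} \<Longrightarrow> \<psi> (\<phi> x) = x"
    using inverse_mp_bijections[OF \<phi>] by metis
  note p = mp_bijectionsD[OF \<phi>] and q = mp_bijectionsD[OF \<psi>(1)]
  define v where "v = (\<lambda>x. u (\<psi> x))"
  have int: "integral\<^sup>L leb01 (\<lambda>x. f (\<psi> x)) = integral\<^sup>L leb01 f" "integrable leb01 (\<lambda>x. f (\<psi> x)) = integrable leb01 f"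
    if "f \<in> borel_measurable leb01" for f :: "real \<Rightarrow> real"
    using integral_distr[OF q(2) that] integrable_distr_eq[OF q(2) that] q(3) by simp_all
  have int': "integral\<^sup>L leb01 (\<lambda>x. f (\<phi> x)) = integral\<^sup>L leb01 f"
    if "f \<in> borel_measurable leb01" for f :: "real \<Rightarrow> real"
    using integral_distr[OF p(2) that] p(3) by simp
  have "v \<in> borel_measurable leb01" unfolding v_def using measurable_compose[OF q(2) L2_funsD(1)[OF u'(1)]] .
  moreover have "(\<lambda>x. (u x)\<^sup>2) \<in> borel_measurable leb01" using L2_funsD(1)[OF u'(1)] by measurable
  ultimately have v: "v \<in> L2_ball"
    using int[of "\<lambda>x. (u x)\<^sup>2"] L2_funsD(2)[OF u'(1)] u'(2)
    by (simp add: L2_ball_def L2_funs_def L2_norm01_def v_def)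
  then have v': "v \<in> L2_funs" by (simp add: L2_ball_def)
  have "AE x in distr leb01 leb01 \<phi>. integrable leb01 (\<lambda>y. h x y * (v x - v y))"
    unfolding p(3) using h v' by (rule laplacian_section_integrable)
  then have "AE x in leb01. integrable leb01 (\<lambda>y. h (\<phi> x) y * (v (\<phi> x) - v y))"
    by (rule AE_distrD[OF p(2)])
  moreover have "AE x in leb01. x \<in> {0..1}" by (rule AE_I2) simp
  ultimately have "AE x in leb01. laplacian (relabel h \<phi>) u x = laplacian h v (\<phi> x)"
  proof eventually_elim
    case (elim x)
    have "laplacian (relabel h \<phi>) u x = (LINT y|leb01. h (\<phi> x) (\<phi> y) * (v (\<phi> x) - v (\<phi> y)))"
      unfolding laplacian_def relabel_def v_def using elim(2) \<psi>(3)
      by (intro Bochner_Integration.integral_cong) auto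
    also have "\<dots> = laplacian h v (\<phi> x)"
      unfolding laplacian_def by (rule int'[OF borel_measurable_integrable[OF elim(1)]])
    finally show ?case .
  qed
  then have "L2_norm01 (laplacian (relabel h \<phi>) u) = L2_norm01 (\<lambda>x. laplacian h v (\<phi> x))"
    using laplacian_measurable[OF relabel_graphons[OF h \<phi>] u'(1)] measurable_compose[OF p(2) laplacian_measurable[OF h v']]
    by (rule L2_norm01_cong_AE)
  also have "\<dots> = L2_norm01 (laplacian h v)"
    unfolding L2_norm01_def using laplacian_measurable[OF h v']
    by (intro arg_cong[where f = sqrt] int'[of "\<lambda>x. (laplacian h v x)\<^sup>2"]) measurable
  also have "\<dots> \<le> lap_norm h" using h v by (rule lap_norm_upper)
  finally show "L2_norm01 (laplacian (relabel h \<phi>) u) \<le> lap_norm h" .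
qed

lemma lap_norm_relabel:
  assumes h: "h \<in> graphons" and \<phi>: "\<phi> \<in> mp_bijections"
  shows "lap_norm (relabel h \<phi>) = lap_norm h"
proof (rule antisym[OF lap_norm_relabel_le[OF assms]])
  obtain \<psi> where \<psi>: "\<psi> \<in> mp_bijections" "\<And>x. x \<in> {0..1} \<Longrightarrow> \<phi> (\<psi> x) = x"
    using inverse_mp_bijections[OF \<phi>] by metis
  have "lap_norm h = lap_norm (relabel (relabel h \<phi>) \<psi>)"
    by (rule lap_norm_cong) (simp add: relabel_def \<psi>(2) del: atLeastAtMost_iff)
  also have "\<dots> \<le> lap_norm (relabel h \<phi>)"
    by (rule lap_norm_relabel_le[OF relabel_graphons[OF assms] \<psi>(1)])
  finally show "lap_norm h \<le> lap_norm (relabel h \<phi>)" .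
qed

text \<open>For one fixed u the norm of the image converges, by dominated convergence first in y for
  almost every x and then in x. A supremum of such continuous functionals is lower semicontinuous,
  so upper bounds on the norm survive the limit.\<close>

lemma lap_norm_AE_limit_le:
  assumes h: "h \<in> graphons" and hn: "\<And>n. k n \<in> graphons" and le: "\<And>n. lap_norm (k n) \<le> \<beta>"
    and lim: "AE p in leb_sq. (\<lambda>n. case_prod (k n) p) \<longlonglongrightarrow> case_prod h p"
  shows "lap_norm h \<le> \<beta>"
proof (rule lap_norm_least)
  fix u assume u: "u \<in> L2_ball"
  then have u': "u \<in> L2_funs" by (auto simp: L2_ball_def)
  have "AE x in leb01. \<forall>n. integrable leb01 (\<lambda>y. k n x y * (u x - u y))"
    using laplacian_section_integrable[OF hn u'] by (simp add: AE_all_countable)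
  moreover have "AE x in leb01. x \<in> {0..1}" by (rule AE_I2) simp
  ultimately have ae: "AE x in leb01. (\<lambda>n. laplacian (k n) u x) \<longlonglongrightarrow> laplacian h u x"
    using AE_leb_sq_pair[OF lim] laplacian_section_integrable[OF h u']
  proof eventually_elim
    case (elim x)
    show ?case unfolding laplacian_def
    proof (rule integral_dominated_convergence[where w = "\<lambda>y. \<bar>u x\<bar> + \<bar>u y\<bar>"])
      show "AE y in leb01. (\<lambda>n. k n x y * (u x - u y)) \<longlonglongrightarrow> h x y * (u x - u y)"
        using elim(3) by eventually_elim (auto intro: tendsto_intros)
      show "AE y in leb01. norm (k n x y * (u x - u y)) \<le> \<bar>u x\<bar> + \<bar>u y\<bar>" for n
        using laplacian_integrand_bound[OF hn elim(2)] by (intro AE_I2) simp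
    qed (use elim L2_funsD(3)[OF u'] in auto)
  qed
  have "(\<lambda>n. LINT x|leb01. (laplacian (k n) u x)\<^sup>2) \<longlonglongrightarrow> (LINT x|leb01. (laplacian h u x)\<^sup>2)"
  proof (rule integral_dominated_convergence[where w = "\<lambda>x. 2 * (u x)\<^sup>2 + 2"])
    show "AE x in leb01. (\<lambda>n. (laplacian (k n) u x)\<^sup>2) \<longlonglongrightarrow> (laplacian h u x)\<^sup>2"
      using ae by eventually_elim (auto intro: tendsto_intros)
    show "AE x in leb01. norm ((laplacian (k n) u x)\<^sup>2) \<le> 2 * (u x)\<^sup>2 + 2" for n
      using laplacian_power2_bound[OF hn u] by (intro AE_I2) simp
  qed (use laplacian_measurable[OF hn u'] laplacian_measurable[OF h u'] laplacian_power2_dominated(1)[OF u] in auto)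
  then have "(\<lambda>n. L2_norm01 (laplacian (k n) u)) \<longlonglongrightarrow> L2_norm01 (laplacian h u)"
    unfolding L2_norm01_def by (rule tendsto_real_sqrt)
  then show "L2_norm01 (laplacian h u) \<le> \<beta>"
    by (rule LIMSEQ_le_const2) (use lap_norm_upper[OF hn u] le in \<open>auto intro: order_trans\<close>)
qed

text \<open>Makes \<open>lap_norm_class\<close> independent of the chosen representative. Each
  graphon is an almost everywhere limit of relabellings of the other, all of equal norm, so
  semicontinuity gives both inequalities.\<close>

lemma lap_norm_cut_rel:
  assumes "(h, k) \<in> cut_rel"
  shows "lap_norm h = lap_norm k"
proof -
  have le: "lap_norm h \<le> lap_norm k" if h: "h \<in> graphons" and k: "k \<in> graphons" and 0: "cut_metric h k = 0" for h k
  proof -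
    obtain \<phi> where \<phi>: "\<And>n. \<phi> n \<in> mp_bijections" "(\<lambda>n. sqdist_L2 h (relabel k (\<phi> n))) \<longlonglongrightarrow> 0"
      using cut_metric_zero_imp_L2[OF h k 0] by metis
    note kg = relabel_graphons[OF k \<phi>(1)]
    obtain s where "AE p in leb_sq. (\<lambda>n. case_prod (relabel k (\<phi> (s n))) p) \<longlonglongrightarrow> case_prod h p"
      using sqdist_L2_AE_subseq[OF h kg \<phi>(2)] .
    then show ?thesis
      by (rule lap_norm_AE_limit_le[OF h kg, rotated]) (simp add: lap_norm_relabel[OF k \<phi>(1)])
  qed
  show ?thesis using assms le[of h k] le[of k h] cut_metric_commute[of h k] by (auto simp: cut_rel_def)
qed

text \<open>The quadratic form of the Laplacian at the identity function is half of this integral.\<close>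

lemma integral_graphon_le_lap_norm:
  assumes h: "h \<in> graphons"
  shows "(LINT p|leb_sq. case_prod h p * (fst p - snd p)\<^sup>2) \<le> 2 * lap_norm h"
proof -
  note [measurable] = graphonD(1)[OF h]
  have id: "(\<lambda>x. x) \<in> borel_measurable leb01"
    by (intro measurable_restrict_space1 measurable_completion) simp
  have fs [measurable]: "fst \<in> borel_measurable leb_sq" "snd \<in> borel_measurable leb_sq"
    using measurable_compose[OF measurable_fst_leb_sq id] measurable_compose[OF measurable_snd_leb_sq id] by simp_all
  have i2: "integrable leb01 (\<lambda>x. x\<^sup>2)"
    by (rule leb01.integrable_const_bound[of _ 1]) (use id in \<open>auto simp: abs_square_le_1\<close>)
  have idL2: "(\<lambda>x. x) \<in> L2_funs" using id i2 by (simp add: L2_funs_def)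
  have "(LINT x|leb01. x\<^sup>2) \<le> (LINT x|leb01. 1)" using i2 by (intro integral_mono) (auto simp: abs_square_le_1)
  then have n1: "L2_norm01 (\<lambda>x. x) \<le> 1" by (simp add: L2_norm01_def)
  then have idb: "(\<lambda>x. x) \<in> L2_ball" using idL2 by (simp add: L2_ball_def)
  define F where "F p = case_prod h p * (fst p - snd p) * fst p" for p
  have Fi: "integrable leb_sq F"
  proof (rule integrable_leb_sq_bounded[of _ 1])
    show "F \<in> borel_measurable leb_sq" unfolding F_def by measurable
    fix p :: "real \<times> real" assume p: "p \<in> {0..1} \<times> {0..1}"
    have "\<bar>case_prod h p\<bar> \<le> 1" "\<bar>fst p - snd p\<bar> \<le> 1" "\<bar>fst p\<bar> \<le> 1"
      using graphonD(2,3)[OF h p] p by auto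
    then show "\<bar>F p\<bar> \<le> 1" unfolding F_def abs_mult by (intro mult_le_one mult_nonneg_nonneg) auto
  qed
  have "integral\<^sup>L leb_sq F = (LINT x|leb01. LINT y|leb01. F (x, y))" using leb_sq_Fubini(3)[OF Fi] ..
  also have "\<dots> = (LINT x|leb01. x * laplacian h (\<lambda>x. x) x)"
    unfolding laplacian_def F_def by (simp add: mult.commute)
  also have "\<dots> \<le> L2_norm01 (\<lambda>x. x) * L2_norm01 (laplacian h (\<lambda>x. x))"
    using idL2 laplacian_L2(1)[OF h idb] by (rule L2_Cauchy_Schwarz)
  also have "\<dots> \<le> 1 * lap_norm h"
    using n1 lap_norm_upper[OF h idb] L2_norm01_nonneg by (intro mult_mono) auto
  finally have F: "integral\<^sup>L leb_sq F \<le> lap_norm h" by simp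
  have sw: "integral\<^sup>L leb_sq F = (LINT p|leb_sq. F (prod.swap p))"
    using integral_distr[OF measurable_leb_sq_swap borel_measurable_integrable[OF Fi]] by (simp add: distr_leb_sq_swap)
  have Fi': "integrable leb_sq (\<lambda>p. F (prod.swap p))"
    using integrable_distr[OF measurable_leb_sq_swap, of F] Fi by (simp add: distr_leb_sq_swap)
  \<comment> \<open>By symmetry of h, exchanging the coordinates and adding uses
    \<open>(x - y) * x + (y - x) * y = (x - y)\<^sup>2\<close>.\<close>
  have "(LINT p|leb_sq. case_prod h p * (fst p - snd p)\<^sup>2) = (LINT p|leb_sq. F p + F (prod.swap p))"
    using graphonD(4)[OF h]
    by (intro Bochner_Integration.integral_cong) (auto simp: F_def power2_eq_square algebra_simps)
  also have "\<dots> = 2 * integral\<^sup>L leb_sq F"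
    using Fi Fi' sw by (simp add: Bochner_Integration.integral_add)
  finally show ?thesis using F by simp
qed

section \<open>Relative entropy\<close>

text \<open>Both lower bounds are \<open>ln z \<le> z - 1\<close>, taken at \<open>z = 1 / a\<close>
  and at \<open>z = 1 / sqrt a\<close>. The first serves for domination; the second, which vanishes
  with a, gives continuity at 0.\<close>

lemma x_ln_x_lower:
  fixes a :: real
  assumes "0 \<le> a" "a \<le> 1"
  shows "- 1 \<le> a * ln a" "a * ln a \<le> 0" "- (2 * sqrt a) \<le> a * ln a"
proof -
  show "a * ln a \<le> 0"
    using assms by (cases "a = 0") (auto simp: mult_le_0_iff)
  show 2: "- (2 * sqrt a) \<le> a * ln a"
  proof (cases "a = 0")
    case False
    then have a: "a > 0" using assms by simp
    have "ln (1 / sqrt a) \<le> 1 / sqrt a - 1" using a by (intro ln_le_minus_one) auto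
    then have "- ln a / 2 \<le> 1 / sqrt a" using a by (simp add: ln_div ln_sqrt)
    then have "a * (- ln a / 2) \<le> a * (1 / sqrt a)" using a by (intro mult_left_mono) auto
    then show ?thesis using a by (simp add: real_div_sqrt)
  qed simp
  show "- 1 \<le> a * ln a"
  proof (cases "a = 0")
    case False
    then have a: "a > 0" using assms by simp
    have "ln (1 / a) \<le> 1 / a - 1" using a by (intro ln_le_minus_one) auto
    then have "a * (- ln a) \<le> a * (1 / a - 1)" using a by (intro mult_left_mono) (auto simp: ln_div)
    then show ?thesis using a by (simp add: right_diff_distrib)
  qed simp
qed

lemma tendsto_x_ln_x:
  fixes x :: "nat \<Rightarrow> real"
  assumes x: "x \<longlonglongrightarrow> a" "\<And>n. 0 \<le> x n" "\<And>n. x n \<le> 1"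
  shows "(\<lambda>n. x n * ln (x n)) \<longlonglongrightarrow> a * ln a"
proof (cases "a = 0")
  case True
  have "(\<lambda>n. - (2 * sqrt (x n))) \<longlonglongrightarrow> 0"
    using tendsto_minus[OF tendsto_mult_left[OF tendsto_real_sqrt[OF x(1)], of 2]] True by simp
  then have "(\<lambda>n. x n * ln (x n)) \<longlonglongrightarrow> 0"
    by (rule tendsto_sandwich[OF _ _ _ tendsto_const, rotated 2])
       (intro always_eventually allI x_ln_x_lower x(2,3))+
  then show ?thesis using True by simp
next
  case False then show ?thesis using x(1) by (intro tendsto_intros) auto
qed

text \<open>The negative of the binary entropy, which is the part of \<open>rel_ent a b\<close> that
  is nonlinear in a.\<close>

definition ent :: "real \<Rightarrow> real" where
  "ent a = a * ln a + (1 - a) * ln (1 - a)"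

lemma abs_ent_le: "0 \<le> a \<Longrightarrow> a \<le> 1 \<Longrightarrow> \<bar>ent a\<bar> \<le> 2"
  unfolding ent_def using x_ln_x_lower(1,2)[of a] x_ln_x_lower(1,2)[of "1 - a"] by linarith

lemma tendsto_ent:
  fixes x :: "nat \<Rightarrow> real"
  assumes x: "x \<longlonglongrightarrow> a" "\<And>n. 0 \<le> x n" "\<And>n. x n \<le> 1"
  shows "(\<lambda>n. ent (x n)) \<longlonglongrightarrow> ent a"
  unfolding ent_def using x
  by (intro tendsto_add tendsto_x_ln_x tendsto_diff tendsto_const) auto

text \<open>What remains besides \<open>ent a\<close> is affine in a, with coefficients built from
  \<open>ln b\<close> and \<open>ln (1 - b)\<close>, the two functions assumed integrable for the
  reference graphon.\<close>

lemma rel_ent_expand: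
  assumes "0 \<le> a" "a \<le> 1" "0 < b" "b < 1"
  shows "rel_ent a b = ent a - a * ln b - (1 - a) * ln (1 - b)"
proof -
  have "a * ln (a / b) = a * ln a - a * ln b"
    using assms by (cases "a = 0") (auto simp: ln_div right_diff_distrib)
  moreover have "(1 - a) * ln ((1 - a) / (1 - b)) = (1 - a) * ln (1 - a) - (1 - a) * ln (1 - b)"
    using assms by (cases "a = 1") (auto simp: ln_div right_diff_distrib)
  ultimately show ?thesis by (simp add: rel_ent_def ent_def)
qed

lemma abs_rel_ent_le:
  assumes "0 \<le> a" "a \<le> 1" "0 < b" "b < 1"
  shows "\<bar>rel_ent a b\<bar> \<le> 2 + \<bar>ln b\<bar> + \<bar>ln (1 - b)\<bar>"
proof -
  have "\<bar>a * ln b\<bar> \<le> \<bar>ln b\<bar>" "\<bar>(1 - a) * ln (1 - b)\<bar> \<le> \<bar>ln (1 - b)\<bar>"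
    unfolding abs_mult using assms by (auto intro!: mult_left_le_one_le)
  then show ?thesis using abs_ent_le[OF assms(1,2)] rel_ent_expand[OF assms] by linarith
qed

lemma rel_ent_self: "0 < b \<Longrightarrow> b < 1 \<Longrightarrow> rel_ent b b = 0"
  by (simp add: rel_ent_def)

text \<open>The relative entropy dominates the squared Hellinger distance, via \<open>ln x \<le> x - 1\<close> at
  \<open>x = sqrt (b / a)\<close>; this avoids the derivative argument of Pinsker's inequality.\<close>

lemma rel_ent_ge:
  assumes a: "0 \<le> a" "a \<le> 1" and b: "0 < b" "b < 1"
  shows "(a - b)\<^sup>2 / 2 \<le> rel_ent a b"
proof -
  have *: "2 * x - 2 * (sqrt x * sqrt y) \<le> x * ln (x / y)" if "0 \<le> x" "0 < y" for x y :: real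
  proof (cases "x = 0")
    case False
    then have x: "x > 0" using that by simp
    have "ln (sqrt (y / x)) \<le> sqrt (y / x) - 1" using x that by (intro ln_le_minus_one) auto
    moreover have "ln (sqrt (y / x)) = - ln (x / y) / 2"
      using x that by (simp add: ln_sqrt ln_div)
    ultimately have "- ln (x / y) / 2 \<le> sqrt y / sqrt x - 1"
      by (simp only: real_sqrt_divide)
    then have "x * (- ln (x / y) / 2) \<le> x * (sqrt y / sqrt x - 1)" using x by (intro mult_left_mono) auto
    also have "\<dots> = sqrt x * sqrt y - x"
      using x by (simp add: right_diff_distrib) (metis real_div_sqrt less_imp_le mult.commute times_divide_eq_left)
    finally show ?thesis by simp
  qed simp
  \<comment> \<open>The difference of x and y factors through their roots, and the sum of the roots
    is at most 2.\<close>
  have H: "(x - y)\<^sup>2 \<le> 4 * (x + y - 2 * (sqrt x * sqrt y))" if "0 \<le> x" "x \<le> 1" "0 \<le> y" "y \<le> 1" for x y :: real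
  proof -
    have "x - y = (sqrt x - sqrt y) * (sqrt x + sqrt y)"
      using that by (simp add: algebra_simps)
    then have "(x - y)\<^sup>2 = (sqrt x - sqrt y)\<^sup>2 * (sqrt x + sqrt y)\<^sup>2"
      by (simp add: power_mult_distrib)
    also have "\<dots> \<le> (sqrt x - sqrt y)\<^sup>2 * 2\<^sup>2"
    proof (intro mult_left_mono power_mono)
      show "sqrt x + sqrt y \<le> 2" using that add_mono[of "sqrt x" 1 "sqrt y" 1] by simp
    qed (use that in auto)
    also have "\<dots> = 4 * (x + y - 2 * (sqrt x * sqrt y))"
      using that by (simp add: power2_diff)
    finally show ?thesis .
  qed
  \<comment> \<open>The two right-hand sides add up to 4 times the lower bound for
    \<open>rel_ent a b\<close> found below, so
    \<open>2 * (a - b)\<^sup>2 \<le> 4 * rel_ent a b\<close>. This is the origin of the factor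
    1/2.\<close>
  have "(a - b)\<^sup>2 \<le> 4 * (a + b - 2 * (sqrt a * sqrt b))" using a b by (intro H) auto
  moreover have "(a - b)\<^sup>2 \<le> 4 * ((1 - a) + (1 - b) - 2 * (sqrt (1 - a) * sqrt (1 - b)))"
    using H[of "1 - a" "1 - b"] a b by (simp add: power2_commute)
  moreover have "2 * a - 2 * (sqrt a * sqrt b) + (2 * (1 - a) - 2 * (sqrt (1 - a) * sqrt (1 - b))) \<le> rel_ent a b"
    unfolding rel_ent_def using a b by (intro add_mono *) auto
  ultimately show ?thesis by simp
qed

text \<open>The convexity defect of \<open>rel_ent \<cdot> r\<close> is the mean relative entropy to the mixture
  \<open>m\<close>, independently of \<open>r\<close>.\<close>

lemma rel_ent_mix:
  assumes a: "0 \<le> a" "a \<le> 1" and b: "0 \<le> b" "b \<le> 1" and r: "0 < r" "r < 1" and t: "0 \<le> t" "t \<le> 1"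
  shows "rel_ent (t * a + (1 - t) * b) r + t * (1 - t) / 2 * (a - b)\<^sup>2 \<le> t * rel_ent a r + (1 - t) * rel_ent b r"
\<comment> \<open>In the excluded cases both sides coincide, and m could be 0 or 1. Otherwise m lies
  strictly inside the unit interval and can serve as the second argument of
  \<open>rel_ent\<close>.\<close>
proof (cases "t = 0 \<or> t = 1 \<or> a = b")
  case True
  then show ?thesis by (auto simp: algebra_simps)
next
  case False
  then have t': "0 < t" "0 < 1 - t" and ab: "a \<noteq> b" using t by auto
  define m where "m = t * a + (1 - t) * b"
  have m: "0 < m" "m < 1"
  proof -
    have "0 < t * a \<or> 0 < (1 - t) * b" using t' ab a b by (auto simp: less_le)
    moreover have "0 \<le> t * a" "0 \<le> (1 - t) * b" using t a b by auto
    ultimately show "0 < m" unfolding m_def by linarith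
    have "0 < t * (1 - a) \<or> 0 < (1 - t) * (1 - b)" using t' ab a b by (auto simp: less_le)
    moreover have "0 \<le> t * (1 - a)" "0 \<le> (1 - t) * (1 - b)" using t a b by auto
    moreover have "1 - m = t * (1 - a) + (1 - t) * (1 - b)" by (simp add: m_def algebra_simps)
    ultimately show "m < 1" by linarith
  qed
  have "t * rel_ent a r + (1 - t) * rel_ent b r - rel_ent m r = t * rel_ent a m + (1 - t) * rel_ent b m"
  proof -
    have "t * rel_ent a r + (1 - t) * rel_ent b r = t * ent a + (1 - t) * ent b - m * ln r - (1 - m) * ln (1 - r)"
      using a b r by (simp add: rel_ent_expand m_def algebra_simps)
    moreover have "t * rel_ent a m + (1 - t) * rel_ent b m = t * ent a + (1 - t) * ent b - m * ln m - (1 - m) * ln (1 - m)"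
    proof -
      have "t * rel_ent a m + (1 - t) * rel_ent b m = t * ent a + (1 - t) * ent b - (t * a + (1 - t) * b) * ln m
         - (1 - (t * a + (1 - t) * b)) * ln (1 - m)"
        using a b m by (simp add: rel_ent_expand algebra_simps)
      then show ?thesis by (simp add: m_def)
    qed
    moreover have "rel_ent m r = m * ln m + (1 - m) * ln (1 - m) - m * ln r - (1 - m) * ln (1 - r)"
      using rel_ent_expand[of m r] m r by (simp add: ent_def)
    ultimately show ?thesis by simp
  qed
  moreover have "t * ((a - m)\<^sup>2 / 2) + (1 - t) * ((b - m)\<^sup>2 / 2) \<le> t * rel_ent a m + (1 - t) * rel_ent b m"
    using rel_ent_ge[OF a m] rel_ent_ge[OF b m] t by (intro add_mono mult_left_mono) auto
  \<comment> \<open>Half the variance of the two-point distribution at a and b with weights t and 1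
    - t, whose mean is m.\<close>
  moreover have "t * ((a - m)\<^sup>2 / 2) + (1 - t) * ((b - m)\<^sup>2 / 2) = t * (1 - t) / 2 * (a - b)\<^sup>2"
    unfolding m_def by (simp add: power2_eq_square field_simps)
  ultimately show ?thesis unfolding m_def by linarith
qed

locale reference_graphon =
  fixes r :: "real \<Rightarrow> real \<Rightarrow> real"
  assumes r_graphon: "r \<in> graphons"
    and log_r: "log_in_L1 r"
    and log_1r: "log_in_L1 (\<lambda>x y. 1 - r x y)"
begin

lemma AE_r: "AE p in leb_sq. p \<in> {0..1} \<times> {0..1} \<and> 0 < case_prod r p \<and> case_prod r p < 1"
proof -
  have "AE p in leb_sq. 0 < case_prod r p" "AE p in leb_sq. 0 < 1 - case_prod r p"
    using log_r log_1r by (auto simp: log_in_L1_def split_beta')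
  moreover have "AE p in leb_sq. p \<in> {0..1} \<times> {0..1}" by (rule AE_I2) simp
  ultimately show ?thesis by eventually_elim simp
qed

text \<open>A single majorant valid for all graphons at once, as dominated convergence along a
  sequence requires.\<close>

definition rate_bound :: "real \<times> real \<Rightarrow> real" where
  "rate_bound p = 2 + \<bar>ln (case_prod r p)\<bar> + \<bar>ln (1 - case_prod r p)\<bar>"

lemma rate_bound_integrable: "integrable leb_sq rate_bound"
proof -
  have "integrable leb_sq (\<lambda>p. ln (case_prod r p))" "integrable leb_sq (\<lambda>p. ln (1 - case_prod r p))"
    using log_r log_1r by (auto simp: log_in_L1_def split_beta')
  then show ?thesis unfolding rate_bound_def by auto
qed

lemma rate_I_eq: "rate_I r h = (LINT p|leb_sq. rel_ent (case_prod h p) (case_prod r p))"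
  unfolding rate_I_def by (intro Bochner_Integration.integral_cong) auto

lemma rate_I_measurable:
  assumes "h \<in> graphons"
  shows "(\<lambda>p. rel_ent (case_prod h p) (case_prod r p)) \<in> borel_measurable leb_sq"
  unfolding rel_ent_def using graphonD(1)[OF assms] graphonD(1)[OF r_graphon] by measurable

lemma rate_I_dominated:
  assumes h: "h \<in> graphons"
  shows "AE p in leb_sq. norm (rel_ent (case_prod h p) (case_prod r p)) \<le> rate_bound p"
  using AE_r
proof eventually_elim
  case (elim p)
  then have "\<bar>rel_ent (case_prod h p) (case_prod r p)\<bar> \<le> 2 + \<bar>ln (case_prod r p)\<bar> + \<bar>ln (1 - case_prod r p)\<bar>"
    using graphonD(2,3)[OF h, of p] by (intro abs_rel_ent_le) auto
  then show ?case by (simp add: rate_bound_def)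
qed

lemma rate_I_integrable:
  assumes h: "h \<in> graphons"
  shows "integrable leb_sq (\<lambda>p. rel_ent (case_prod h p) (case_prod r p))"
proof (rule Bochner_Integration.integrable_bound[OF rate_bound_integrable rate_I_measurable[OF h]])
  show "AE p in leb_sq. norm (rel_ent (case_prod h p) (case_prod r p)) \<le> norm (rate_bound p)"
    using rate_I_dominated[OF h] by eventually_elim simp
qed

text \<open>Shows that the rate can vanish only at graphons equal to r almost everywhere.\<close>

lemma sqdist_L2_le_rate_I:
  assumes h: "h \<in> graphons"
  shows "sqdist_L2 h r / 2 \<le> rate_I r h"
proof -
  have "sqdist_L2 h r / 2 = (LINT p|leb_sq. (case_prod h p - case_prod r p)\<^sup>2 / 2)"
    unfolding sqdist_L2_def by (simp only: integral_divide_zero)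
  also have "\<dots> \<le> (LINT p|leb_sq. rel_ent (case_prod h p) (case_prod r p))"
  proof (rule integral_mono_AE)
    show "AE p in leb_sq. (case_prod h p - case_prod r p)\<^sup>2 / 2 \<le> rel_ent (case_prod h p) (case_prod r p)"
      using AE_r by eventually_elim (intro rel_ent_ge graphonD(2,3)[OF h]; simp only:)
    show "integrable leb_sq (\<lambda>p. (case_prod h p - case_prod r p)\<^sup>2 / 2)"
      by (intro integrable_divide graphon_diff_integrable(2) h r_graphon)
  qed (rule rate_I_integrable[OF h])
  finally show ?thesis by (simp add: rate_I_eq)
qed

lemma rate_I_nonneg: "h \<in> graphons \<Longrightarrow> 0 \<le> rate_I r h"
  using sqdist_L2_le_rate_I sqdist_L2_nonneg[of h r] by fastforce

lemma rate_I_self: "rate_I r r = 0"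
  unfolding rate_I_eq
proof (rule integral_eq_zero_AE)
  show "AE p in leb_sq. rel_ent (case_prod r p) (case_prod r p) = 0"
    using AE_r by eventually_elim (simp add: rel_ent_self)
qed

lemma rate_I_mix_le:
  assumes h: "h \<in> graphons" and k: "k \<in> graphons" and t: "0 \<le> t" "t \<le> 1"
  shows "rate_I r (mix t h k) + t * (1 - t) / 2 * sqdist_L2 h k \<le> t * rate_I r h + (1 - t) * rate_I r k"
proof -
  note i = rate_I_integrable[OF h] rate_I_integrable[OF k] rate_I_integrable[OF mix_graphons[OF h k t]]
    graphon_diff_integrable(2)[OF h k]
  have "rate_I r (mix t h k) + t * (1 - t) / 2 * sqdist_L2 h k =
    (LINT p|leb_sq. rel_ent (case_prod (mix t h k) p) (case_prod r p) + t * (1 - t) / 2 * (case_prod h p - case_prod k p)\<^sup>2)"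
    unfolding rate_I_eq sqdist_L2_def
    by (subst Bochner_Integration.integral_add[OF i(3) integrable_mult_right[OF i(4)]])
      (simp only: integral_mult_right_zero)
  also have "\<dots> \<le> (LINT p|leb_sq. t * rel_ent (case_prod h p) (case_prod r p) + (1 - t) * rel_ent (case_prod k p) (case_prod r p))"
  proof (rule integral_mono_AE)
    show "AE p in leb_sq. rel_ent (case_prod (mix t h k) p) (case_prod r p) + t * (1 - t) / 2 * (case_prod h p - case_prod k p)\<^sup>2
      \<le> t * rel_ent (case_prod h p) (case_prod r p) + (1 - t) * rel_ent (case_prod k p) (case_prod r p)"
      using AE_r
    proof eventually_elim
      case (elim p)
      then show ?case unfolding case_prod_mix
        using graphonD(2,3)[OF h, of p] graphonD(2,3)[OF k, of p] t by (intro rel_ent_mix) auto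
    qed
  qed (intro Bochner_Integration.integrable_add integrable_mult_right i)+
  also have "\<dots> = t * rate_I r h + (1 - t) * rate_I r k"
    unfolding rate_I_eq
    by (subst Bochner_Integration.integral_add[OF integrable_mult_right[OF i(1)] integrable_mult_right[OF i(2)]])
      (simp only: integral_mult_right_zero)
  finally show ?thesis .
qed

lemma rate_I_AE_limit:
  assumes h: "h \<in> graphons" and k: "\<And>n. k n \<in> graphons"
    and lim: "AE p in leb_sq. (\<lambda>n. case_prod (k n) p) \<longlonglongrightarrow> case_prod h p"
  shows "(\<lambda>n. rate_I r (k n)) \<longlonglongrightarrow> rate_I r h"
  unfolding rate_I_eq
proof (rule integral_dominated_convergence[where w = rate_bound])
  show "AE p in leb_sq. (\<lambda>n. rel_ent (case_prod (k n) p) (case_prod r p)) \<longlonglongrightarrow> rel_ent (case_prod h p) (case_prod r p)"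
    using AE_r lim
  proof eventually_elim
    case (elim p)
    note b = graphonD(2,3)[OF h, of p] graphonD(2,3)[OF k, of p]
    have "(\<lambda>n. ent (case_prod (k n) p) - case_prod (k n) p * ln (case_prod r p) - (1 - case_prod (k n) p) * ln (1 - case_prod r p))
      \<longlonglongrightarrow> ent (case_prod h p) - case_prod h p * ln (case_prod r p) - (1 - case_prod h p) * ln (1 - case_prod r p)"
      using elim b by (intro tendsto_intros tendsto_ent) auto
    then show ?case using elim b by (simp add: rel_ent_expand)
  qed
qed (use rate_bound_integrable rate_I_measurable h k rate_I_dominated in auto)

end

section \<open>The variational problem\<close>

text \<open>Completeness of \<open>L\<^sup>2\<close> for rapidly Cauchy sequences, with a pointwise
  limit. Weighting the squared increments by \<open>2 ^ n\<close> still leaves a series with finite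
  integral, and \<open>\<bar>f n p\<bar> \<le> 2 ^ n * (f n p)\<^sup>2 + (1/2) ^ n\<close> turns its
  finiteness at p into absolute summability of the increments.\<close>

lemma graphon_sequence_limit:
  assumes h: "\<And>n. h n \<in> graphons" and d: "\<And>n. sqdist_L2 (h (Suc n)) (h n) \<le> C * (1/4) ^ n"
  obtains g where "g \<in> graphons" "AE p in leb_sq. (\<lambda>n. case_prod (h n) p) \<longlonglongrightarrow> case_prod g p"
proof -
  note [measurable] = graphonD(1)[OF h]
  define f where "f n p = case_prod (h (Suc n)) p - case_prod (h n) p" for n p
  have [measurable]: "f n \<in> borel_measurable leb_sq" for n unfolding f_def by measurable
  have "C \<ge> 0" using d[of 0] sqdist_L2_nonneg[of "h (Suc 0)" "h 0"] by simp
  have "(\<integral>\<^sup>+p. (\<Sum>n. ennreal (2 ^ n * (f n p)\<^sup>2)) \<partial>leb_sq) = (\<Sum>n. \<integral>\<^sup>+p. ennreal (2 ^ n * (f n p)\<^sup>2) \<partial>leb_sq)"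
    by (intro nn_integral_suminf) measurable
  also have "\<dots> \<le> (\<Sum>n. ennreal (C * (1/2) ^ n))"
  proof (intro suminf_le allI)
    fix n
    have i: "integrable leb_sq (\<lambda>p. (f n p)\<^sup>2)"
      unfolding f_def by (rule graphon_diff_integrable(2)[OF h h])
    have "(\<integral>\<^sup>+p. ennreal (2 ^ n * (f n p)\<^sup>2) \<partial>leb_sq) = ennreal (LINT p|leb_sq. 2 ^ n * (f n p)\<^sup>2)"
      using i by (intro nn_integral_eq_integral) auto
    also have "(LINT p|leb_sq. 2 ^ n * (f n p)\<^sup>2) = 2 ^ n * sqdist_L2 (h (Suc n)) (h n)"
      unfolding sqdist_L2_def f_def by (rule integral_mult_right_zero)
    also have "ennreal \<dots> \<le> ennreal (C * (1/2) ^ n)"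
    proof (rule ennreal_leI)
      have "2 ^ n * sqdist_L2 (h (Suc n)) (h n) \<le> 2 ^ n * (C * (1/4) ^ n)"
        using d[of n] by (intro mult_left_mono) auto
      also have "\<dots> = C * (2 * (1/4)) ^ n" by (simp only: power_mult_distrib mult_ac)
      finally show "2 ^ n * sqdist_L2 (h (Suc n)) (h n) \<le> C * (1/2) ^ n" by simp
    qed
    finally show "(\<integral>\<^sup>+p. ennreal (2 ^ n * (f n p)\<^sup>2) \<partial>leb_sq) \<le> ennreal (C * (1/2) ^ n)" .
  qed auto
  also have "\<dots> = ennreal (\<Sum>n. C * (1/2) ^ n)"
    using \<open>C \<ge> 0\<close> by (intro suminf_ennreal2 summable_mult summable_geometric) auto
  finally have fin: "(\<integral>\<^sup>+p. (\<Sum>n. ennreal (2 ^ n * (f n p)\<^sup>2)) \<partial>leb_sq) \<noteq> \<infinity>"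
    by (auto simp: top_unique)
  have "AE p in leb_sq. (\<Sum>n. ennreal (2 ^ n * (f n p)\<^sup>2)) \<noteq> \<infinity>"
    by (rule nn_integral_PInf_AE[OF _ fin]) measurable
  then have conv: "AE p in leb_sq. convergent (\<lambda>n. case_prod (h n) p)"
  proof eventually_elim
    case (elim p)
    have "summable (\<lambda>n. 2 ^ n * (f n p)\<^sup>2)" using elim by (intro summable_suminf_not_top) auto
    then have s: "summable (\<lambda>n. 2 ^ n * (f n p)\<^sup>2 + (1/2) ^ n)"
      by (intro summable_add) (auto simp: summable_geometric)
    have "norm (f n p) \<le> 2 ^ n * (f n p)\<^sup>2 + (1/2) ^ n" for n
    proof -
      have "0 \<le> (1/2) ^ n * (2 ^ n * \<bar>f n p\<bar> - 1)\<^sup>2" by simp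
      also have "\<dots> = ((1/2) ^ n * 2 ^ n) * (2 ^ n * (f n p)\<^sup>2) - 2 * ((1/2) ^ n * 2 ^ n) * \<bar>f n p\<bar> + (1/2) ^ n"
        by (simp add: power2_eq_square algebra_simps)
      also have "(1/2 :: real) ^ n * 2 ^ n = 1" by (simp flip: power_mult_distrib)
      finally show ?thesis by simp
    qed
    then have "summable (\<lambda>n. f n p)" by (intro summable_comparison_test[OF _ s]) auto
    then have "convergent (\<lambda>n. \<Sum>k<n. f k p)" by (simp add: summable_iff_convergent)
    then have "convergent (\<lambda>n. case_prod (h 0) p + (\<Sum>k<n. f k p))"
      by (intro convergent_add convergent_const)
    moreover have "case_prod (h 0) p + (\<Sum>k<n. f k p) = case_prod (h n) p" for n
    proof -
      have "a + (b - a) = b" for a b :: real by simp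
      then show ?thesis unfolding f_def sum_lessThan_telescope[of "\<lambda>n. case_prod (h n) p"] .
    qed
    ultimately show ?case by simp
  qed
  \<comment> \<open>A graphon is constrained at every point of the square, not just almost
    everywhere. The value 0 where the sequence diverges keeps g symmetric and within the unit
    interval, and testing for Cauchy sequences keeps it measurable.\<close>
  define g where "g x y = (if Cauchy (\<lambda>n. h n x y) then lim (\<lambda>n. h n x y) else 0)" for x y
  have g: "(\<lambda>n. h n x y) \<longlonglongrightarrow> g x y" if "convergent (\<lambda>n. h n x y)" for x y
    using that by (simp add: g_def Cauchy_convergent_iff convergent_LIMSEQ_iff)
  have "g \<in> graphons"
  proof (rule graphonI)
    have "(\<lambda>p. if Cauchy (\<lambda>n. case_prod (h n) p) then lim (\<lambda>n. case_prod (h n) p) else 0) \<in> borel_measurable leb_sq"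
      by measurable
    moreover have "case_prod g = (\<lambda>p. if Cauchy (\<lambda>n. case_prod (h n) p) then lim (\<lambda>n. case_prod (h n) p) else 0)"
      by (auto simp: g_def fun_eq_iff)
    ultimately show "case_prod g \<in> borel_measurable leb_sq" by simp
    fix x y :: real assume xy: "x \<in> {0..1}" "y \<in> {0..1}"
    show "g x y = g y x" unfolding g_def using graphonD(4)[OF h xy] by simp
    have "0 \<le> g x y \<and> g x y \<le> 1"
    proof (cases "convergent (\<lambda>n. h n x y)")
      case True
      then show ?thesis
        using LIMSEQ_le_const[OF g[OF True], of 0] LIMSEQ_le_const2[OF g[OF True], of 1] graphonD(5,6)[OF h xy] by auto
    qed (simp add: g_def Cauchy_convergent_iff)
    then show "0 \<le> g x y" "g x y \<le> 1" by auto
  qed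
  moreover have "AE p in leb_sq. (\<lambda>n. case_prod (h n) p) \<longlonglongrightarrow> case_prod g p"
    using conv by eventually_elim (auto simp: split_beta intro: g)
  ultimately show thesis by (rule that)
qed

section \<open>The zero graphon and sequences with vanishing Laplacian norm\<close>

lemma zero_graphon: "(\<lambda>x y. 0) \<in> graphons"
  by (rule graphonI) auto

lemma lap_norm_zero: "lap_norm (\<lambda>x y. 0) = 0"
proof (rule antisym[OF lap_norm_least lap_norm_nonneg[OF zero_graphon]])
  show "L2_norm01 (laplacian (\<lambda>x y. 0) u) \<le> 0" for u
    by (simp add: laplacian_def L2_norm01_def)
qed

lemma AE_leb_sq_offdiag: "AE p in leb_sq. fst p \<noteq> snd p"
proof -
  have "AE y in unit1. x \<noteq> y" for x :: real
    using AE_lborel_singleton[of x] by (subst AE_restrict_space_iff) (auto elim: eventually_mono)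
  then have "AE p in unit1 \<Otimes>\<^sub>M unit1. fst p \<noteq> snd p"
  proof (intro unit2.AE_pair_measure)
    have "fst \<in> borel_measurable (unit1 \<Otimes>\<^sub>M unit1)" "snd \<in> borel_measurable (unit1 \<Otimes>\<^sub>M unit1)"
      by (auto intro!: measurable_compose[OF measurable_fst] measurable_compose[OF measurable_snd] measurable_restrict_space1)
    then show "{p \<in> space (unit1 \<Otimes>\<^sub>M unit1). fst p \<noteq> snd p} \<in> sets (unit1 \<Otimes>\<^sub>M unit1)"
      by (rule borel_measurable_neq)
  qed simp
  then show ?thesis unfolding leb_sq_eq by (rule AE_completion)
qed

text \<open>The weighted graphons tend to 0 in mean, hence almost everywhere along a subsequence;
  off the diagonal the weight can be divided out.\<close>

lemma lap_norm_tendsto_0_AE_subseq: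
  assumes k: "\<And>n. k n \<in> graphons" and lim: "(\<lambda>n. lap_norm (k n)) \<longlonglongrightarrow> 0"
  obtains s where "strict_mono s" "AE p in leb_sq. (\<lambda>n. case_prod (k (s n)) p) \<longlonglongrightarrow> 0"
proof -
  have id: "(\<lambda>x. x) \<in> borel_measurable leb01"
    by (intro measurable_restrict_space1 measurable_completion) simp
  have fs [measurable]: "fst \<in> borel_measurable leb_sq" "snd \<in> borel_measurable leb_sq"
    using measurable_compose[OF measurable_fst_leb_sq id] measurable_compose[OF measurable_snd_leb_sq id] by simp_all
  note [measurable] = graphonD(1)[OF k]
  define u where "u n p = case_prod (k n) p * (fst p - snd p)\<^sup>2" for n p
  have nn: "0 \<le> u n p" if "p \<in> {0..1} \<times> {0..1}" for n p
    unfolding u_def using graphonD(2)[OF k that] by simp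
  have "\<exists>s::nat\<Rightarrow>nat. strict_mono s \<and> (AE p in leb_sq. (\<lambda>n. u (s n) p) \<longlonglongrightarrow> 0)"
  proof (rule tendsto_L1_AE_subseq)
    fix n
    show "integrable leb_sq (u n)"
    proof (rule integrable_leb_sq_bounded[of _ 1])
      show "u n \<in> borel_measurable leb_sq" unfolding u_def by measurable
      fix p :: "real \<times> real" assume p: "p \<in> {0..1} \<times> {0..1}"
      have "\<bar>case_prod (k n) p\<bar> \<le> 1" "\<bar>(fst p - snd p)\<^sup>2\<bar> \<le> 1"
        using graphonD(2,3)[OF k p, of n] p by (auto simp: abs_square_le_1)
      then show "\<bar>u n p\<bar> \<le> 1" unfolding u_def abs_mult by (intro mult_le_one) auto
    qed
  next
    have eq: "(LINT p|leb_sq. norm (u n p)) = (LINT p|leb_sq. case_prod (k n) p * (fst p - snd p)\<^sup>2)" for n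
    proof (rule Bochner_Integration.integral_cong)
      fix p assume "p \<in> space leb_sq"
      then have "0 \<le> u n p" by (intro nn) simp
      then show "norm (u n p) = case_prod (k n) p * (fst p - snd p)\<^sup>2"
        by (simp only: real_norm_def abs_of_nonneg) (simp only: u_def)
    qed simp
    show "(\<lambda>n. LINT p|leb_sq. norm (u n p)) \<longlonglongrightarrow> 0"
    proof (rule tendsto_sandwich[OF _ _ tendsto_const])
      show "\<forall>\<^sub>F n in sequentially. (LINT p|leb_sq. norm (u n p)) \<le> 2 * lap_norm (k n)"
        unfolding eq using integral_graphon_le_lap_norm[OF k] by (intro always_eventually allI)
      show "(\<lambda>n. 2 * lap_norm (k n)) \<longlonglongrightarrow> 0" using tendsto_mult_left[OF lim, of 2] by simp
      show "\<forall>\<^sub>F n in sequentially. 0 \<le> (LINT p|leb_sq. norm (u n p))"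
        by (intro always_eventually allI integral_nonneg_AE) auto
    qed
  qed
  then obtain s :: "nat \<Rightarrow> nat" where s: "strict_mono s" "AE p in leb_sq. (\<lambda>n. u (s n) p) \<longlonglongrightarrow> 0" by blast
  have "AE p in leb_sq. (\<lambda>n. case_prod (k (s n)) p) \<longlonglongrightarrow> 0"
    using s(2) AE_leb_sq_offdiag
  proof eventually_elim
    case (elim p)
    have "(\<lambda>n. u (s n) p / (fst p - snd p)\<^sup>2) \<longlonglongrightarrow> 0 / (fst p - snd p)\<^sup>2"
      using elim by (intro tendsto_intros) auto
    moreover have "u (s n) p / (fst p - snd p)\<^sup>2 = case_prod (k (s n)) p" for n
      using elim(2) unfolding u_def by (intro nonzero_mult_div_cancel_right) auto
    ultimately show ?case by simp
  qed
  with s(1) show thesis by (rule that)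
qed

definition sublevel :: "real \<Rightarrow> (real \<Rightarrow> real \<Rightarrow> real) set" where
  "sublevel \<beta> = {h \<in> graphons. lap_norm h \<le> \<beta>}"

lemma sublevelD: "h \<in> sublevel \<beta> \<Longrightarrow> h \<in> graphons" "h \<in> sublevel \<beta> \<Longrightarrow> lap_norm h \<le> \<beta>"
  by (auto simp: sublevel_def)

lemma zero_in_sublevel: "0 \<le> \<beta> \<Longrightarrow> (\<lambda>x y. 0) \<in> sublevel \<beta>"
  by (simp add: sublevel_def zero_graphon lap_norm_zero)

lemma sublevel_nonempty: "0 \<le> \<beta> \<Longrightarrow> sublevel \<beta> \<noteq> {}"
  using zero_in_sublevel by blast

lemma mix_sublevel:
  assumes "h \<in> sublevel a" "k \<in> sublevel b" "0 \<le> t" "t \<le> 1"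
  shows "mix t h k \<in> sublevel (t * a + (1 - t) * b)"
proof -
  have "lap_norm (mix t h k) \<le> t * lap_norm h + (1 - t) * lap_norm k"
    using assms by (intro lap_norm_mix_le sublevelD(1))
  also have "\<dots> \<le> t * a + (1 - t) * b"
    using assms sublevelD(2) by (intro add_mono mult_left_mono) auto
  finally show ?thesis using assms by (auto simp: sublevel_def intro: mix_graphons)
qed

section \<open>Minimisation of the rate over graphons\<close>

context reference_graphon
begin

definition min_rate :: "real \<Rightarrow> real" where
  "min_rate \<beta> = (INF h\<in>sublevel \<beta>. rate_I r h)"

lemma bdd_below_rate: "bdd_below (rate_I r ` sublevel \<beta>)"
  using rate_I_nonneg sublevelD by (intro bdd_belowI2[of _ 0]) auto

lemma min_rate_le: "h \<in> sublevel \<beta> \<Longrightarrow> min_rate \<beta> \<le> rate_I r h"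
  unfolding min_rate_def using bdd_below_rate by (rule cINF_lower)

lemma min_rate_nonneg: "0 \<le> \<beta> \<Longrightarrow> 0 \<le> min_rate \<beta>"
  unfolding min_rate_def using sublevel_nonempty rate_I_nonneg sublevelD by (intro cINF_greatest) auto

lemma min_rate_approx:
  assumes "0 \<le> \<beta>" "e > 0"
  obtains h where "h \<in> sublevel \<beta>" "rate_I r h < min_rate \<beta> + e"
  using cINF_less_iff[OF sublevel_nonempty[OF assms(1)] bdd_below_rate, of "min_rate \<beta> + e"] assms(2)
  unfolding min_rate_def by auto

text \<open>The midpoint remains admissible, so its rate is at least the minimum. The convexity
  defect there is one eighth of the squared distance, while the mean excess of h and k carries a
  factor 1/2; hence the constant 4.\<close>

lemma sqdist_L2_near_minimiser:
  assumes "h \<in> sublevel \<beta>" "k \<in> sublevel \<beta>"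
  shows "sqdist_L2 h k \<le> 4 * ((rate_I r h - min_rate \<beta>) + (rate_I r k - min_rate \<beta>))"
proof -
  have "mix (1/2) h k \<in> sublevel \<beta>" using mix_sublevel[OF assms, of "1/2"] by simp
  then have "min_rate \<beta> \<le> rate_I r (mix (1/2) h k)" by (rule min_rate_le)
  then show ?thesis
    using rate_I_mix_le[OF sublevelD(1)[OF assms(1)] sublevelD(1)[OF assms(2)], of "1/2"] by simp
qed

lemma minimiser_exists:
  assumes \<beta>: "0 \<le> \<beta>"
  obtains h where "h \<in> sublevel \<beta>" "rate_I r h = min_rate \<beta>"
proof -
  have "\<exists>h. h \<in> sublevel \<beta> \<and> rate_I r h < min_rate \<beta> + (1/4) ^ n" for n :: nat
    by (rule min_rate_approx[OF \<beta>, of "(1/4) ^ n"]) auto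
  then obtain h where h: "\<And>n. h n \<in> sublevel \<beta>" "\<And>n. rate_I r (h n) < min_rate \<beta> + (1/4) ^ n" by metis
  \<comment> \<open>Both excesses are at most \<open>(1/4) ^ n\<close>, so the constant 4 of
    \<open>sqdist_L2_near_minimiser\<close> becomes 8. The rate 1/4 is the speed that
    \<open>graphon_sequence_limit\<close> asks for.\<close>
  have d: "sqdist_L2 (h (Suc n)) (h n) \<le> 8 * (1/4) ^ n" for n
  proof -
    have "0 \<le> (1/4 :: real) ^ n" by simp
    then have "rate_I r (h (Suc n)) - min_rate \<beta> \<le> (1/4) ^ n"
      using h(2)[of "Suc n", unfolded power_Suc] by linarith
    then show ?thesis using sqdist_L2_near_minimiser[OF h(1)[of "Suc n"] h(1)[of n]] h(2)[of n] by simp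
  qed
  obtain g where g: "g \<in> graphons" "AE p in leb_sq. (\<lambda>n. case_prod (h n) p) \<longlonglongrightarrow> case_prod g p"
    using graphon_sequence_limit[OF sublevelD(1)[OF h(1)] d] .
  have gs: "g \<in> sublevel \<beta>"
    using lap_norm_AE_limit_le[OF g(1) sublevelD(1)[OF h(1)] sublevelD(2)[OF h(1)] g(2)] g(1)
    by (simp add: sublevel_def)
  have "(\<lambda>n. min_rate \<beta> + (1/4) ^ n) \<longlonglongrightarrow> min_rate \<beta> + 0"
    by (intro tendsto_intros LIMSEQ_realpow_zero) auto
  then have "rate_I r g \<le> min_rate \<beta> + 0"
    using h(2) by (intro LIMSEQ_le[OF rate_I_AE_limit[OF g(1) sublevelD(1)[OF h(1)] g(2)]]) (auto intro: less_imp_le)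
  then have "rate_I r g = min_rate \<beta>" using min_rate_le[OF gs] by simp
  with gs show thesis by (rule that)
qed

section \<open>Convexity, monotonicity and continuity of the minimal rate\<close>

lemma min_rate_antimono:
  assumes "0 \<le> a" "a \<le> b" shows "min_rate b \<le> min_rate a"
proof -
  obtain h where "h \<in> sublevel a" "rate_I r h = min_rate a" using minimiser_exists[OF assms(1)] .
  then show ?thesis using min_rate_le[of h b] assms by (auto simp: sublevel_def)
qed

lemma min_rate_convex:
  assumes "0 \<le> a" "0 \<le> b" "0 \<le> t" "t \<le> 1"
  shows "min_rate (t * a + (1 - t) * b) \<le> t * min_rate a + (1 - t) * min_rate b"
proof -
  obtain h where h: "h \<in> sublevel a" "rate_I r h = min_rate a" using minimiser_exists[OF assms(1)] .
  obtain k where k: "k \<in> sublevel b" "rate_I r k = min_rate b" using minimiser_exists[OF assms(2)] .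
  have "min_rate (t * a + (1 - t) * b) \<le> rate_I r (mix t h k)"
    using mix_sublevel[OF h(1) k(1)] assms by (intro min_rate_le) auto
  also have "\<dots> \<le> rate_I r (mix t h k) + t * (1 - t) / 2 * sqdist_L2 h k" using assms sqdist_L2_nonneg by simp
  also have "\<dots> \<le> t * rate_I r h + (1 - t) * rate_I r k"
    by (rule rate_I_mix_le[OF sublevelD(1)[OF h(1)] sublevelD(1)[OF k(1)] assms(3,4)])
  finally show ?thesis unfolding h(2) k(2) .
qed

lemma sqdist_zero_cut_rel:
  assumes h: "h \<in> graphons" and k: "k \<in> graphons" and 0: "sqdist_L2 h k = 0"
  shows "(h, k) \<in> cut_rel"
proof -
  have "relabel k (\<lambda>x. x) = k" by (simp add: relabel_def)
  then have "cut_metric h k = 0"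
    using 0 by (intro cut_metric_zero_of_L2[OF h k, of "\<lambda>_ x. x"]) (auto simp: id_mp_bijections)
  then show ?thesis using h k by (simp add: cut_rel_def)
qed

lemma min_rate_lap_norm: "min_rate (lap_norm r) = 0"
proof -
  have "min_rate (lap_norm r) \<le> rate_I r r" by (rule min_rate_le) (simp add: sublevel_def r_graphon)
  then show ?thesis using min_rate_nonneg[OF lap_norm_nonneg[OF r_graphon]] rate_I_self by simp
qed

text \<open>The minimum is attained, so the value 0 would belong to a graphon equal to r almost
  everywhere, whose Laplacian norm is too large.\<close>

lemma min_rate_pos:
  assumes "0 \<le> \<beta>" "\<beta> < lap_norm r" shows "0 < min_rate \<beta>"
proof (rule ccontr)
  assume "\<not> 0 < min_rate \<beta>"
  then have 0: "min_rate \<beta> = 0" using min_rate_nonneg[OF assms(1)] by simp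
  obtain h where h: "h \<in> sublevel \<beta>" "rate_I r h = min_rate \<beta>" using minimiser_exists[OF assms(1)] .
  have "sqdist_L2 h r = 0"
    using sqdist_L2_le_rate_I[OF sublevelD(1)[OF h(1)]] sqdist_L2_nonneg[of h r] h(2) 0 by simp
  then have "lap_norm h = lap_norm r"
    using h by (intro lap_norm_cut_rel sqdist_zero_cut_rel sublevelD(1) r_graphon)
  then show False using sublevelD(2)[OF h(1)] assms by simp
qed

lemma rate_I_zero_eq_C0: "rate_I r (\<lambda>x y. 0) = C0 r"
  by (simp add: rate_I_def C0_def rel_ent_def)

text \<open>\<open>C0 r\<close> is the rate of the zero graphon; if it were not positive, r would
  vanish almost everywhere, against its positivity on a square of measure one.\<close>

lemma C0_pos: "0 < C0 r"
proof (rule ccontr)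
  assume "\<not> 0 < C0 r"
  then have "sqdist_L2 (\<lambda>x y. 0) r = 0"
    using sqdist_L2_le_rate_I[OF zero_graphon] sqdist_L2_nonneg[of "\<lambda>x y. 0" r] by (simp add: rate_I_zero_eq_C0)
  then have "AE p in leb_sq. (case_prod (\<lambda>x y. 0) p - case_prod r p)\<^sup>2 = 0"
    unfolding sqdist_L2_def using graphon_diff_integrable(2)[OF zero_graphon r_graphon]
    by (subst (asm) integral_nonneg_eq_0_iff_AE) auto
  then have "AE p in leb_sq. False" using AE_r by eventually_elim (auto simp: split_beta)
  then have "emeasure leb_sq (space leb_sq) = 0" by (simp add: AE_iff_measurable[OF _ refl])
  then show False by simp
qed

lemma rate_I_tendsto_C0_subseq:
  assumes k: "\<And>n. k n \<in> graphons" and lim: "(\<lambda>n. lap_norm (k n)) \<longlonglongrightarrow> 0"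
  obtains s where "strict_mono s" "(\<lambda>n. rate_I r (k (s n))) \<longlonglongrightarrow> C0 r"
proof -
  obtain s where s: "strict_mono s" "AE p in leb_sq. (\<lambda>n. case_prod (k (s n)) p) \<longlonglongrightarrow> 0"
    using lap_norm_tendsto_0_AE_subseq[OF k lim] .
  have "(\<lambda>n. rate_I r (k (s n))) \<longlonglongrightarrow> rate_I r (\<lambda>x y. 0)"
    using s(2) by (intro rate_I_AE_limit zero_graphon k) (auto simp: split_beta)
  with s(1) show thesis unfolding rate_I_zero_eq_C0 by (rule that)
qed

text \<open>The constant sequence of a minimiser at level 0 has Laplacian norms tending to 0, so its
  rates tend to \<open>C0 r\<close>.\<close>

lemma min_rate_zero: "min_rate 0 = C0 r"
proof -
  obtain h where h: "h \<in> sublevel 0" "rate_I r h = min_rate 0" using minimiser_exists[of 0] by auto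
  have "lap_norm h = 0" using sublevelD[OF h(1)] lap_norm_nonneg by force
  then obtain s :: "nat \<Rightarrow> nat" where "(\<lambda>n. rate_I r h) \<longlonglongrightarrow> C0 r"
    using rate_I_tendsto_C0_subseq[of "\<lambda>_. h"] sublevelD(1)[OF h(1)] by auto
  then show ?thesis using h(2) by (simp add: LIMSEQ_const_iff)
qed

text \<open>Were the norm 0, the minimal rate there would be both \<open>C0 r\<close> and 0.\<close>

lemma lap_norm_pos: "0 < lap_norm r"
  using min_rate_zero min_rate_lap_norm C0_pos lap_norm_nonneg[OF r_graphon] by (metis less_le)

text \<open>The graph lies below the chord from a to the norm of r, and this chord falls strictly
  because it starts at a positive value and ends at 0. The weight t is the one that places b on the
  segment.\<close>

lemma min_rate_strict_antimono:
  assumes a: "0 \<le> a" and ab: "a < b" and b: "b \<le> lap_norm r"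
  shows "min_rate b < min_rate a"
proof -
  define C where "C = lap_norm r"
  have pos: "0 < min_rate a" using assms by (intro min_rate_pos) auto
  define t where "t = (C - b) / (C - a)"
  have t: "0 \<le> t" "t < 1" using ab b by (auto simp: t_def C_def)
  have "t * (C - a) = C - b" using ab b by (simp add: t_def C_def)
  then have "b = t * a + (1 - t) * C" by (simp add: algebra_simps)
  then have "min_rate b \<le> t * min_rate a + (1 - t) * min_rate C"
    using min_rate_convex[of a C t] a ab b t by (simp add: C_def)
  also have "\<dots> < min_rate a" using t pos min_rate_lap_norm by (simp add: C_def)
  finally show ?thesis .
qed

text \<open>Minimisers at levels tending to 0 have vanishing Laplacian norm, so along a subsequence
  their rates approach \<open>C0 r\<close>. One such level close to 0 suffices: monotonicity covers
  all smaller ones.\<close>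

lemma min_rate_right_limit_0: "(min_rate \<longlongrightarrow> min_rate 0) (at 0 within {0..lap_norm r})"
proof (rule tendstoI)
  fix e :: real assume e: "0 < e"
  define b where "b n = inverse (real (Suc n))" for n
  have "\<exists>h. h \<in> sublevel (b n) \<and> rate_I r h = min_rate (b n)" for n
    by (rule minimiser_exists[of "b n"]) (auto simp: b_def)
  then obtain k where k: "\<And>n. k n \<in> sublevel (b n)" "\<And>n. rate_I r (k n) = min_rate (b n)" by metis
  have "(\<lambda>n. lap_norm (k n)) \<longlonglongrightarrow> 0"
  proof (rule tendsto_sandwich[OF _ _ tendsto_const])
    show "b \<longlonglongrightarrow> 0" unfolding b_def by (rule LIMSEQ_inverse_real_of_nat)
  qed (use sublevelD[OF k(1)] lap_norm_nonneg in auto)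
  then obtain s where s: "(\<lambda>n. rate_I r (k (s n))) \<longlonglongrightarrow> C0 r"
    by (rule rate_I_tendsto_C0_subseq[OF sublevelD(1)[OF k(1)]])
  obtain n where n: "rate_I r (k (s n)) > C0 r - e"
    using order_tendstoD(1)[OF s, of "C0 r - e"] e by (auto simp: eventually_sequentially)
  define \<delta> where "\<delta> = b (s n)"
  have \<delta>: "\<delta> > 0" by (simp add: \<delta>_def b_def)
  have "dist (min_rate x) (min_rate 0) < e" if "0 \<le> x" "x < \<delta>" for x
  proof -
    have "min_rate \<delta> \<le> min_rate x" "min_rate x \<le> min_rate 0"
      using min_rate_antimono that by auto
    then show ?thesis using n k(2)[of "s n"] min_rate_zero by (simp add: dist_real_def \<delta>_def)
  qed
  then show "\<forall>\<^sub>F x in at 0 within {0..lap_norm r}. dist (min_rate x) (min_rate 0) < e"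
    unfolding eventually_at using \<delta> by (intro exI[of _ \<delta>]) auto
qed

text \<open>The minimal rate is squeezed between 0 and the chord joining its values at the two ends
  of the interval.\<close>

lemma min_rate_left_limit:
  "(min_rate \<longlongrightarrow> min_rate (lap_norm r)) (at (lap_norm r) within {0..lap_norm r})"
proof -
  define C where "C = lap_norm r"
  have C: "0 < C" unfolding C_def by (rule lap_norm_pos)
  have bd: "min_rate x \<le> (1 - x / C) * min_rate 0" if "x \<in> {0..C}" for x
  proof -
    have "min_rate ((1 - x / C) * 0 + (1 - (1 - x / C)) * C) \<le> (1 - x / C) * min_rate 0 + (1 - (1 - x / C)) * min_rate C"
      using that C by (intro min_rate_convex) auto
    then show ?thesis using C min_rate_lap_norm by (simp add: C_def)
  qed
  have lim: "((\<lambda>x. (1 - x / C) * min_rate 0) \<longlongrightarrow> (1 - C / C) * min_rate 0) (at C within {0..C})"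
    using C by (intro tendsto_intros) auto
  have "(min_rate \<longlongrightarrow> 0) (at C within {0..C})"
  proof (rule tendsto_sandwich[OF _ _ tendsto_const])
    show "((\<lambda>x. (1 - x / C) * min_rate 0) \<longlongrightarrow> 0) (at C within {0..C})" using lim C by simp
    show "\<forall>\<^sub>F x in at C within {0..C}. 0 \<le> min_rate x"
      unfolding eventually_at using min_rate_nonneg by (intro exI[of _ 1]) auto
    show "\<forall>\<^sub>F x in at C within {0..C}. min_rate x \<le> (1 - x / C) * min_rate 0"
      unfolding eventually_at using bd by (intro exI[of _ 1]) auto
  qed
  then show ?thesis using min_rate_lap_norm by (simp add: C_def)
qed

lemma min_rate_continuous_on: "continuous_on {0..lap_norm r} min_rate"
proof -
  define C where "C = lap_norm r"
  have "convex_on {0<..<C} min_rate"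
  proof (rule convex_onI)
    fix t x y :: real assume "t > 0" "t < 1" "x \<in> {0<..<C}" "y \<in> {0<..<C}"
    then show "min_rate ((1 - t) *\<^sub>R x + t *\<^sub>R y) \<le> (1 - t) * min_rate x + t * min_rate y"
      using min_rate_convex[of x y "1 - t"] by simp
  qed simp
  then have int: "continuous_on {0<..<C} min_rate" by (intro convex_on_continuous) auto
  show ?thesis
    unfolding continuous_on_def C_def[symmetric]
  proof
    fix x assume x: "x \<in> {0..C}"
    consider "x = 0" | "x = C" | "x \<in> {0<..<C}" using x by force
    then show "(min_rate \<longlongrightarrow> min_rate x) (at x within {0..C})"
    proof cases
      case 1 then show ?thesis using min_rate_right_limit_0 by (simp add: C_def)
    next
      case 2 then show ?thesis using min_rate_left_limit by (simp add: C_def)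
    next
      case 3
      then have "isCont min_rate x" using int by (simp add: continuous_on_eq_continuous_at)
      then show ?thesis unfolding isCont_def by (rule tendsto_within_subset) simp
    qed
  qed
qed

text \<open>The representative chosen by \<open>rep\<close> does not matter: equivalent graphons are
  \<open>L\<^sup>2\<close> limits of relabellings of each other.\<close>

lemma bdd_below_rate_relabel:
  "c \<in> graphon_classes \<Longrightarrow> bdd_below ((\<lambda>\<phi>. rate_I r (relabel (rep c) \<phi>)) ` mp_bijections)"
  using rate_I_nonneg relabel_graphons rep_in(2) by (intro bdd_belowI2[of _ 0]) auto

lemma rate_J_le:
  assumes c: "c \<in> graphon_classes" and hc: "(h, rep c) \<in> cut_rel"
  shows "rate_J r c \<le> rate_I r h"
proof -
  have h: "h \<in> graphons" and g: "rep c \<in> graphons" and 0: "cut_metric h (rep c) = 0"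
    using hc by (auto simp: cut_rel_def)
  obtain \<phi> where \<phi>: "\<And>n. \<phi> n \<in> mp_bijections" "(\<lambda>n. sqdist_L2 h (relabel (rep c) (\<phi> n))) \<longlonglongrightarrow> 0"
    using cut_metric_zero_imp_L2[OF h g 0] by metis
  note kg = relabel_graphons[OF g \<phi>(1)]
  obtain s where s: "AE p in leb_sq. (\<lambda>n. case_prod (relabel (rep c) (\<phi> (s n))) p) \<longlonglongrightarrow> case_prod h p"
    using sqdist_L2_AE_subseq[OF h kg \<phi>(2)] .
  show ?thesis
  \<comment> \<open>Possibly h is no relabelling of \<open>rep c\<close>, so its rate may be missing
    from the infimum; it is a limit of rates that do occur there.\<close>
  proof (rule LIMSEQ_le_const[OF rate_I_AE_limit[OF h kg s]], intro exI allI impI)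
    show "rate_J r c \<le> rate_I r (relabel (rep c) (\<phi> (s n)))" for n
      unfolding rate_J_def using bdd_below_rate_relabel[OF c] \<phi>(1) by (rule cINF_lower)
  qed
qed

lemma rate_J_nonneg: "c \<in> graphon_classes \<Longrightarrow> 0 \<le> rate_J r c"
  unfolding rate_J_def using rate_I_nonneg relabel_graphons rep_in(2) mp_bijections_nonempty
  by (intro cINF_greatest) auto

lemma relabel_rep_sublevel:
  assumes "c \<in> graphon_classes" "lap_norm_class c \<le> \<beta>" "\<phi> \<in> mp_bijections"
  shows "relabel (rep c) \<phi> \<in> sublevel \<beta>"
  using assms rep_in(2)[OF assms(1)]
  by (simp add: sublevel_def relabel_graphons lap_norm_relabel lap_norm_class_def)

lemma class_sublevel:
  assumes "h \<in> sublevel \<beta>"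
  shows "cut_rel `` {h} \<in> {c \<in> graphon_classes. lap_norm_class c \<le> \<beta>}"
  using class_in[OF sublevelD(1)[OF assms]] lap_norm_cut_rel[OF rep_class[OF sublevelD(1)[OF assms]]] sublevelD(2)[OF assms]
  by (simp add: lap_norm_class_def)

lemma psi_le_rate_J:
  assumes "c \<in> {c \<in> graphon_classes. lap_norm_class c \<le> \<beta>}"
  shows "psi r \<beta> \<le> rate_J r c"
  unfolding psi_def using assms rate_J_nonneg by (intro cINF_lower bdd_belowI2[of _ 0]) auto

lemma min_rate_le_rate_J:
  assumes "c \<in> {c \<in> graphon_classes. lap_norm_class c \<le> \<beta>}"
  shows "min_rate \<beta> \<le> rate_J r c"
  unfolding rate_J_def using assms mp_bijections_nonempty relabel_rep_sublevel min_rate_le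
  by (intro cINF_greatest) auto

text \<open>The class of an exact minimiser is admissible, which gives one inequality; for the
  other, every relabelling of an admissible representative is itself admissible.\<close>

lemma psi_eq_min_rate:
  assumes \<beta>: "0 \<le> \<beta>" shows "psi r \<beta> = min_rate \<beta>"
proof (rule antisym)
  obtain h where h: "h \<in> sublevel \<beta>" "rate_I r h = min_rate \<beta>" using minimiser_exists[OF \<beta>] .
  note cl = class_sublevel[OF h(1)]
  have "psi r \<beta> \<le> rate_J r (cut_rel `` {h})" using cl by (rule psi_le_rate_J)
  also have "\<dots> \<le> rate_I r h"
    using cl rep_class[OF sublevelD(1)[OF h(1)]] by (intro rate_J_le) auto
  finally show "psi r \<beta> \<le> min_rate \<beta>" using h(2) by simp
  show "min_rate \<beta> \<le> psi r \<beta>"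
    unfolding psi_def using cl min_rate_le_rate_J by (intro cINF_greatest) blast+
qed

text \<open>The minimiser over graphons is unique almost everywhere by strict convexity, and a
  minimising class has relabellings that form a minimising sequence.\<close>

lemma minimisers_singleton:
  assumes \<beta>: "0 \<le> \<beta>"
  obtains c where "c \<in> graphon_classes" "minimisers r \<beta> = {c}"
proof -
  obtain h where h: "h \<in> sublevel \<beta>" "rate_I r h = min_rate \<beta>" using minimiser_exists[OF \<beta>] .
  have hg: "h \<in> graphons" using h(1) by (rule sublevelD)
  note cl = class_sublevel[OF h(1)]
  have "rate_J r (cut_rel `` {h}) \<le> rate_I r h"
    using cl rep_class[OF hg] by (intro rate_J_le) auto
  then have "rate_J r (cut_rel `` {h}) = psi r \<beta>"
    using psi_le_rate_J[OF cl] psi_eq_min_rate[OF \<beta>] h(2) by simp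
  then have 1: "cut_rel `` {h} \<in> minimisers r \<beta>" using cl by (simp add: minimisers_def)
  have 2: "c = cut_rel `` {h}" if "c \<in> minimisers r \<beta>" for c
  proof -
    have c: "c \<in> graphon_classes" "lap_norm_class c \<le> \<beta>" and J: "rate_J r c = min_rate \<beta>"
      using that psi_eq_min_rate[OF \<beta>] by (auto simp: minimisers_def)
    have g: "rep c \<in> graphons" using rep_in(2)[OF c(1)] .
    have "\<exists>\<phi>\<in>mp_bijections. rate_I r (relabel (rep c) \<phi>) < min_rate \<beta> + 1 / real (Suc n)" for n
      using cINF_less_iff[OF mp_bijections_nonempty bdd_below_rate_relabel[OF c(1)], of "min_rate \<beta> + 1 / real (Suc n)"] J
      unfolding rate_J_def by simp
    then obtain \<phi> where \<phi>: "\<And>n. \<phi> n \<in> mp_bijections"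
      "\<And>n. rate_I r (relabel (rep c) (\<phi> n)) < min_rate \<beta> + 1 / real (Suc n)" by metis
    \<comment> \<open>As h minimises exactly, only the excess of the relabelling
      contributes.\<close>
    have d: "sqdist_L2 h (relabel (rep c) (\<phi> n)) \<le> 4 * (1 / real (Suc n))" for n
    proof -
      have "sqdist_L2 h (relabel (rep c) (\<phi> n)) \<le> 4 * ((rate_I r h - min_rate \<beta>) + (rate_I r (relabel (rep c) (\<phi> n)) - min_rate \<beta>))"
        by (rule sqdist_L2_near_minimiser[OF h(1) relabel_rep_sublevel[OF c \<phi>(1)]])
      also have "\<dots> \<le> 4 * (1 / real (Suc n))" using h(2) \<phi>(2)[of n] by (intro mult_left_mono) auto
      finally show ?thesis .
    qed
    have "(\<lambda>n. sqdist_L2 h (relabel (rep c) (\<phi> n))) \<longlonglongrightarrow> 0"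
    proof (rule tendsto_sandwich[OF _ _ tendsto_const])
      show "(\<lambda>n. 4 * (1 / real (Suc n))) \<longlonglongrightarrow> 0"
        using tendsto_mult_left[OF LIMSEQ_inverse_real_of_nat, of 4] by (simp add: inverse_eq_divide)
    qed (intro always_eventually allI d sqdist_L2_nonneg)+
    then have "cut_metric h (rep c) = 0"
      by (rule cut_metric_zero_of_L2[OF hg g \<phi>(1)])
    then have "(h, rep c) \<in> cut_rel" using hg g by (simp add: cut_rel_def)
    then show ?thesis by (rule eq_classI[OF c(1)])
  qed
  show thesis using that[of "cut_rel `` {h}"] 1 2 cl by blast
qed

end

theorem theorem3:
  fixes r :: "real \<Rightarrow> real \<Rightarrow> real" and rN :: "nat \<Rightarrow> real \<Rightarrow> real \<Rightarrow> real"
  assumes r_graphon: "r \<in> graphons"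
    and log_r: "log_in_L1 r"
    and log_1r: "log_in_L1 (\<lambda>x y. 1 - r x y)"
    and rN_graphon: "\<And>N. N \<ge> 1 \<Longrightarrow> rN N \<in> graphons"
    and rN_open: "\<And>N x y. N \<ge> 1 \<Longrightarrow> x \<in> {0..1} \<Longrightarrow> y \<in> {0..1} \<Longrightarrow> 0 < rN N x y \<and> rN N x y < 1"
    and rN_block: "\<And>N. N \<ge> 1 \<Longrightarrow> block_constant N (rN N)"
    and rN_ae: "AE (x, y) in leb_sq. (\<lambda>N. rN N x y) \<longlonglongrightarrow> r x y"
    and rN_L1: "(\<lambda>N. L1_norm_sq (\<lambda>x y. rN N x y - r x y)) \<longlonglongrightarrow> 0"
    and log_rN_L1: "(\<lambda>N. L1_norm_sq (\<lambda>x y. ln (rN N x y) - ln (r x y))) \<longlonglongrightarrow> 0"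
    and log_1rN_L1:
      "(\<lambda>N. L1_norm_sq (\<lambda>x y. ln (1 - rN N x y) - ln (1 - r x y))) \<longlonglongrightarrow> 0"
  shows
    "(\<forall>\<beta>\<in>{0..lap_norm r}. psi r \<beta> = (INF h\<in>{h \<in> graphons. lap_norm h \<le> \<beta>}. rate_I r h)) \<and>
     continuous_on {0..lap_norm r} (psi r) \<and>
     strict_antimono_on {0..lap_norm r} (psi r) \<and>
     psi r 0 = C0 r \<and> C0 r > 0 \<and> psi r (lap_norm r) = 0 \<and>
     (\<forall>\<beta>\<in>{0..lap_norm r}. minimisers r \<beta> \<noteq> {} \<and> compactin graphon_topology (minimisers r \<beta>))"
proof -
  interpret reference_graphon r by unfold_locales (fact r_graphon log_r log_1r)+
  have C: "0 \<le> lap_norm r" using r_graphon by (rule lap_norm_nonneg)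
  have eq: "psi r \<beta> = min_rate \<beta>" if "\<beta> \<in> {0..lap_norm r}" for \<beta>
    using that by (intro psi_eq_min_rate) simp
  have "continuous_on {0..lap_norm r} (psi r)"
    using min_rate_continuous_on by (rule continuous_on_cong[THEN iffD1, rotated 2]) (simp_all add: eq)
  moreover have "strict_antimono_on {0..lap_norm r} (psi r)"
    by (rule monotone_onI) (simp add: eq min_rate_strict_antimono)
  moreover have "minimisers r \<beta> \<noteq> {} \<and> compactin graphon_topology (minimisers r \<beta>)"
    if "\<beta> \<in> {0..lap_norm r}" for \<beta>
  proof -
    have "0 \<le> \<beta>" using that by simp
    then obtain c where "c \<in> graphon_classes" "minimisers r \<beta> = {c}" by (rule minimisers_singleton)
    \<comment> \<open>A singleton contained in the space is compact in any topology.\<close>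
    then show ?thesis by (simp add: topspace_graphon_topology)
  qed
  ultimately show ?thesis
    using eq C min_rate_zero C0_pos min_rate_lap_norm
    by (simp add: min_rate_def sublevel_def)
qed

end
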